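(* Let $R$ be a discrete valuation ring whose residue field has characteristic different from $2$, let $G=\mathbb{Z}/2=\{1,\psi\}$ act on a Frobenius cyclic poset $(\mathcal{X},\mathcal{X}_0)$, let $\mathcal{F}=\mathcal{F}(\mathcal{X},\mathcal{X}_0)$ and let $\mathcal{F}^\psi=\mathcal{F}^G$. Then $\mathcal{F}^\psi$ is a Krull-Schmidt $R$-category whose indecomposable objects are (up to isomorphism): (1) $SX=(X\oplus\psi X,\xi)$ for every regular object $X$ of $\mathcal{F}$, i.e. $X$ indecomposable and not isomorphic to $\psi X$, where $\xi=\begin{bmatrix}0&1\\1&0\end{bmatrix}:\psi X\oplus X\to X\oplus\psi X$; (2) $Z_+(Y)=(Y,\zeta_Y)$ and $Z_-(Y)=(Y,-\zeta_Y)$ for every singular object $Y$ of $\mathcal{F}$, i.e. $Y$ indecomposable with $Y\cong\psi Y$, where $\zeta_Y:\psi Y\cong Y$ is the basic morphism. Furthermore, $\mathcal{F}^\psi$ is a Frobenius category whose indecomposable projective-injective objects are those of the form $SX$, $Z_\pm(Y)$ where $X$, respectively $Y$, are regular, respectively singular, projective-injective objects of $\mathcal{F}$.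
   Context: A reduced cocycle on a set $\mathcal{X}$ is a function $c:\mathcal{X}^3\to\mathbb{N}=\{0,1,2,\dots\}$ with $c(X,Y,Z)-c(W,Y,Z)+c(W,X,Z)-c(W,X,Y)=0$ and $c(X,X,Y)=0=c(X,Y,Y)$ for all $W,X,Y,Z\in\mathcal{X}$. A cyclic poset is a set with a reduced cocycle. Given a cyclic poset $(\mathcal{X},c)$ and a discrete valuation ring $R$ with uniformizer $u$, $\mathcal{P}(\mathcal{X})$ is the $R$-category with object set $\mathcal{X}$, in which each $\mathrm{Hom}(X,Y)$ is a free $R$-module of rank one on a generator $f_{XY}$ (the basic morphism), with $f_{XX}=\mathrm{id}$ and $f_{YZ}\circ f_{XY}=u^{c(X,Y,Z)}f_{XZ}$. Let $\operatorname{add}\mathcal{P}(\mathcal{X})$ be the additive category of finite (ordered) direct sums of objects of $\mathcal{X}$; its indecomposable objects are those isomorphic to elements of $\mathcal{X}$ (in (1),(2) take them to be elements of $\mathcal{X}$). Two elements $X,Y\in\mathcal{X}$ are isomorphic iff $c(X,Y,X)=0$. Let $\mathcal{X}_0\subseteq\mathcal{X}$ be closed under isomorphism. The pair $(\mathcal{X},\mathcal{X}_0)$ is a Frobenius cyclic poset if, for every choice of $(R,u)$, $\operatorname{add}\mathcal{P}(\mathcal{X})$ admits the structure of a Frobenius category with $\mathcal{X}_0$ the set of indecomposable projective-injective objects. This exact structure is then unique ($A\to B\to C$ is exact iff $0\to \mathrm{Hom}(P,A)\to\mathrm{Hom}(P,B)\to\mathrm{Hom}(P,C)\to0$ and $0\to\mathrm{Hom}(C,P)\to\mathrm{Hom}(B,P)\to\mathrm{Hom}(A,P)\to0$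 are exact for all $P\in\operatorname{add}\mathcal{X}_0$), and the Frobenius category is denoted $\mathcal{F}(\mathcal{X},\mathcal{X}_0)$. An action of $\mathbb{Z}/2$ on $(\mathcal{X},\mathcal{X}_0)$ is an involution $\psi$ of $\mathcal{X}$ (with $\psi^2=1$) such that $c(\psi X,\psi Y,\psi Z)=c(X,Y,Z)$ and $\psi\mathcal{X}_0=\mathcal{X}_0$. It induces an $R$-linear involution $\psi$ of $\mathcal{F}$ with $\psi(\bigoplus X_i)=\bigoplus\psi X_i$ and $\psi f_{XY}=f_{\psi X,\psi Y}$. The category $\mathcal{F}^\psi$: objects are pairs $(X,\xi)$ with $X\in\mathcal{F}$ and $\xi:\psi X\to X$ an isomorphism with $\xi\circ\psi(\xi)=\mathrm{id}_X$; a morphism $(X,\xi^X)\to(Y,\xi^Y)$ is a morphism $f:X\to Y$ in $\mathcal{F}$ with $f\circ\xi^X=\xi^Y\circ\psi f$; a sequence is exact if its underlying sequence in $\mathcal{F}$ is exact. *)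

theory Defs
  imports "HOL-Algebra.Ring_Divisibility" "HOL-Algebra.Module" "Jordan_Normal_Form.Matrix"
begin

locale discrete_valuation_ring = principal_domain R for R (structure) +
  assumes unique_nonzero_prime: "\<exists>!I. primeideal I R \<and> I \<noteq> {\<zero>}"

definition uniformizer :: "('r, 'k) ring_scheme \<Rightarrow> 'r \<Rightarrow> bool" where
  "uniformizer R u \<longleftrightarrow> u \<in> carrier R \<and> maximalideal (PIdl\<^bsub>R\<^esub> u) R"

(* Analogue for ring records of the library's CHAR('a) for type classes. *)
definition ring_char :: "('r, 'k) ring_scheme \<Rightarrow> nat" where
  "ring_char R = Gcd {n::nat. [n] \<cdot>\<^bsub>R\<^esub> \<one>\<^bsub>R\<^esub> = \<zero>\<^bsub>R\<^esub>}"

(* Noncommutative rings are allowed. *)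
definition local_ring :: "('r, 'k) ring_scheme \<Rightarrow> bool" where
  "local_ring A \<longleftrightarrow> ring A \<and> \<one>\<^bsub>A\<^esub> \<noteq> \<zero>\<^bsub>A\<^esub> \<and>
     (\<forall>a \<in> carrier A - Units A. \<forall>b \<in> carrier A - Units A. a \<oplus>\<^bsub>A\<^esub> b \<notin> Units A)"

(* Hom-sets need not be disjoint, so composition takes the three objects as arguments:
   Cmp C X Y Z g f is the composite of f : X -> Y followed by g : Y -> Z.
   Only the additive and scalar part of the module record Hom C X Y is used. *)
record ('o, 'm, 'r) lincat =
  Ob :: "'o set"
  Hom :: "'o \<Rightarrow> 'o \<Rightarrow> ('r, 'm) module"
  Cmp :: "'o \<Rightarrow> 'o \<Rightarrow> 'o \<Rightarrow> 'm \<Rightarrow> 'm \<Rightarrow> 'm"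
  Idn :: "'o \<Rightarrow> 'm"

definition arr :: "('o, 'm, 'r) lincat \<Rightarrow> 'o \<Rightarrow> 'o \<Rightarrow> 'm \<Rightarrow> bool" where
  "arr C X Y f \<longleftrightarrow> X \<in> Ob C \<and> Y \<in> Ob C \<and> f \<in> carrier (Hom C X Y)"

locale linear_category = cring R
  for R :: "('r, 'k) ring_scheme" (structure) and C :: "('o, 'm, 'r) lincat" +
  assumes Hom_module: "\<lbrakk>X \<in> Ob C; Y \<in> Ob C\<rbrakk> \<Longrightarrow> module R (Hom C X Y)"
    and Idn_arr: "X \<in> Ob C \<Longrightarrow> arr C X X (Idn C X)"
    and Cmp_arr: "\<lbrakk>arr C X Y f; arr C Y Z g\<rbrakk> \<Longrightarrow> arr C X Z (Cmp C X Y Z g f)"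
    and Cmp_Idn_right: "arr C X Y f \<Longrightarrow> Cmp C X X Y f (Idn C X) = f"
    and Cmp_Idn_left: "arr C X Y f \<Longrightarrow> Cmp C X Y Y (Idn C Y) f = f"
    and Cmp_assoc: "\<lbrakk>arr C W X f; arr C X Y g; arr C Y Z h\<rbrakk> \<Longrightarrow>
      Cmp C W Y Z h (Cmp C W X Y g f) = Cmp C W X Z (Cmp C X Y Z h g) f"
    and Cmp_add_right: "\<lbrakk>arr C X Y f; arr C X Y f'; arr C Y Z g\<rbrakk> \<Longrightarrow>
      Cmp C X Y Z g (f \<oplus>\<^bsub>Hom C X Y\<^esub> f') = Cmp C X Y Z g f \<oplus>\<^bsub>Hom C X Z\<^esub> Cmp C X Y Z g f'"
    and Cmp_add_left: "\<lbrakk>arr C X Y f; arr C Y Z g; arr C Y Z g'\<rbrakk> \<Longrightarrow>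
      Cmp C X Y Z (g \<oplus>\<^bsub>Hom C Y Z\<^esub> g') f = Cmp C X Y Z g f \<oplus>\<^bsub>Hom C X Z\<^esub> Cmp C X Y Z g' f"
    and Cmp_smult_right: "\<lbrakk>r \<in> carrier R; arr C X Y f; arr C Y Z g\<rbrakk> \<Longrightarrow>
      Cmp C X Y Z g (r \<odot>\<^bsub>Hom C X Y\<^esub> f) = r \<odot>\<^bsub>Hom C X Z\<^esub> Cmp C X Y Z g f"
    and Cmp_smult_left: "\<lbrakk>r \<in> carrier R; arr C X Y f; arr C Y Z g\<rbrakk> \<Longrightarrow>
      Cmp C X Y Z (r \<odot>\<^bsub>Hom C Y Z\<^esub> g) f = r \<odot>\<^bsub>Hom C X Z\<^esub> Cmp C X Y Z g f"

definition iso_arr :: "('o, 'm, 'r) lincat \<Rightarrow> 'o \<Rightarrow> 'o \<Rightarrow> 'm \<Rightarrow> bool" where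
  "iso_arr C X Y f \<longleftrightarrow> arr C X Y f \<and>
     (\<exists>g. arr C Y X g \<and> Cmp C X Y X g f = Idn C X \<and> Cmp C Y X Y f g = Idn C Y)"

definition isomorphic :: "('o, 'm, 'r) lincat \<Rightarrow> 'o \<Rightarrow> 'o \<Rightarrow> bool" where
  "isomorphic C X Y \<longleftrightarrow> (\<exists>f. iso_arr C X Y f)"

definition zero_object :: "('o, 'm, 'r) lincat \<Rightarrow> 'o \<Rightarrow> bool" where
  "zero_object C Z \<longleftrightarrow> Z \<in> Ob C \<and>
     (\<forall>X \<in> Ob C. carrier (Hom C X Z) = {\<zero>\<^bsub>Hom C X Z\<^esub>} \<and> carrier (Hom C Z X) = {\<zero>\<^bsub>Hom C Z X\<^esub>})"

definition direct_sum :: "('o, 'm, 'r) lincat \<Rightarrow> 'o \<Rightarrow> 'o list \<Rightarrow> bool" where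
  "direct_sum C X As \<longleftrightarrow> X \<in> Ob C \<and> (\<exists>\<iota> \<pi>.
     (\<forall>k < length As. arr C (As ! k) X (\<iota> k) \<and> arr C X (As ! k) (\<pi> k)) \<and>
     (\<forall>k < length As. \<forall>l < length As.
        Cmp C (As ! k) X (As ! l) (\<pi> l) (\<iota> k) =
          (if k = l then Idn C (As ! k) else \<zero>\<^bsub>Hom C (As ! k) (As ! l)\<^esub>)) \<and>
     finsum (Hom C X X) (\<lambda>k. Cmp C X (As ! k) X (\<iota> k) (\<pi> k)) {..<length As} = Idn C X)"

definition indecomposable :: "('o, 'm, 'r) lincat \<Rightarrow> 'o \<Rightarrow> bool" where
  "indecomposable C X \<longleftrightarrow> X \<in> Ob C \<and> \<not> zero_object C X \<and>
     (\<forall>A B. direct_sum C X [A, B] \<longrightarrow> zero_object C A \<or> zero_object C B)"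

locale additive_category = linear_category R C
  for R :: "('r, 'k) ring_scheme" (structure) and C :: "('o, 'm, 'r) lincat" +
  assumes ex_zero_object: "\<exists>Z. zero_object C Z"
    and ex_direct_sum: "\<lbrakk>A \<in> Ob C; B \<in> Ob C\<rbrakk> \<Longrightarrow> \<exists>X. direct_sum C X [A, B]"

definition End_ring :: "('o, 'm, 'r) lincat \<Rightarrow> 'o \<Rightarrow> 'm ring" where
  "End_ring C X = \<lparr>carrier = carrier (Hom C X X), mult = Cmp C X X X, one = Idn C X,
     zero = \<zero>\<^bsub>Hom C X X\<^esub>, add = add (Hom C X X)\<rparr>"

locale krull_schmidt_category = additive_category R C
  for R :: "('r, 'k) ring_scheme" (structure) and C :: "('o, 'm, 'r) lincat" +
  assumes krull_schmidt: "X \<in> Ob C \<Longrightarrow>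
    \<exists>As. direct_sum C X As \<and> (\<forall>A \<in> set As. local_ring (End_ring C A))"

(* The objects satisfying Q are, up to isomorphism, the elements of L. *)
definition objects_up_to_iso :: "('o, 'm, 'r) lincat \<Rightarrow> ('o \<Rightarrow> bool) \<Rightarrow> 'o set \<Rightarrow> bool" where
  "objects_up_to_iso C Q L \<longleftrightarrow>
     (\<forall>A \<in> L. A \<in> Ob C \<and> Q A) \<and> (\<forall>A \<in> Ob C. Q A \<longrightarrow> (\<exists>B \<in> L. isomorphic C A B))"

definition is_kernel :: "('o, 'm, 'r) lincat \<Rightarrow> 'o \<Rightarrow> 'o \<Rightarrow> 'o \<Rightarrow> 'm \<Rightarrow> 'm \<Rightarrow> bool" where
  "is_kernel C X Y Z f g \<longleftrightarrow> arr C X Y f \<and> arr C Y Z g \<and> Cmp C X Y Z g f = \<zero>\<^bsub>Hom C X Z\<^esub> \<and>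
     (\<forall>T t. arr C T Y t \<and> Cmp C T Y Z g t = \<zero>\<^bsub>Hom C T Z\<^esub> \<longrightarrow>
        (\<exists>!s. arr C T X s \<and> Cmp C T X Y f s = t))"

definition is_cokernel :: "('o, 'm, 'r) lincat \<Rightarrow> 'o \<Rightarrow> 'o \<Rightarrow> 'o \<Rightarrow> 'm \<Rightarrow> 'm \<Rightarrow> bool" where
  "is_cokernel C X Y Z f g \<longleftrightarrow> arr C X Y f \<and> arr C Y Z g \<and> Cmp C X Y Z g f = \<zero>\<^bsub>Hom C X Z\<^esub> \<and>
     (\<forall>T t. arr C Y T t \<and> Cmp C X Y T t f = \<zero>\<^bsub>Hom C X T\<^esub> \<longrightarrow>
        (\<exists>!s. arr C Z T s \<and> Cmp C Y Z T s g = t))"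

(* Square with i : A -> B, f : A -> A', i' : A' -> B', f' : B -> B'. *)
definition is_pushout ::
  "('o, 'm, 'r) lincat \<Rightarrow> 'o \<Rightarrow> 'o \<Rightarrow> 'o \<Rightarrow> 'o \<Rightarrow> 'm \<Rightarrow> 'm \<Rightarrow> 'm \<Rightarrow> 'm \<Rightarrow> bool" where
  "is_pushout C A B A' B' i f i' f' \<longleftrightarrow>
     arr C A B i \<and> arr C A A' f \<and> arr C A' B' i' \<and> arr C B B' f' \<and>
     Cmp C A B B' f' i = Cmp C A A' B' i' f \<and>
     (\<forall>T b a. arr C B T b \<and> arr C A' T a \<and> Cmp C A B T b i = Cmp C A A' T a f \<longrightarrow>
        (\<exists>!h. arr C B' T h \<and> Cmp C B B' T h f' = b \<and> Cmp C A' B' T h i' = a))"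

(* Square with p : B -> C0, f : C1 -> C0, p' : B' -> C1, f' : B' -> B. *)
definition is_pullback ::
  "('o, 'm, 'r) lincat \<Rightarrow> 'o \<Rightarrow> 'o \<Rightarrow> 'o \<Rightarrow> 'o \<Rightarrow> 'm \<Rightarrow> 'm \<Rightarrow> 'm \<Rightarrow> 'm \<Rightarrow> bool" where
  "is_pullback C B C0 B' C1 p f p' f' \<longleftrightarrow>
     arr C B C0 p \<and> arr C C1 C0 f \<and> arr C B' C1 p' \<and> arr C B' B f' \<and>
     Cmp C B' B C0 p f' = Cmp C B' C1 C0 f p' \<and>
     (\<forall>T b a. arr C T B b \<and> arr C T C1 a \<and> Cmp C T B C0 p b = Cmp C T C1 C0 f a \<longrightarrow>
        (\<exists>!h. arr C T B' h \<and> Cmp C T B' B f' h = b \<and> Cmp C T B' C1 p' h = a))"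

(* E X Y Z f g means that X -f-> Y -g-> Z belongs to the class of exact sequences. *)
type_synonym ('o, 'm) seq_class = "'o \<Rightarrow> 'o \<Rightarrow> 'o \<Rightarrow> 'm \<Rightarrow> 'm \<Rightarrow> bool"

definition inflation :: "('o, 'm) seq_class \<Rightarrow> 'o \<Rightarrow> 'o \<Rightarrow> 'm \<Rightarrow> bool" where
  "inflation E X Y f \<longleftrightarrow> (\<exists>Z g. E X Y Z f g)"

definition deflation :: "('o, 'm) seq_class \<Rightarrow> 'o \<Rightarrow> 'o \<Rightarrow> 'm \<Rightarrow> bool" where
  "deflation E Y Z g \<longleftrightarrow> (\<exists>X f. E X Y Z f g)"

locale exact_category = additive_category R C
  for R :: "('r, 'k) ring_scheme" (structure) and C :: "('o, 'm, 'r) lincat" +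
  fixes E :: "('o, 'm) seq_class"
  assumes kernel_cokernel: "E X Y Z f g \<Longrightarrow> is_kernel C X Y Z f g \<and> is_cokernel C X Y Z f g"
    and iso_closed: "\<lbrakk>E X Y Z f g; arr C X' Y' f'; arr C Y' Z' g';
      iso_arr C X X' a; iso_arr C Y Y' b; iso_arr C Z Z' d;
      Cmp C X Y Y' b f = Cmp C X X' Y' f' a; Cmp C Y Z Z' d g = Cmp C Y Y' Z' g' b\<rbrakk>
      \<Longrightarrow> E X' Y' Z' f' g'"
    and Idn_inflation: "X \<in> Ob C \<Longrightarrow> inflation E X X (Idn C X)"
    and Idn_deflation: "X \<in> Ob C \<Longrightarrow> deflation E X X (Idn C X)"
    and Cmp_inflation: "\<lbrakk>inflation E X Y f; inflation E Y Z g\<rbrakk> \<Longrightarrow> inflation E X Z (Cmp C X Y Z g f)"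
    and Cmp_deflation: "\<lbrakk>deflation E X Y f; deflation E Y Z g\<rbrakk> \<Longrightarrow> deflation E X Z (Cmp C X Y Z g f)"
    and pushout_inflation: "\<lbrakk>inflation E A B i; arr C A A' f\<rbrakk> \<Longrightarrow>
      \<exists>B' i' f'. is_pushout C A B A' B' i f i' f' \<and> inflation E A' B' i'"
    and pullback_deflation: "\<lbrakk>deflation E B C0 p; arr C C1 C0 f\<rbrakk> \<Longrightarrow>
      \<exists>B' p' f'. is_pullback C B C0 B' C1 p f p' f' \<and> deflation E B' C1 p'"

definition projective :: "('o, 'm, 'r) lincat \<Rightarrow> ('o, 'm) seq_class \<Rightarrow> 'o \<Rightarrow> bool" where
  "projective C E P \<longleftrightarrow> P \<in> Ob C \<and>
     (\<forall>Y Z g h. deflation E Y Z g \<and> arr C P Z h \<longrightarrow> (\<exists>k. arr C P Y k \<and> Cmp C P Y Z g k = h))"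

definition injective :: "('o, 'm, 'r) lincat \<Rightarrow> ('o, 'm) seq_class \<Rightarrow> 'o \<Rightarrow> bool" where
  "injective C E I \<longleftrightarrow> I \<in> Ob C \<and>
     (\<forall>X Y f h. inflation E X Y f \<and> arr C X I h \<longrightarrow> (\<exists>k. arr C Y I k \<and> Cmp C X Y I k f = h))"

definition proj_inj :: "('o, 'm, 'r) lincat \<Rightarrow> ('o, 'm) seq_class \<Rightarrow> 'o \<Rightarrow> bool" where
  "proj_inj C E A \<longleftrightarrow> projective C E A \<and> injective C E A"

locale frobenius_category = exact_category R C E
  for R :: "('r, 'k) ring_scheme" (structure) and C :: "('o, 'm, 'r) lincat"
    and E :: "('o, 'm) seq_class" +
  assumes enough_projectives: "X \<in> Ob C \<Longrightarrow> \<exists>P g. projective C E P \<and> deflation E P X g"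
    and enough_injectives: "X \<in> Ob C \<Longrightarrow> \<exists>I f. injective C E I \<and> inflation E X I f"
    and projective_iff_injective: "projective C E A \<longleftrightarrow> injective C E A"

definition reduced_cocycle :: "'x set \<Rightarrow> ('x \<Rightarrow> 'x \<Rightarrow> 'x \<Rightarrow> nat) \<Rightarrow> bool" where
  "reduced_cocycle \<X> c \<longleftrightarrow>
     (\<forall>w \<in> \<X>. \<forall>x \<in> \<X>. \<forall>y \<in> \<X>. \<forall>z \<in> \<X>.
        int (c x y z) - int (c w y z) + int (c w x z) - int (c w x y) = 0) \<and>
     (\<forall>x \<in> \<X>. \<forall>y \<in> \<X>. c x x y = 0 \<and> c x y y = 0)"

(* The scalar r in Hom x y stands for r times the basic morphism f_xy. *)
definition P_cat :: "('r, 'k) ring_scheme \<Rightarrow> 'r \<Rightarrow> 'x set \<Rightarrow> ('x \<Rightarrow> 'x \<Rightarrow> 'x \<Rightarrow> nat) \<Rightarrow>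
    ('x, 'r, 'r) lincat" where
  "P_cat R u \<X> c = \<lparr>Ob = \<X>,
     Hom = (\<lambda>x y. \<lparr>carrier = carrier R, mult = mult R, one = \<one>\<^bsub>R\<^esub>,
                     zero = \<zero>\<^bsub>R\<^esub>, add = add R, smult = mult R\<rparr>),
     Cmp = (\<lambda>x y z g f. (u [^]\<^bsub>R\<^esub> c x y z) \<otimes>\<^bsub>R\<^esub> (g \<otimes>\<^bsub>R\<^esub> f)),
     Idn = (\<lambda>x. \<one>\<^bsub>R\<^esub>)\<rparr>"

(* Additive closure: the list A stands for the direct sum of the A ! j; the entry (i, j) of a
   morphism A -> B is its component A ! j -> B ! i. *)
definition add_cat :: "('o, 'm, 'r) lincat \<Rightarrow> ('o list, 'm mat, 'r) lincat" where
  "add_cat C = \<lparr>Ob = {A. set A \<subseteq> Ob C},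
     Hom = (\<lambda>A B. \<lparr>
       carrier = {M \<in> carrier_mat (length B) (length A).
         \<forall>i < length B. \<forall>j < length A. M $$ (i, j) \<in> carrier (Hom C (A ! j) (B ! i))},
       mult = undefined, one = undefined,
       zero = mat (length B) (length A) (\<lambda>(i, j). \<zero>\<^bsub>Hom C (A ! j) (B ! i)\<^esub>),
       add = (\<lambda>M N. mat (length B) (length A)
         (\<lambda>(i, j). M $$ (i, j) \<oplus>\<^bsub>Hom C (A ! j) (B ! i)\<^esub> N $$ (i, j))),
       smult = (\<lambda>r M. mat (length B) (length A)
         (\<lambda>(i, j). r \<odot>\<^bsub>Hom C (A ! j) (B ! i)\<^esub> M $$ (i, j)))\<rparr>),
     Cmp = (\<lambda>A B D N M. mat (length D) (length A) (\<lambda>(i, k).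
       finsum (Hom C (A ! k) (D ! i))
         (\<lambda>j. Cmp C (A ! k) (B ! j) (D ! i) (N $$ (i, j)) (M $$ (j, k))) {..<length B})),
     Idn = (\<lambda>A. mat (length A) (length A)
       (\<lambda>(i, j). if i = j then Idn C (A ! i) else \<zero>\<^bsub>Hom C (A ! j) (A ! i)\<^esub>))\<rparr>"

abbreviation addP :: "('r, 'k) ring_scheme \<Rightarrow> 'r \<Rightarrow> 'x set \<Rightarrow> ('x \<Rightarrow> 'x \<Rightarrow> 'x \<Rightarrow> nat) \<Rightarrow>
    ('x list, 'r mat, 'r) lincat" where
  "addP R u \<X> c \<equiv> add_cat (P_cat R u \<X> c)"

(* HOL cannot quantify over types inside a formula, so the rings R below range over all
   discrete valuation rings whose carrier is a subset of the type 'r. *)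
definition frobenius_cyclic_poset ::
  "'r itself \<Rightarrow> 'x set \<Rightarrow> ('x \<Rightarrow> 'x \<Rightarrow> 'x \<Rightarrow> nat) \<Rightarrow> 'x set \<Rightarrow> bool" where
  "frobenius_cyclic_poset TYPE('r) \<X> c \<X>\<^sub>0 \<longleftrightarrow>
     reduced_cocycle \<X> c \<and> \<X>\<^sub>0 \<subseteq> \<X> \<and>
     (\<forall>x \<in> \<X>\<^sub>0. \<forall>y \<in> \<X>. c x y x = 0 \<longrightarrow> y \<in> \<X>\<^sub>0) \<and>
     (\<forall>(R :: 'r ring) u. discrete_valuation_ring R \<and> uniformizer R u \<longrightarrow>
        (\<exists>E. frobenius_category R (addP R u \<X> c) E \<and>
           objects_up_to_iso (addP R u \<X> c)
             (\<lambda>A. indecomposable (addP R u \<X> c) A \<and> proj_inj (addP R u \<X> c) E A)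
             {[x] |x. x \<in> \<X>\<^sub>0}))"

(* 0 -> L -> M -> N -> 0 *)
definition short_exact ::
  "('r, 'm) module \<Rightarrow> ('r, 'm) module \<Rightarrow> ('r, 'm) module \<Rightarrow> ('m \<Rightarrow> 'm) \<Rightarrow> ('m \<Rightarrow> 'm) \<Rightarrow> bool" where
  "short_exact L M N \<phi> \<gamma> \<longleftrightarrow> inj_on \<phi> (carrier L) \<and>
     \<phi> ` carrier L = {m \<in> carrier M. \<gamma> m = \<zero>\<^bsub>N\<^esub>} \<and> \<gamma> ` carrier M = carrier N"

(* The exact structure of F(X, X0) on C = addP R u X c: for a Frobenius cyclic poset it is the only
   one making C a Frobenius category with X0 the set of indecomposable projective-injectives. *)
definition F_exact :: "('x list, 'm, 'r) lincat \<Rightarrow> 'x set \<Rightarrow> ('x list, 'm) seq_class" where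
  "F_exact C \<X>\<^sub>0 A B D f g \<longleftrightarrow> arr C A B f \<and> arr C B D g \<and>
     (\<forall>P. set P \<subseteq> \<X>\<^sub>0 \<longrightarrow>
        short_exact (Hom C P A) (Hom C P B) (Hom C P D) (Cmp C P A B f) (Cmp C P B D g) \<and>
        short_exact (Hom C D P) (Hom C B P) (Hom C A P)
          (\<lambda>h. Cmp C B D P h g) (\<lambda>h. Cmp C A B P h f))"

definition involution_action ::
  "'x set \<Rightarrow> ('x \<Rightarrow> 'x \<Rightarrow> 'x \<Rightarrow> nat) \<Rightarrow> 'x set \<Rightarrow> ('x \<Rightarrow> 'x) \<Rightarrow> bool" where
  "involution_action \<X> c \<X>\<^sub>0 \<psi> \<longleftrightarrow>
     (\<forall>x \<in> \<X>. \<psi> x \<in> \<X> \<and> \<psi> (\<psi> x) = x) \<and>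
     (\<forall>x \<in> \<X>. \<forall>y \<in> \<X>. \<forall>z \<in> \<X>. c (\<psi> x) (\<psi> y) (\<psi> z) = c x y z) \<and>
     \<psi> ` \<X>\<^sub>0 = \<X>\<^sub>0"

(* C^psi for an involutive endofunctor psi of C given by To on objects and Tm X Y on Hom C X Y. *)
definition equivariant_cat :: "('o, 'm, 'r) lincat \<Rightarrow> ('o \<Rightarrow> 'o) \<Rightarrow> ('o \<Rightarrow> 'o \<Rightarrow> 'm \<Rightarrow> 'm) \<Rightarrow>
    ('o \<times> 'm, 'm, 'r) lincat" where
  "equivariant_cat C To Tm = \<lparr>
     Ob = {(X, \<xi>). X \<in> Ob C \<and> iso_arr C (To X) X \<xi> \<and>
       Cmp C (To (To X)) (To X) X \<xi> (Tm (To X) X \<xi>) = Idn C X},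
     Hom = (\<lambda>(X, \<xi>) (Y, \<upsilon>). (Hom C X Y)\<lparr>carrier :=
       {f \<in> carrier (Hom C X Y).
         Cmp C (To X) X Y f \<xi> = Cmp C (To X) (To Y) Y \<upsilon> (Tm X Y f)}\<rparr>),
     Cmp = (\<lambda>X Y Z. Cmp C (fst X) (fst Y) (fst Z)),
     Idn = (\<lambda>X. Idn C (fst X))\<rparr>"

definition equivariant_exact :: "('o \<times> 'm, 'm, 'r) lincat \<Rightarrow> ('o, 'm) seq_class \<Rightarrow>
    ('o \<times> 'm, 'm) seq_class" where
  "equivariant_exact D E X Y Z f g \<longleftrightarrow>
     arr D X Y f \<and> arr D Y Z g \<and> E (fst X) (fst Y) (fst Z) f g"

(* psi acts on objects componentwise. A morphism and its image under psi have the same matrix, with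
   respect to the basic morphisms f_xy and f_(psi x)(psi y) respectively. *)
abbreviation F_psi :: "('r, 'k) ring_scheme \<Rightarrow> 'r \<Rightarrow> 'x set \<Rightarrow> ('x \<Rightarrow> 'x \<Rightarrow> 'x \<Rightarrow> nat) \<Rightarrow>
    ('x \<Rightarrow> 'x) \<Rightarrow> ('x list \<times> 'r mat, 'r mat, 'r) lincat" where
  "F_psi R u \<X> c \<psi> \<equiv> equivariant_cat (addP R u \<X> c) (map \<psi>) (\<lambda>A B M. M)"

abbreviation F_psi_exact :: "('r, 'k) ring_scheme \<Rightarrow> 'r \<Rightarrow> 'x set \<Rightarrow> ('x \<Rightarrow> 'x \<Rightarrow> 'x \<Rightarrow> nat) \<Rightarrow>
    'x set \<Rightarrow> ('x \<Rightarrow> 'x) \<Rightarrow> ('x list \<times> 'r mat, 'r mat) seq_class" where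
  "F_psi_exact R u \<X> c \<X>\<^sub>0 \<psi> \<equiv>
     equivariant_exact (F_psi R u \<X> c \<psi>) (F_exact (addP R u \<X> c) \<X>\<^sub>0)"

definition regular :: "('x list, 'm, 'r) lincat \<Rightarrow> ('x \<Rightarrow> 'x) \<Rightarrow> 'x \<Rightarrow> bool" where
  "regular C \<psi> x \<longleftrightarrow> indecomposable C [x] \<and> \<not> isomorphic C [x] [\<psi> x]"

definition singular :: "('x list, 'm, 'r) lincat \<Rightarrow> ('x \<Rightarrow> 'x) \<Rightarrow> 'x \<Rightarrow> bool" where
  "singular C \<psi> y \<longleftrightarrow> indecomposable C [y] \<and> isomorphic C [y] [\<psi> y]"

definition S_ob :: "('r, 'k) ring_scheme \<Rightarrow> ('x \<Rightarrow> 'x) \<Rightarrow> 'x \<Rightarrow> 'x list \<times> 'r mat" where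
  "S_ob R \<psi> x = ([x, \<psi> x], mat 2 2 (\<lambda>(i, j). if i = j then \<zero>\<^bsub>R\<^esub> else \<one>\<^bsub>R\<^esub>))"

(* Matrix of the basic morphism psi y -> y. *)
definition zeta :: "('r, 'k) ring_scheme \<Rightarrow> 'r mat" where
  "zeta R = mat 1 1 (\<lambda>_. \<one>\<^bsub>R\<^esub>)"

definition Z_plus :: "('r, 'k) ring_scheme \<Rightarrow> 'x \<Rightarrow> 'x list \<times> 'r mat" where
  "Z_plus R y = ([y], zeta R)"

definition Z_minus :: "('r, 'k) ring_scheme \<Rightarrow> ('x list, 'r mat, 'r) lincat \<Rightarrow> ('x \<Rightarrow> 'x) \<Rightarrow>
    'x \<Rightarrow> 'x list \<times> 'r mat" where
  "Z_minus R C \<psi> y = ([y], \<ominus>\<^bsub>Hom C [\<psi> y] [y]\<^esub> zeta R)"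

end

theory Submission
  imports Defs
begin

text \<open>Let \<open>\<psi>\<close> act on a Frobenius category \<open>\<F>\<close> by a strict involution. Both halves of the theorem
  compare \<open>\<F>\<^sup>\<psi>\<close> with \<open>\<F>\<close> along the forgetful functor. Since \<open>2\<close> is invertible, averaging over the
  group is available throughout.

  \<^bold>\<open>Exactness.\<close> For objects \<open>(X, \<xi>)\<close> and \<open>(Y, \<upsilon>)\<close> of \<open>\<F>\<^sup>\<psi>\<close> the group acts on all morphisms \<open>X \<rightarrow> Y\<close>
  by \<open>f \<mapsto> \<upsilon> \<circ> \<psi>f \<circ> \<psi>\<xi>\<close>, called \<open>twist\<close> below, and the equivariant morphisms are the fixed points.
  A kernel, cokernel, pushout or pullback in \<open>\<F>\<close> of equivariant data carries a unique compatible
  structure and keeps its universal property in \<open>\<F>\<^sup>\<psi>\<close>, because a solution which is unique is fixed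
  by the action. So a morphism of \<open>\<F>\<^sup>\<psi>\<close> is an inflation or deflation if and only if it is one in
  \<open>\<F>\<close> (\<open>inflation_D_iff\<close>, \<open>deflation_D_iff\<close>), and the axioms of an exact category are inherited.
  Averaging shows that \<open>(P, \<rho>)\<close> is projective whenever \<open>P\<close> is. The free objects \<open>P \<oplus> \<psi>P\<close> on
  projective \<open>P\<close>, with the swap as structure, provide enough projectives; splitting such a cover
  gives the converse, and the dual arguments treat injectives (\<open>projective_D_iff\<close>,
  \<open>injective_D_iff\<close>). Hence \<open>\<F>\<^sup>\<psi>\<close> is a Frobenius category whose projective-injective objects are
  those lying over projective-injective objects of \<open>\<F>\<close>.

  The hypothesis only provides \<^emph>\<open>some\<close> exact structure on \<open>add \<P>(\<X>)\<close>. That it is the one defined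
  through the functors \<open>Hom(P, -)\<close> and \<open>Hom(-, P)\<close>, and is therefore invariant under \<open>\<psi>\<close>, is
  \<open>F_exact_unique\<close>. It rests on the fact that a kernel-cokernel pair is exact as soon as a
  deflation factors through its second arrow (\<open>exact_of_factored_deflation\<close>).

  \<^bold>\<open>Decomposition.\<close> Let \<open>(X, \<xi>)\<close> be an object with \<open>X = x \<oplus> X'\<close>, and let \<open>e\<close> and \<open>p\<close> be the
  inclusion and the projection of \<open>x\<close>. If \<open>x\<close> is regular, \<open>e\<close> and \<open>p\<close> induce equivariant maps
  \<open>Sx \<rightarrow> X \<rightarrow> Sx\<close>, whose composite is a matrix with rows \<open>(1, a)\<close> and \<open>(a, 1)\<close>; its determinant is
  \<open>1 - u\<^sup>n a\<^sup>2\<close> with \<open>n > 0\<close>, so it is invertible (\<open>regular_split\<close>). If \<open>x\<close> is singular,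
  symmetrizing \<open>e\<close> and \<open>p\<close> with respect to \<open>\<plusminus>\<zeta>\<close> gives equivariant maps \<open>Z\<^sub>\<plusminus>(x) \<rightarrow> X \<rightarrow> Z\<^sub>\<plusminus>(x)\<close> with
  composite \<open>2(1 \<plusminus> \<alpha>)\<close>, and one of \<open>1 + \<alpha>\<close>, \<open>1 - \<alpha>\<close> is a unit because their sum \<open>2\<close> is
  (\<open>singular_split\<close>). In both cases one of the listed objects is a retract. Its complement in
  \<open>add \<P>(\<X>)\<close> exists by the exchange argument \<open>retract_complement\<close> and inherits an equivariant
  structure (\<open>equivariant_complement\<close>), so induction on the number of summands of \<open>X\<close> yields a
  decomposition. The listed objects have local endomorphism rings, namely \<open>R\<close> for \<open>Z\<^sub>\<plusminus>(y)\<close> and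
  \<open>R[\<surd>u\<^sup>n]\<close> for \<open>Sx\<close>.\<close>

section \<open>Linear categories and biproducts\<close>

context linear_category
begin

lemma arr_Ob: "arr C X Y f \<Longrightarrow> X \<in> Ob C \<and> Y \<in> Ob C"
  by (simp add: arr_def)

lemma Hom_abelian_group: "\<lbrakk>X \<in> Ob C; Y \<in> Ob C\<rbrakk> \<Longrightarrow> abelian_group (Hom C X Y)"
  using Hom_module module.axioms by blast

lemma Hom_abelian_monoid: "\<lbrakk>X \<in> Ob C; Y \<in> Ob C\<rbrakk> \<Longrightarrow> abelian_monoid (Hom C X Y)"
  using Hom_abelian_group abelian_group.axioms(1) by blast

text \<open>The laws of the Hom modules are restated with \<open>arr\<close> in place of membership in a carrier:
  sums and composites can then be rewritten together, since every side condition has the form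
  \<open>arr C X Y f\<close> and determines its objects.\<close>

lemma arr_zero [simp]: "\<lbrakk>X \<in> Ob C; Y \<in> Ob C\<rbrakk> \<Longrightarrow> arr C X Y \<zero>\<^bsub>Hom C X Y\<^esub>"
  by (simp add: arr_def abelian_monoid.zero_closed Hom_abelian_monoid)

lemma arr_add [simp]:
  "\<lbrakk>arr C X Y f; arr C X Y g\<rbrakk> \<Longrightarrow> arr C X Y (f \<oplus>\<^bsub>Hom C X Y\<^esub> g)"
  by (simp add: arr_def abelian_monoid.a_closed Hom_abelian_monoid)

lemma arr_minus [simp]: "arr C X Y f \<Longrightarrow> arr C X Y (\<ominus>\<^bsub>Hom C X Y\<^esub> f)"
  by (simp add: arr_def abelian_group.a_inv_closed Hom_abelian_group)

lemma arr_smult [simp]: "\<lbrakk>r \<in> carrier R; arr C X Y f\<rbrakk> \<Longrightarrow> arr C X Y (r \<odot>\<^bsub>Hom C X Y\<^esub> f)"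
  by (auto simp: arr_def intro: module.smult_closed[OF Hom_module])

declare Cmp_arr [simp] Idn_arr [simp] Cmp_Idn_right [simp] Cmp_Idn_left [simp]

lemma hom_assoc: "\<lbrakk>arr C X Y f; arr C X Y g; arr C X Y h\<rbrakk> \<Longrightarrow>
    (f \<oplus>\<^bsub>Hom C X Y\<^esub> g) \<oplus>\<^bsub>Hom C X Y\<^esub> h = f \<oplus>\<^bsub>Hom C X Y\<^esub> (g \<oplus>\<^bsub>Hom C X Y\<^esub> h)"
  by (simp add: arr_def abelian_monoid.a_assoc Hom_abelian_monoid)

lemma hom_comm: "\<lbrakk>arr C X Y f; arr C X Y g\<rbrakk> \<Longrightarrow> f \<oplus>\<^bsub>Hom C X Y\<^esub> g = g \<oplus>\<^bsub>Hom C X Y\<^esub> f"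
  by (simp add: arr_def abelian_monoid.a_comm Hom_abelian_monoid)

lemma hom_lcomm: "\<lbrakk>arr C X Y f; arr C X Y g; arr C X Y h\<rbrakk> \<Longrightarrow>
    f \<oplus>\<^bsub>Hom C X Y\<^esub> (g \<oplus>\<^bsub>Hom C X Y\<^esub> h) = g \<oplus>\<^bsub>Hom C X Y\<^esub> (f \<oplus>\<^bsub>Hom C X Y\<^esub> h)"
  by (simp add: arr_def abelian_monoid.a_lcomm Hom_abelian_monoid)

lemma hom_l_zero [simp]: "arr C X Y f \<Longrightarrow> \<zero>\<^bsub>Hom C X Y\<^esub> \<oplus>\<^bsub>Hom C X Y\<^esub> f = f"
  by (simp add: arr_def abelian_monoid.l_zero Hom_abelian_monoid)

lemma hom_r_zero [simp]: "arr C X Y f \<Longrightarrow> f \<oplus>\<^bsub>Hom C X Y\<^esub> \<zero>\<^bsub>Hom C X Y\<^esub> = f"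
  by (simp add: arr_def abelian_monoid.r_zero Hom_abelian_monoid)

lemma hom_r_neg [simp]: "arr C X Y f \<Longrightarrow> f \<oplus>\<^bsub>Hom C X Y\<^esub> \<ominus>\<^bsub>Hom C X Y\<^esub> f = \<zero>\<^bsub>Hom C X Y\<^esub>"
  by (simp add: arr_def abelian_group.r_neg Hom_abelian_group)

lemma hom_l_neg [simp]: "arr C X Y f \<Longrightarrow> \<ominus>\<^bsub>Hom C X Y\<^esub> f \<oplus>\<^bsub>Hom C X Y\<^esub> f = \<zero>\<^bsub>Hom C X Y\<^esub>"
  by (simp add: arr_def abelian_group.l_neg Hom_abelian_group)

lemma hom_r_neg1 [simp]: "\<lbrakk>arr C X Y f; arr C X Y g\<rbrakk> \<Longrightarrow>
    \<ominus>\<^bsub>Hom C X Y\<^esub> f \<oplus>\<^bsub>Hom C X Y\<^esub> (f \<oplus>\<^bsub>Hom C X Y\<^esub> g) = g"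
  by (simp add: arr_def abelian_group.r_neg1 Hom_abelian_group)

lemma hom_minus_add: "\<lbrakk>arr C X Y f; arr C X Y g\<rbrakk> \<Longrightarrow>
    \<ominus>\<^bsub>Hom C X Y\<^esub> (f \<oplus>\<^bsub>Hom C X Y\<^esub> g) = \<ominus>\<^bsub>Hom C X Y\<^esub> f \<oplus>\<^bsub>Hom C X Y\<^esub> \<ominus>\<^bsub>Hom C X Y\<^esub> g"
  by (simp add: arr_def abelian_group.minus_add Hom_abelian_group)

lemma hom_minus_minus [simp]: "arr C X Y f \<Longrightarrow> \<ominus>\<^bsub>Hom C X Y\<^esub> (\<ominus>\<^bsub>Hom C X Y\<^esub> f) = f"
  by (simp add: arr_def abelian_group.minus_minus Hom_abelian_group)

lemma hom_add_cancel: "\<lbrakk>arr C X Y f; arr C X Y g; arr C X Y h\<rbrakk> \<Longrightarrow>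
    f \<oplus>\<^bsub>Hom C X Y\<^esub> g = f \<oplus>\<^bsub>Hom C X Y\<^esub> h \<longleftrightarrow> g = h"
  by (metis hom_r_neg1)

lemma hom_minus_unique:
  "\<lbrakk>arr C X Y f; arr C X Y g; f \<oplus>\<^bsub>Hom C X Y\<^esub> g = \<zero>\<^bsub>Hom C X Y\<^esub>\<rbrakk> \<Longrightarrow> g = \<ominus>\<^bsub>Hom C X Y\<^esub> f"
  by (metis arr_minus hom_r_neg hom_add_cancel)

lemma Cmp_zero_right [simp]:
  assumes "X \<in> Ob C" "arr C Y Z g"
  shows "Cmp C X Y Z g \<zero>\<^bsub>Hom C X Y\<^esub> = \<zero>\<^bsub>Hom C X Z\<^esub>"
proof -
  have z: "arr C X Y \<zero>\<^bsub>Hom C X Y\<^esub>" using assms by (simp add: arr_Ob)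
  let ?z = "Cmp C X Y Z g \<zero>\<^bsub>Hom C X Y\<^esub>"
  have "?z = ?z \<oplus>\<^bsub>Hom C X Z\<^esub> ?z"
    using Cmp_add_right[OF z z assms(2)] z by simp
  moreover have "arr C X Z ?z" using z assms by simp
  ultimately show ?thesis by (metis hom_l_neg hom_r_neg1)
qed

lemma Cmp_zero_left [simp]:
  assumes "Z \<in> Ob C" "arr C X Y f"
  shows "Cmp C X Y Z \<zero>\<^bsub>Hom C Y Z\<^esub> f = \<zero>\<^bsub>Hom C X Z\<^esub>"
proof -
  have z: "arr C Y Z \<zero>\<^bsub>Hom C Y Z\<^esub>" using assms by (simp add: arr_Ob)
  let ?z = "Cmp C X Y Z \<zero>\<^bsub>Hom C Y Z\<^esub> f"
  have "?z = ?z \<oplus>\<^bsub>Hom C X Z\<^esub> ?z"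
    using Cmp_add_left[OF assms(2) z z] z by simp
  moreover have "arr C X Z ?z" using z assms by simp
  ultimately show ?thesis by (metis hom_l_neg hom_r_neg1)
qed

lemma Cmp_minus_right:
  assumes "arr C X Y f" "arr C Y Z g"
  shows "Cmp C X Y Z g (\<ominus>\<^bsub>Hom C X Y\<^esub> f) = \<ominus>\<^bsub>Hom C X Z\<^esub> (Cmp C X Y Z g f)"
proof -
  have "Cmp C X Y Z g (f \<oplus>\<^bsub>Hom C X Y\<^esub> \<ominus>\<^bsub>Hom C X Y\<^esub> f) = \<zero>\<^bsub>Hom C X Z\<^esub>"
    using assms arr_Ob[OF assms(1)] by (simp del: Cmp_arr)
  then have "Cmp C X Y Z g f \<oplus>\<^bsub>Hom C X Z\<^esub> Cmp C X Y Z g (\<ominus>\<^bsub>Hom C X Y\<^esub> f) = \<zero>\<^bsub>Hom C X Z\<^esub>"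
    using assms by (simp add: Cmp_add_right del: hom_r_neg)
  then show ?thesis using assms by (intro hom_minus_unique) simp_all
qed

lemma Cmp_minus_left:
  assumes "arr C X Y f" "arr C Y Z g"
  shows "Cmp C X Y Z (\<ominus>\<^bsub>Hom C Y Z\<^esub> g) f = \<ominus>\<^bsub>Hom C X Z\<^esub> (Cmp C X Y Z g f)"
proof -
  have "Cmp C X Y Z (g \<oplus>\<^bsub>Hom C Y Z\<^esub> \<ominus>\<^bsub>Hom C Y Z\<^esub> g) f = \<zero>\<^bsub>Hom C X Z\<^esub>"
    using assms arr_Ob[OF assms(2)] by (simp del: Cmp_arr)
  then have "Cmp C X Y Z g f \<oplus>\<^bsub>Hom C X Z\<^esub> Cmp C X Y Z (\<ominus>\<^bsub>Hom C Y Z\<^esub> g) f = \<zero>\<^bsub>Hom C X Z\<^esub>"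
    using assms by (simp add: Cmp_add_left del: hom_r_neg)
  then show ?thesis using assms by (intro hom_minus_unique) simp_all
qed

lemma hom_minus_zero [simp]:
  "\<lbrakk>X \<in> Ob C; Y \<in> Ob C\<rbrakk> \<Longrightarrow> \<ominus>\<^bsub>Hom C X Y\<^esub> \<zero>\<^bsub>Hom C X Y\<^esub> = \<zero>\<^bsub>Hom C X Y\<^esub>"
  by (metis arr_zero hom_l_zero hom_minus_unique)

lemmas Cmp_bilinear = Cmp_add_left Cmp_add_right Cmp_minus_left Cmp_minus_right
lemmas hom_ac = hom_assoc hom_comm hom_lcomm

lemma Cmp_assoc': "\<lbrakk>arr C W X f; arr C X Y g; arr C Y Z h\<rbrakk> \<Longrightarrow>
    Cmp C W X Z (Cmp C X Y Z h g) f = Cmp C W Y Z h (Cmp C W X Y g f)"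
  by (simp add: Cmp_assoc)

text \<open>With composites bracketed to the right, an equation \<open>g f = k\<close> is only applicable inside a
  longer composite in the following form.\<close>

lemma Cmp_reassoc: "\<lbrakk>Cmp C X Y Z g f = k; arr C X Y f; arr C Y Z g\<rbrakk> \<Longrightarrow>
    arr C W X t \<Longrightarrow> Cmp C W Y Z g (Cmp C W X Y f t) = Cmp C W X Z k t"
  by (simp add: Cmp_assoc)

lemma zero_objectI:
  assumes "Z \<in> Ob C" "Idn C Z = \<zero>\<^bsub>Hom C Z Z\<^esub>"
  shows "zero_object C Z"
  unfolding zero_object_def
proof (intro conjI ballI assms(1))
  fix X assume X: "X \<in> Ob C"
  have "f = \<zero>\<^bsub>Hom C X Z\<^esub>" if "arr C X Z f" for f
    using Cmp_Idn_left[OF that] assms Cmp_zero_left[OF assms(1) that] by metis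
  then show "carrier (Hom C X Z) = {\<zero>\<^bsub>Hom C X Z\<^esub>}"
    using arr_zero[OF X assms(1)] X assms(1) unfolding arr_def by blast
  have "f = \<zero>\<^bsub>Hom C Z X\<^esub>" if "arr C Z X f" for f
    using Cmp_Idn_right[OF that] assms Cmp_zero_right[OF assms(1) that] by metis
  then show "carrier (Hom C Z X) = {\<zero>\<^bsub>Hom C Z X\<^esub>}"
    using arr_zero[OF assms(1) X] X assms(1) unfolding arr_def by blast
qed

lemma zero_object_iff:
  "zero_object C Z \<longleftrightarrow> Z \<in> Ob C \<and> Idn C Z = \<zero>\<^bsub>Hom C Z Z\<^esub>"
proof
  assume "zero_object C Z"
  then show "Z \<in> Ob C \<and> Idn C Z = \<zero>\<^bsub>Hom C Z Z\<^esub>"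
    using Idn_arr[of Z] unfolding zero_object_def arr_def by (metis singletonD)
qed (blast intro: zero_objectI)

lemma zero_object_to: "\<lbrakk>zero_object C Z; arr C X Z f\<rbrakk> \<Longrightarrow> f = \<zero>\<^bsub>Hom C X Z\<^esub>"
  by (auto simp: zero_object_def arr_def)

lemma zero_object_from: "\<lbrakk>zero_object C Z; arr C Z X f\<rbrakk> \<Longrightarrow> f = \<zero>\<^bsub>Hom C Z X\<^esub>"
  by (auto simp: zero_object_def arr_def)

lemma iso_arrI: "\<lbrakk>arr C X Y f; arr C Y X g; Cmp C X Y X g f = Idn C X; Cmp C Y X Y f g = Idn C Y\<rbrakk>
    \<Longrightarrow> iso_arr C X Y f"
  by (auto simp: iso_arr_def)

lemma iso_arr_Idn: "X \<in> Ob C \<Longrightarrow> iso_arr C X X (Idn C X)"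
  by (rule iso_arrI[of _ _ _ "Idn C X"]) simp_all

definition biproduct where
  "biproduct X A B i p j q \<longleftrightarrow>
     arr C A X i \<and> arr C X A p \<and> arr C B X j \<and> arr C X B q \<and>
     Cmp C A X A p i = Idn C A \<and> Cmp C B X B q j = Idn C B \<and>
     Cmp C X A X i p \<oplus>\<^bsub>Hom C X X\<^esub> Cmp C X B X j q = Idn C X"

lemma biproduct_Ob: "biproduct X A B i p j q \<Longrightarrow> X \<in> Ob C \<and> A \<in> Ob C \<and> B \<in> Ob C"
  by (auto simp: biproduct_def arr_Ob)

lemma biproduct_swap: "biproduct X A B i p j q \<Longrightarrow> biproduct X B A j q i p"
  unfolding biproduct_def by (metis Cmp_arr hom_comm)

text \<open>Inserting \<open>1 = i p + j q\<close> between \<open>p\<close> and \<open>j\<close> gives \<open>p j = p j + p j\<close>.\<close>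

lemma biproduct_cross:
  assumes "biproduct X A B i p j q"
  shows "Cmp C B X A p j = \<zero>\<^bsub>Hom C B A\<^esub>"
proof -
  have a: "arr C A X i" "arr C X A p" "arr C B X j" "arr C X B q"
    and e: "Cmp C A X A p i = Idn C A" "Cmp C B X B q j = Idn C B"
     "Cmp C X A X i p \<oplus>\<^bsub>Hom C X X\<^esub> Cmp C X B X j q = Idn C X"
    using assms by (auto simp: biproduct_def)
  note o = biproduct_Ob[OF assms]
  let ?pj = "Cmp C B X A p j"
  have "?pj = Cmp C B X A (Cmp C X X A p (Cmp C X A X i p \<oplus>\<^bsub>Hom C X X\<^esub> Cmp C X B X j q)) j"
    using a e by simp
  also have "\<dots> = ?pj \<oplus>\<^bsub>Hom C B A\<^esub> ?pj"
    using a o by (simp del: e(3) add: Cmp_bilinear Cmp_assoc' Cmp_reassoc[OF e(1)] Cmp_reassoc[OF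
        e(2)] e(1,2))
  finally have "?pj = ?pj \<oplus>\<^bsub>Hom C B A\<^esub> ?pj" .
  then show ?thesis using a by (metis Cmp_arr hom_l_neg hom_r_neg1)
qed

lemma biproductD:
  assumes "biproduct X A B i p j q"
  shows "arr C A X i" "arr C X A p" "arr C B X j" "arr C X B q"
    "Cmp C A X A p i = Idn C A" "Cmp C B X B q j = Idn C B"
    "Cmp C B X A p j = \<zero>\<^bsub>Hom C B A\<^esub>" "Cmp C A X B q i = \<zero>\<^bsub>Hom C A B\<^esub>"
    "Cmp C X A X i p \<oplus>\<^bsub>Hom C X X\<^esub> Cmp C X B X j q = Idn C X"
  using assms biproduct_cross[OF assms] biproduct_cross[OF biproduct_swap[OF assms]]
  by (auto simp: biproduct_def)

lemma biproductD_reassoc: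
  assumes "biproduct X A B i p j q"
  shows "arr C T A t \<Longrightarrow> Cmp C T X A p (Cmp C T A X i t) = t"
    "arr C T B s \<Longrightarrow> Cmp C T X B q (Cmp C T B X j s) = s"
    "arr C T B s \<Longrightarrow> Cmp C T X A p (Cmp C T B X j s) = \<zero>\<^bsub>Hom C T A\<^esub>"
    "arr C T A t \<Longrightarrow> Cmp C T X B q (Cmp C T A X i t) = \<zero>\<^bsub>Hom C T B\<^esub>"
  using biproductD[OF assms] biproduct_Ob[OF assms] by (simp_all add: Cmp_assoc)

lemma biproduct_split_left:
  assumes "biproduct X A B i p j q" "arr C T X t"
  shows "Cmp C T A X i (Cmp C T X A p t) \<oplus>\<^bsub>Hom C T X\<^esub> Cmp C T B X j (Cmp C T X B q t) = t"
proof -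
  note b = biproductD[OF assms(1)]
  have "t = Cmp C T X X (Cmp C X A X i p \<oplus>\<^bsub>Hom C X X\<^esub> Cmp C X B X j q) t"
    using b(9) assms(2) by simp
  then show ?thesis using b(1-4) assms(2) by (simp del: b(9) add: Cmp_bilinear Cmp_assoc')
qed

lemma biproduct_split_right:
  assumes "biproduct X A B i p j q" "arr C X T t"
  shows "Cmp C X A T (Cmp C A X T t i) p \<oplus>\<^bsub>Hom C X T\<^esub> Cmp C X B T (Cmp C B X T t j) q = t"
proof -
  note b = biproductD[OF assms(1)]
  have "t = Cmp C X X T t (Cmp C X A X i p \<oplus>\<^bsub>Hom C X X\<^esub> Cmp C X B X j q)"
    using b(9) assms(2) by simp
  then show ?thesis using b(1-4) assms(2) by (simp del: b(9) add: Cmp_bilinear Cmp_assoc)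
qed

lemma finsum_two:
  assumes "arr C X X (f 0)" "arr C X X (f (Suc 0))"
  shows "finsum (Hom C X X) f {..<Suc (Suc 0)} = f 0 \<oplus>\<^bsub>Hom C X X\<^esub> f (Suc 0)"
proof -
  interpret abelian_monoid "Hom C X X" using assms(1) arr_Ob Hom_abelian_monoid by blast
  have "{..<Suc (Suc 0)} = insert 0 {Suc 0}" by auto
  then show ?thesis using assms by (simp add: arr_def)
qed

lemma direct_sum_two_iff:
  "direct_sum C X [A, B] \<longleftrightarrow> (\<exists>i p j q. biproduct X A B i p j q)"
proof
  assume "direct_sum C X [A, B]"
  then obtain \<iota> \<pi> where a: "\<forall>k < 2. arr C ([A, B] ! k) X (\<iota> k) \<and> arr C X ([A, B] ! k) (\<pi> k)"
    and d: "\<forall>k < 2. \<forall>l < 2. Cmp C ([A, B] ! k) X ([A, B] ! l) (\<pi> l) (\<iota> k) =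
          (if k = l then Idn C ([A, B] ! k) else \<zero>\<^bsub>Hom C ([A, B] ! k) ([A, B] ! l)\<^esub>)"
    and s: "finsum (Hom C X X) (\<lambda>k. Cmp C X ([A, B] ! k) X (\<iota> k) (\<pi> k)) {..<Suc (Suc 0)} = Idn C X"
    by (auto simp: direct_sum_def numeral_2_eq_2)
  have "biproduct X A B (\<iota> 0) (\<pi> 0) (\<iota> 1) (\<pi> 1)"
    unfolding biproduct_def
    using a[rule_format, of 0] a[rule_format, of 1] d[rule_format, of 0 0] d[rule_format, of 1 1] s
    by (simp add: finsum_two)
  then show "\<exists>i p j q. biproduct X A B i p j q" by blast
next
  assume "\<exists>i p j q. biproduct X A B i p j q"
  then obtain i p j q where b: "biproduct X A B i p j q" by blast
  show "direct_sum C X [A, B]"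
    unfolding direct_sum_def
    using biproductD[OF b] biproduct_Ob[OF b]
    by (intro conjI exI[of _ "\<lambda>k. if k = 0 then i else j"] exI[of _ "\<lambda>k. if k = 0 then p else q"])
      (auto simp: finsum_two less_Suc_eq)
qed

lemma direct_sum_Nil: "zero_object C X \<Longrightarrow> direct_sum C X []"
  using Hom_abelian_monoid[of X X] by (auto simp: direct_sum_def zero_object_iff
      abelian_monoid.finsum_empty)

lemma finsum_arr:
  assumes "X \<in> Ob C" "Y \<in> Ob C" "\<And>k. k \<in> K \<Longrightarrow> arr C X Y (f k)"
  shows "arr C X Y (finsum (Hom C X Y) f K)"
proof -
  interpret abelian_monoid "Hom C X Y" using assms Hom_abelian_monoid by blast
  show ?thesis using assms by (auto simp: arr_def intro!: finsum_closed)
qed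

lemma Cmp_finsum_right:
  assumes "finite K" "\<And>k. k \<in> K \<Longrightarrow> arr C X Y (f k)" "X \<in> Ob C" "arr C Y Z g"
  shows "Cmp C X Y Z g (finsum (Hom C X Y) f K) = finsum (Hom C X Z) (\<lambda>k. Cmp C X Y Z g (f k)) K"
  using assms(1,2)
proof (induction K)
  case empty
  then show ?case using assms arr_Ob[OF assms(4)]
    by (simp add: abelian_monoid.finsum_empty Hom_abelian_monoid)
next
  case (insert k K)
  interpret XY: abelian_monoid "Hom C X Y" using assms arr_Ob Hom_abelian_monoid by blast
  interpret XZ: abelian_monoid "Hom C X Z" using assms arr_Ob Hom_abelian_monoid by blast
  have f: "f \<in> K \<rightarrow> carrier (Hom C X Y)" "f k \<in> carrier (Hom C X Y)"
    using insert.prems by (auto simp: arr_def)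
  have "\<And>l. l \<in> insert k K \<Longrightarrow> arr C X Z (Cmp C X Y Z g (f l))"
    using insert.prems assms(4) by simp
  then have g: "(\<lambda>k. Cmp C X Y Z g (f k)) \<in> K \<rightarrow> carrier (Hom C X Z)" 
    "Cmp C X Y Z g (f k) \<in> carrier (Hom C X Z)"
    by (auto simp: arr_def)
  have "arr C X Y (finsum (Hom C X Y) f K)"
    using insert.prems assms arr_Ob by (intro finsum_arr) auto
  then show ?case
    using insert f g assms(4) by (simp add: Cmp_add_right)
qed

lemma Cmp_finsum_left:
  assumes "finite K" "\<And>k. k \<in> K \<Longrightarrow> arr C Y Z (f k)" "Z \<in> Ob C" "arr C X Y g"
  shows "Cmp C X Y Z (finsum (Hom C Y Z) f K) g = finsum (Hom C X Z) (\<lambda>k. Cmp C X Y Z (f k) g) K"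
  using assms(1,2)
proof (induction K)
  case empty
  then show ?case using assms arr_Ob[OF assms(4)]
    by (simp add: abelian_monoid.finsum_empty Hom_abelian_monoid)
next
  case (insert k K)
  interpret YZ: abelian_monoid "Hom C Y Z" using assms arr_Ob Hom_abelian_monoid by blast
  interpret XZ: abelian_monoid "Hom C X Z" using assms arr_Ob Hom_abelian_monoid by blast
  have f: "f \<in> K \<rightarrow> carrier (Hom C Y Z)" "f k \<in> carrier (Hom C Y Z)"
    using insert.prems by (auto simp: arr_def)
  have "\<And>l. l \<in> insert k K \<Longrightarrow> arr C X Z (Cmp C X Y Z (f l) g)"
    using insert.prems assms(4) by simp
  then have g: "(\<lambda>k. Cmp C X Y Z (f k) g) \<in> K \<rightarrow> carrier (Hom C X Z)" 
    "Cmp C X Y Z (f k) g \<in> carrier (Hom C X Z)"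
    by (auto simp: arr_def)
  have "arr C Y Z (finsum (Hom C Y Z) f K)"
    using insert.prems assms arr_Ob by (intro finsum_arr) auto
  then show ?case
    using insert f g assms(4) by (simp add: Cmp_add_left)
qed

text \<open>Decompositions into several summands are assembled from binary ones.\<close>

lemma direct_sum_Cons:
  assumes b: "biproduct X A V i p j q" and V: "direct_sum C V As"
  shows "direct_sum C X (A # As)"
proof -
  from V obtain \<iota> \<pi> where "(\<forall>k < length As. arr C (As ! k) V (\<iota> k) \<and> arr C V (As ! k) (\<pi> k)) \<and>
     (\<forall>k < length As. \<forall>l < length As. Cmp C (As ! k) V (As ! l) (\<pi> l) (\<iota> k) =
          (if k = l then Idn C (As ! k) else \<zero>\<^bsub>Hom C (As ! k) (As ! l)\<^esub>)) \<and>
     finsum (Hom C V V) (\<lambda>k. Cmp C V (As ! k) V (\<iota> k) (\<pi> k)) {..<length As} = Idn C V"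
    unfolding direct_sum_def by blast
  then have a: "\<And>k. k < length As \<Longrightarrow> arr C (As ! k) V (\<iota> k)"
      "\<And>k. k < length As \<Longrightarrow> arr C V (As ! k) (\<pi> k)"
    and d: "\<And>k l. \<lbrakk>k < length As; l < length As\<rbrakk> \<Longrightarrow> Cmp C (As ! k) V (As ! l) (\<pi> l) (\<iota> k) =
          (if k = l then Idn C (As ! k) else \<zero>\<^bsub>Hom C (As ! k) (As ! l)\<^esub>)"
    and s: "finsum (Hom C V V) (\<lambda>k. Cmp C V (As ! k) V (\<iota> k) (\<pi> k)) {..<length As} = Idn C V"
    by auto
  note bD = biproductD[OF b] biproductD_reassoc[OF b]
  note o = biproduct_Ob[OF b]
  let ?i = "\<lambda>k. case k of 0 \<Rightarrow> i | Suc l \<Rightarrow> Cmp C (As ! l) V X j (\<iota> l)"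
  let ?p = "\<lambda>k. case k of 0 \<Rightarrow> p | Suc l \<Rightarrow> Cmp C X V (As ! l) (\<pi> l) q"
  let ?t = "\<lambda>k. Cmp C X ((A # As) ! k) X (?i k) (?p k)"
  have arrs: "arr C ((A # As) ! k) X (?i k)" "arr C X ((A # As) ! k) (?p k)"
    if "k < length (A # As)" for k
    using that bD(1-4) a by (cases k; simp)+
  have orth: "Cmp C ((A # As) ! k) X ((A # As) ! l) (?p l) (?i k) =
      (if k = l then Idn C ((A # As) ! k) else \<zero>\<^bsub>Hom C ((A # As) ! k) ((A # As) ! l)\<^esub>)"
    if "k < length (A # As)" "l < length (A # As)" for k l
    using that bD a d o arr_Ob[OF a(1)] by (cases k; cases l) (simp_all add: Cmp_assoc')
  interpret XX: abelian_monoid "Hom C X X" using o Hom_abelian_monoid by blast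
  have tc: "?t k \<in> carrier (Hom C X X)" if "k < length (A # As)" for k
    using Cmp_arr[OF arrs(2) arrs(1)] that by (simp add: arr_def)
  have "finsum (Hom C X X) ?t {..<length (A # As)}
      = ?t 0 \<oplus>\<^bsub>Hom C X X\<^esub> finsum (Hom C X X) ?t (Suc ` {..<length As})"
    unfolding length_Cons lessThan_Suc_eq_insert_0
    using tc[of 0] tc[of "Suc _"] by (intro XX.finsum_insert) auto
  also have "finsum (Hom C X X) ?t (Suc ` {..<length As})
      = finsum (Hom C X X) (\<lambda>k. ?t (Suc k)) {..<length As}"
    using tc[of "Suc _"] by (intro XX.finsum_reindex) auto
  also have "\<dots> = finsum (Hom C X X)
      (\<lambda>k. Cmp C X V X j (Cmp C X V V (Cmp C V (As ! k) V (\<iota> k) (\<pi> k)) q)) {..<length As}"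
    using tc[of "Suc _"] a bD(1-4) by (intro XX.finsum_cong') (auto simp: Cmp_assoc')
  also have "\<dots> = Cmp C X V X j (Cmp C X V V
      (finsum (Hom C V V) (\<lambda>k. Cmp C V (As ! k) V (\<iota> k) (\<pi> k)) {..<length As}) q)"
  proof -
    let ?v = "\<lambda>k. Cmp C V (As ! k) V (\<iota> k) (\<pi> k)"
    have v: "\<And>k. k \<in> {..<length As} \<Longrightarrow> arr C V V (?v k)" using a by auto
    have vq: "\<And>k. k \<in> {..<length As} \<Longrightarrow> arr C X V (Cmp C X V V (?v k) q)"
      using v bD(4) Cmp_arr by blast
    show ?thesis
      using o Cmp_finsum_left[OF finite_lessThan v _ bD(4)]
        Cmp_finsum_right[OF finite_lessThan vq _ bD(3)] by simp
  qed
  finally have "finsum (Hom C X X) ?t {..<length (A # As)} = Idn C X"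
    using s bD by simp
  moreover have "\<forall>k < length (A # As). arr C ((A # As) ! k) X (?i k) \<and> arr C X ((A # As) ! k) (?p
      k)"
    using arrs by blast
  moreover have "\<forall>k < length (A # As). \<forall>l < length (A # As).
      Cmp C ((A # As) ! k) X ((A # As) ! l) (?p l) (?i k) =
      (if k = l then Idn C ((A # As) ! k) else \<zero>\<^bsub>Hom C ((A # As) ! k) ((A # As) ! l)\<^esub>)"
    using orth by blast
  moreover have "X \<in> Ob C" using o by blast
  ultimately show ?thesis unfolding direct_sum_def by blast
qed

text \<open>The complement \<open>V\<close> of \<open>U\<close> is embedded into \<open>X\<close> as the graph of \<open>- a\<^sup>-\<^sup>1 g\<close>, where \<open>a\<close> is the
  restriction of \<open>g\<close> to \<open>U\<close>; this graph is the kernel of \<open>g\<close>.\<close>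

lemma biproduct_exchange:
  assumes b: "biproduct X U V i p j q"
    and f: "arr C W X f" and g: "arr C X W g" and gf: "Cmp C W X W g f = Idn C W"
    and iso: "iso_arr C U W (Cmp C U X W g i)"
  shows "\<exists>j' q'. biproduct X W V f g j' q'"
proof -
  note bD = biproductD[OF b] biproductD_reassoc[OF b]
  note o = biproduct_Ob[OF b]
  have W: "W \<in> Ob C" using arr_Ob[OF f] by simp
  obtain a where a: "arr C W U a" "Cmp C U W U a (Cmp C U X W g i) = Idn C U"
      "Cmp C W U W (Cmp C U X W g i) a = Idn C W"
    using iso by (auto simp: iso_arr_def)
  \<comment> \<open>\<open>e\<close> is the idempotent with kernel \<open>U\<close> whose image is the kernel of \<open>g\<close>, and \<open>d\<close> the one with
    kernel \<open>W\<close> and the same image.\<close>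
  define e where "e = Idn C X \<oplus>\<^bsub>Hom C X X\<^esub> \<ominus>\<^bsub>Hom C X X\<^esub> (Cmp C X U X i (Cmp C X W U a g))"
  define d where "d = Idn C X \<oplus>\<^bsub>Hom C X X\<^esub> \<ominus>\<^bsub>Hom C X X\<^esub> (Cmp C X W X f g)"
  have arrs [simp]: "arr C X X e" "arr C X X d" "arr C U X i" "arr C X U p" "arr C V X j" 
    "arr C X V q" "arr C W X f" "arr C X W g" "arr C W U a" and [simp]: "X \<in> Ob C" "W \<in> Ob C"
    "U \<in> Ob C" "V \<in> Ob C"
    using bD(1-4) f g a(1) o W by (auto simp: e_def d_def)
  have ei: "Cmp C U X X e i = \<zero>\<^bsub>Hom C U X\<^esub>"
    by (simp add: e_def Cmp_bilinear Cmp_assoc' a(2))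
  have ejq: "Cmp C X V X (Cmp C V X X e j) q = e"
    using biproduct_split_right[OF b, of X e] ei by simp
  have qe: "Cmp C X X V q e = q"
    using bD by (simp add: e_def Cmp_bilinear Cmp_assoc')
  have ed: "Cmp C X X X e d = d"
  proof -
    have "Cmp C X X X e (Cmp C X W X f g) = \<zero>\<^bsub>Hom C X X\<^esub> \<oplus>\<^bsub>Hom C X X\<^esub>
       (Cmp C X W X f g \<oplus>\<^bsub>Hom C X X\<^esub> \<ominus>\<^bsub>Hom C X X\<^esub> (Cmp C X U X i (Cmp C X W U a g)))"
      by (simp add: e_def Cmp_bilinear Cmp_assoc' Cmp_reassoc[OF gf])
    then show ?thesis
      by (simp add: d_def Cmp_bilinear hom_minus_add hom_ac) (simp add: e_def hom_ac)
  qed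
  have de: "Cmp C X X X d e = e"
  proof -
    have "Cmp C X X W g (Cmp C X U X i (Cmp C X W U a g)) =
        Cmp C X W W (Cmp C W U W (Cmp C U X W g i) a) g"
      by (simp add: Cmp_assoc')
    then have "Cmp C X X W g e = \<zero>\<^bsub>Hom C X W\<^esub>"
      by (simp add: e_def Cmp_bilinear a(3))
    then show ?thesis by (simp add: d_def Cmp_bilinear Cmp_assoc')
  qed
  let ?j = "Cmp C V X X e j" and ?q = "Cmp C X X V q d"
  have "Cmp C V X V ?q ?j = Cmp C V X V q (Cmp C V X X (Cmp C X X X d e) j)"
    by (simp add: Cmp_assoc')
  also have "\<dots> = Idn C V"
    unfolding de using qe bD by (simp add: Cmp_assoc)
  finally have 1: "Cmp C V X V ?q ?j = Idn C V" .
  have "Cmp C X V X ?j ?q = Cmp C X X X (Cmp C X V X ?j q) d"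
    by (simp add: Cmp_assoc' )
  also have "\<dots> = d" unfolding ejq by (rule ed)
  finally have 2: "Cmp C X V X ?j ?q = d" .
  have "Cmp C X W X f g \<oplus>\<^bsub>Hom C X X\<^esub> d = Idn C X"
    by (simp add: d_def hom_ac)
  then have "biproduct X W V f g ?j ?q"
    unfolding biproduct_def using 1 2 gf by simp
  then show ?thesis by blast
qed

text \<open>Three summands may be regrouped. The maps are explicit because the exchange argument goes on
  to use the inclusion of \<open>B\<close>.\<close>

lemma biproduct_assoc:
  assumes b: "biproduct X A V i p j q" and b': "biproduct V B D i' p' j' q'"
    and c: "biproduct Y A D k r l s"
  shows "biproduct X B Y (Cmp C B V X j i') (Cmp C X V B p' q)
    (Cmp C Y A X i r \<oplus>\<^bsub>Hom C Y X\<^esub> Cmp C Y D X (Cmp C D V X j j') s)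
    (Cmp C X A Y k p \<oplus>\<^bsub>Hom C X Y\<^esub> Cmp C X D Y l (Cmp C X V D q' q))"
proof -
  note bD = biproductD[OF b] biproductD_reassoc[OF b] biproductD[OF b'] biproductD_reassoc[OF b']
    biproductD[OF c] biproductD_reassoc[OF c] 
  note o [simp] = biproduct_Ob[OF b] biproduct_Ob[OF b'] biproduct_Ob[OF c]
  have "Cmp C X B X (Cmp C B V X j i') (Cmp C X V B p' q) \<oplus>\<^bsub>Hom C X X\<^esub>
      Cmp C X D X (Cmp C D V X j j') (Cmp C X V D q' q) = Cmp C X V X j (Cmp C X V V
        (Cmp C V B V i' p' \<oplus>\<^bsub>Hom C V V\<^esub> Cmp C V D V j' q') q)"
    using bD(1-4,14-17) by (simp add: Cmp_bilinear Cmp_assoc')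
  also have "\<dots> = Cmp C X V X j q" using bD by simp
  finally have s: "Cmp C X B X (Cmp C B V X j i') (Cmp C X V B p' q) \<oplus>\<^bsub>Hom C X X\<^esub>
      Cmp C X D X (Cmp C D V X j j') (Cmp C X V D q' q) = Cmp C X V X j q" .
  have k: "Cmp C Y A Y k r \<oplus>\<^bsub>Hom C Y Y\<^esub> Cmp C Y D Y l s = Idn C Y" using bD by blast
  show ?thesis
    unfolding biproduct_def
    using bD s k
    by (simp add: Cmp_bilinear Cmp_assoc') (simp add: hom_ac)
qed

end

section \<open>An exact structure is determined by its projective and injective objects\<close>

context linear_category
begin

lemma is_kernel_mono:
  assumes k: "is_kernel C X Y Z f g" and a: "arr C T X a" and b: "arr C T X b"
    and e: "Cmp C T X Y f a = Cmp C T X Y f b"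
  shows "a = b"
proof -
  have f: "arr C X Y f" "arr C Y Z g" "Cmp C X Y Z g f = \<zero>\<^bsub>Hom C X Z\<^esub>" using k by (auto simp:
      is_kernel_def)
  have "arr C T Y (Cmp C T X Y f a)" using f a by simp
  moreover have "Cmp C T Y Z g (Cmp C T X Y f a) = \<zero>\<^bsub>Hom C T Z\<^esub>"
    using f a arr_Ob[OF f(2)] by (simp add: Cmp_assoc)
  ultimately have "\<exists>!s. arr C T X s \<and> Cmp C T X Y f s = Cmp C T X Y f a"
    using k unfolding is_kernel_def by blast
  then show ?thesis using a b e by metis
qed

lemma is_cokernel_epi:
  assumes k: "is_cokernel C X Y Z f g" and a: "arr C Z T a" and b: "arr C Z T b"
    and e: "Cmp C Y Z T a g = Cmp C Y Z T b g"
  shows "a = b"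
proof -
  have f: "arr C X Y f" "arr C Y Z g" "Cmp C X Y Z g f = \<zero>\<^bsub>Hom C X Z\<^esub>" using k by (auto simp:
      is_cokernel_def)
  have "arr C Y T (Cmp C Y Z T a g)" using f a by simp
  moreover have "Cmp C X Y T (Cmp C Y Z T a g) f = \<zero>\<^bsub>Hom C X T\<^esub>"
    using f a arr_Ob[OF f(1)] by (simp add: Cmp_assoc')
  ultimately have "\<exists>!s. arr C Z T s \<and> Cmp C Y Z T s g = Cmp C Y Z T a g"
    using k unfolding is_cokernel_def by blast
  then show ?thesis using a b e by metis
qed

lemma is_kernel_ex:
  assumes "is_kernel C X Y Z f g" "arr C T Y t" "Cmp C T Y Z g t = \<zero>\<^bsub>Hom C T Z\<^esub>"
  obtains s where "arr C T X s" "Cmp C T X Y f s = t"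
  using assms unfolding is_kernel_def by metis

lemma is_cokernel_ex:
  assumes "is_cokernel C X Y Z f g" "arr C Y T t" "Cmp C X Y T t f = \<zero>\<^bsub>Hom C X T\<^esub>"
  obtains s where "arr C Z T s" "Cmp C Y Z T s g = t"
  using assms unfolding is_cokernel_def by metis

lemma is_kernelD: "is_kernel C X Y Z f g \<Longrightarrow>
    arr C X Y f \<and> arr C Y Z g \<and> Cmp C X Y Z g f = \<zero>\<^bsub>Hom C X Z\<^esub>"
  by (simp add: is_kernel_def)

lemma is_cokernelD: "is_cokernel C X Y Z f g \<Longrightarrow>
    arr C X Y f \<and> arr C Y Z g \<and> Cmp C X Y Z g f = \<zero>\<^bsub>Hom C X Z\<^esub>"
  by (simp add: is_cokernel_def)

lemma is_kernelI:
  assumes "arr C X Y f" "arr C Y Z g" "Cmp C X Y Z g f = \<zero>\<^bsub>Hom C X Z\<^esub>"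
    and "\<And>T t. \<lbrakk>arr C T Y t; Cmp C T Y Z g t = \<zero>\<^bsub>Hom C T Z\<^esub>\<rbrakk> \<Longrightarrow> \<exists>s. arr C T X s \<and> Cmp C T X Y f s = t"
    and "\<And>T a b. \<lbrakk>arr C T X a; arr C T X b; Cmp C T X Y f a = Cmp C T X Y f b\<rbrakk> \<Longrightarrow> a = b"
  shows "is_kernel C X Y Z f g"
  unfolding is_kernel_def using assms by metis

lemma is_cokernelI:
  assumes "arr C X Y f" "arr C Y Z g" "Cmp C X Y Z g f = \<zero>\<^bsub>Hom C X Z\<^esub>"
    and "\<And>T t. \<lbrakk>arr C Y T t; Cmp C X Y T t f = \<zero>\<^bsub>Hom C X T\<^esub>\<rbrakk> \<Longrightarrow> \<exists>s. arr C Z T s \<and> Cmp C Y Z T s g = t"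
    and "\<And>T a b. \<lbrakk>arr C Z T a; arr C Z T b; Cmp C Y Z T a g = Cmp C Y Z T b g\<rbrakk> \<Longrightarrow> a = b"
  shows "is_cokernel C X Y Z f g"
  unfolding is_cokernel_def using assms by metis

lemma is_cokernel_unique:
  assumes k: "is_cokernel C X Y Z f g" and k': "is_cokernel C X Y Z' f g'"
  obtains h where "iso_arr C Z Z' h" "Cmp C Y Z Z' h g = g'"
proof -
  note kD = is_cokernelD[OF k] is_cokernelD[OF k']
  obtain h where h: "arr C Z Z' h" "Cmp C Y Z Z' h g = g'"
    using is_cokernel_ex[OF k, of Z' g'] kD by blast
  obtain h' where h': "arr C Z' Z h'" "Cmp C Y Z' Z h' g' = g"
    using is_cokernel_ex[OF k', of Z g] kD by blast
  have o: "Z \<in> Ob C" "Z' \<in> Ob C" using arr_Ob[OF h(1)] by auto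
  have "Cmp C Z Z' Z h' h = Idn C Z"
    by (rule is_cokernel_epi[OF k, where T = Z]) (simp_all add: o h h' kD Cmp_assoc')
  moreover have "Cmp C Z' Z Z' h h' = Idn C Z'"
    by (rule is_cokernel_epi[OF k', where T = Z']) (simp_all add: o h h' kD Cmp_assoc')
  ultimately have "iso_arr C Z Z' h" using h h' by (auto intro: iso_arrI)
  then show ?thesis using that h by blast
qed

lemma is_pushoutD: "is_pushout C A B A' B' i f i' f' \<Longrightarrow>
    arr C A B i \<and> arr C A A' f \<and> arr C A' B' i' \<and> arr C B B' f' \<and>
     Cmp C A B B' f' i = Cmp C A A' B' i' f"
  by (simp add: is_pushout_def)

lemma is_pushout_ex:
  assumes "is_pushout C A B A' B' i f i' f'" "arr C B T b" "arr C A' T a"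
    "Cmp C A B T b i = Cmp C A A' T a f"
  obtains h where "arr C B' T h" "Cmp C B B' T h f' = b" "Cmp C A' B' T h i' = a"
  using assms unfolding is_pushout_def by metis

lemma is_pushout_eqI:
  assumes p: "is_pushout C A B A' B' i f i' f'" and h: "arr C B' T h" "arr C B' T h'"
    "Cmp C B B' T h f' = Cmp C B B' T h' f'" "Cmp C A' B' T h i' = Cmp C A' B' T h' i'"
  shows "h = h'"
proof -
  note pD = is_pushoutD[OF p]
  have "arr C B T (Cmp C B B' T h f') \<and> arr C A' T (Cmp C A' B' T h i') \<and>
    Cmp C A B T (Cmp C B B' T h f') i = Cmp C A A' T (Cmp C A' B' T h i') f"
    using pD h(1) by (simp add: Cmp_assoc')
  then have "\<exists>!k. arr C B' T k \<and> Cmp C B B' T k f' = Cmp C B B' T h f' \<and>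
      Cmp C A' B' T k i' = Cmp C A' B' T h i'"
    using p unfolding is_pushout_def by blast
  then show ?thesis using h by metis
qed

lemma is_pushout_unique:
  assumes p: "is_pushout C A B A' B' i f i' f'" and p': "is_pushout C A B A' B'' i f i'' f''"
  obtains h where "iso_arr C B' B'' h" "Cmp C A' B' B'' h i' = i''" "Cmp C B B' B'' h f' = f''"
proof -
  note pD = is_pushoutD[OF p] is_pushoutD[OF p']
  obtain h where h: "arr C B' B'' h" "Cmp C B B' B'' h f' = f''" "Cmp C A' B' B'' h i' = i''"
    using is_pushout_ex[OF p, of B'' f'' i''] pD by blast
  obtain k where k: "arr C B'' B' k" "Cmp C B B'' B' k f'' = f'" "Cmp C A' B'' B' k i'' = i'"
    using is_pushout_ex[OF p', of B' f' i'] pD by blast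
  have o: "B' \<in> Ob C" "B'' \<in> Ob C" using arr_Ob[OF h(1)] by auto
  have "Cmp C B' B'' B' k h = Idn C B'"
    by (rule is_pushout_eqI[OF p, where T = "B'"]) (simp_all add: h k pD o Cmp_assoc')
  moreover have "Cmp C B'' B' B'' h k = Idn C B''"
    by (rule is_pushout_eqI[OF p', where T = "B''"]) (simp_all add: h k pD o Cmp_assoc')
  ultimately have "iso_arr C B' B'' h" using h k by (auto intro: iso_arrI)
  then show ?thesis using that h by blast
qed

lemma is_pullbackD: "is_pullback C B D B' D' p f p' f' \<Longrightarrow>
    arr C B D p \<and> arr C D' D f \<and> arr C B' D' p' \<and> arr C B' B f' \<and>
     Cmp C B' B D p f' = Cmp C B' D' D f p'"
  by (simp add: is_pullback_def)

lemma is_pullback_ex: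
  assumes "is_pullback C B D B' D' p f p' f'" "arr C T B b" "arr C T D' a"
    "Cmp C T B D p b = Cmp C T D' D f a"
  obtains h where "arr C T B' h" "Cmp C T B' B f' h = b" "Cmp C T B' D' p' h = a"
  using assms unfolding is_pullback_def by metis

lemma is_pullback_eqI:
  assumes p: "is_pullback C B D B' D' p f p' f'" and h: "arr C T B' h" "arr C T B' h'"
    "Cmp C T B' B f' h = Cmp C T B' B f' h'" "Cmp C T B' D' p' h = Cmp C T B' D' p' h'"
  shows "h = h'"
proof -
  note pD = is_pullbackD[OF p]
  have "arr C T B (Cmp C T B' B f' h) \<and> arr C T D' (Cmp C T B' D' p' h) \<and>
    Cmp C T B D p (Cmp C T B' B f' h) = Cmp C T D' D f (Cmp C T B' D' p' h)"
    using pD h(1) by (simp add: Cmp_assoc)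
  then have "\<exists>!k. arr C T B' k \<and> Cmp C T B' B f' k = Cmp C T B' B f' h \<and>
      Cmp C T B' D' p' k = Cmp C T B' D' p' h"
    using p unfolding is_pullback_def by blast
  then show ?thesis using h by metis
qed

lemma is_pullback_unique:
  assumes p: "is_pullback C B D B' D' p f p' f'" and q: "is_pullback C B D B'' D' p f p'' f''"
  obtains h where "iso_arr C B' B'' h" "Cmp C B' B'' D' p'' h = p'" "Cmp C B' B'' B f'' h = f'"
proof -
  note pD = is_pullbackD[OF p] is_pullbackD[OF q]
  obtain h where h: "arr C B' B'' h" "Cmp C B' B'' B f'' h = f'" "Cmp C B' B'' D' p'' h = p'"
    using is_pullback_ex[OF q, of B' f' p'] pD by blast
  obtain k where k: "arr C B'' B' k" "Cmp C B'' B' B f' k = f''" "Cmp C B'' B' D' p' k = p''"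
    using is_pullback_ex[OF p, of B'' f'' p''] pD by blast
  have o: "B' \<in> Ob C" "B'' \<in> Ob C" using arr_Ob[OF h(1)] by auto
  have "Cmp C B' B'' B' k h = Idn C B'"
    by (rule is_pullback_eqI[OF p, where T = "B'"]) (simp_all add: h k pD o Cmp_assoc)
  moreover have "Cmp C B'' B' B'' h k = Idn C B''"
    by (rule is_pullback_eqI[OF q, where T = "B''"]) (simp_all add: h k pD o Cmp_assoc)
  ultimately have "iso_arr C B' B'' h" using h k by (auto intro: iso_arrI)
  then show ?thesis using that h by blast
qed

lemma is_pushoutI:
  assumes "arr C A B i" "arr C A A' f" "arr C A' B' i'" "arr C B B' f'"
    "Cmp C A B B' f' i = Cmp C A A' B' i' f"
    and "\<And>T b a. \<lbrakk>arr C B T b; arr C A' T a; Cmp C A B T b i = Cmp C A A' T a f\<rbrakk> \<Longrightarrow>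
       \<exists>h. arr C B' T h \<and> Cmp C B B' T h f' = b \<and> Cmp C A' B' T h i' = a"
    and "\<And>T h h'. \<lbrakk>arr C B' T h; arr C B' T h'; Cmp C B B' T h f' = Cmp C B B' T h' f';
       Cmp C A' B' T h i' = Cmp C A' B' T h' i'\<rbrakk> \<Longrightarrow> h = h'"
  shows "is_pushout C A B A' B' i f i' f'"
proof -
  have "\<exists>!h. arr C B' T h \<and> Cmp C B B' T h f' = b \<and> Cmp C A' B' T h i' = a"
    if "arr C B T b" "arr C A' T a" "Cmp C A B T b i = Cmp C A A' T a f" for T b a
    using assms(6)[OF that] assms(7)[of T] by metis
  then show ?thesis unfolding is_pushout_def using assms(1-5) by blast
qed

lemma is_pullbackI:
  assumes "arr C B D p" "arr C D' D f" "arr C B' D' p'" "arr C B' B f'"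
    "Cmp C B' B D p f' = Cmp C B' D' D f p'"
    and "\<And>T b a. \<lbrakk>arr C T B b; arr C T D' a; Cmp C T B D p b = Cmp C T D' D f a\<rbrakk> \<Longrightarrow>
       \<exists>h. arr C T B' h \<and> Cmp C T B' B f' h = b \<and> Cmp C T B' D' p' h = a"
    and "\<And>T h h'. \<lbrakk>arr C T B' h; arr C T B' h'; Cmp C T B' B f' h = Cmp C T B' B f' h';
       Cmp C T B' D' p' h = Cmp C T B' D' p' h'\<rbrakk> \<Longrightarrow> h = h'"
  shows "is_pullback C B D B' D' p f p' f'"
proof -
  have "\<exists>!h. arr C T B' h \<and> Cmp C T B' B f' h = b \<and> Cmp C T B' D' p' h = a"
    if "arr C T B b" "arr C T D' a" "Cmp C T B D p b = Cmp C T D' D f a" for T b a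
    using assms(6)[OF that] assms(7)[of T] by metis
  then show ?thesis unfolding is_pullback_def using assms(1-5) by blast
qed

end

context exact_category
begin

lemma exact_is_kernel: "E X Y Z f g \<Longrightarrow> is_kernel C X Y Z f g"
  and exact_is_cokernel: "E X Y Z f g \<Longrightarrow> is_cokernel C X Y Z f g"
  using kernel_cokernel by auto

lemma exact_arr: "E X Y Z f g \<Longrightarrow> arr C X Y f \<and> arr C Y Z g"
  using kernel_cokernel by (auto simp: is_kernel_def)

lemma inflation_arr: "inflation E X Y f \<Longrightarrow> arr C X Y f"
  and deflation_arr: "deflation E X Y f \<Longrightarrow> arr C X Y f"
  by (auto simp: inflation_def deflation_def exact_arr)

lemma exact_of_is_cokernel:
  assumes E: "E X Y Z f g" and k: "is_cokernel C X Y Z' f g'"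
  shows "E X Y Z' f g'"
proof -
  obtain h where h: "iso_arr C Z Z' h" "Cmp C Y Z Z' h g = g'"
    using is_cokernel_unique[OF exact_is_cokernel[OF E] k] by blast
  note a = exact_arr[OF E] is_cokernelD[OF k]
  show ?thesis
    by (rule iso_closed[OF E _ _ iso_arr_Idn iso_arr_Idn h(1)]) (use h a arr_Ob in auto)
qed

text \<open>The axioms only assert that \<^emph>\<open>some\<close> pushout of an inflation is an inflation; by uniqueness of
  pushouts this holds for every one of them. The same applies to pullbacks of deflations.\<close>

lemma inflation_is_pushout:
  assumes i: "inflation E A B i" and p: "is_pushout C A B A' B' i f i' f'"
  shows "inflation E A' B' i'"
proof -
  have "arr C A A' f" using is_pushoutD[OF p] by blast
  then obtain B0 i0 f0 where q: "is_pushout C A B A' B0 i f i0 f0" and "inflation E A' B0 i0"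
    using pushout_inflation[OF i] by blast
  then obtain Z g where E: "E A' B0 Z i0 g" by (auto simp: inflation_def)
  obtain h where h: "iso_arr C B0 B' h" "Cmp C A' B0 B' h i0 = i'"
    using is_pushout_unique[OF q p] by blast
  then obtain h' where h': "arr C B0 B' h" "arr C B' B0 h'" "Cmp C B0 B' B0 h' h = Idn C B0"
    by (auto simp: iso_arr_def)
  note a = exact_arr[OF E]
  have "E A' B' Z i' (Cmp C B' B0 Z g h')"
    by (rule iso_closed[OF E _ _ iso_arr_Idn h(1) iso_arr_Idn])
       (use h h' a is_pushoutD[OF p] arr_Ob in \<open>auto simp: Cmp_assoc'\<close>)
  then show ?thesis by (auto simp: inflation_def)
qed

lemma deflation_is_pullback:
  assumes i: "deflation E B D p" and p: "is_pullback C B D B' D' p f p' f'"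
  shows "deflation E B' D' p'"
proof -
  have "arr C D' D f" using is_pullbackD[OF p] by blast
  then obtain B0 p0 f0 where q: "is_pullback C B D B0 D' p f p0 f0" and "deflation E B0 D' p0"
    using pullback_deflation[OF i] by blast
  then obtain K k where E: "E K B0 D' k p0" by (auto simp: deflation_def)
  obtain h where h: "iso_arr C B0 B' h" "Cmp C B0 B' D' p' h = p0"
    using is_pullback_unique[OF q p] by blast
  then have h': "arr C B0 B' h" by (auto simp: iso_arr_def)
  note a = exact_arr[OF E]
  have "E K B' D' (Cmp C K B0 B' h k) p'"
    by (rule iso_closed[OF E _ _ iso_arr_Idn h(1) iso_arr_Idn])
       (use h h' a is_pullbackD[OF p] arr_Ob in \<open>auto simp: Cmp_assoc'\<close>)
  then show ?thesis by (auto simp: deflation_def)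
qed

text \<open>The arrow \<open>[f, h] : A \<oplus> P \<rightarrow> B\<close> is a pullback of \<open>p\<close> along \<open>g\<close>, hence a deflation. Because it
  is the cokernel of its kernel, \<open>f\<close> is a pushout of the kernel of \<open>p\<close>, hence an inflation.\<close>

lemma exact_of_factored_deflation:
  assumes ker: "is_kernel C A B D f g" and coker: "is_cokernel C A B D f g"
    and p: "deflation E P D p" and h: "arr C P B h" and gh: "Cmp C P B D g h = p"
  shows "E A B D f g"
proof -
  note kD = is_kernelD[OF ker]
  have o [simp]: "A \<in> Ob C" "B \<in> Ob C" "D \<in> Ob C" "P \<in> Ob C"
    using kD h arr_Ob by blast+
  have f [simp]: "arr C A B f" "arr C B D g" "arr C P B h" and gf: "Cmp C A B D g f = \<zero>\<^bsub>Hom C A D\<^esub>"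
    using kD h by auto
  obtain K k where K: "E K P D k p" using p by (auto simp: deflation_def)
  note KD = is_kernelD[OF exact_is_kernel[OF K]]
  have k [simp]: "arr C K P k" "arr C P D p" "K \<in> Ob C" using KD arr_Ob by auto
  obtain Q i r j s where Q: "biproduct Q A P i r j s"
    using ex_direct_sum[OF o(1) o(4)] by (auto simp: direct_sum_two_iff)
  note QD [simp] = biproductD[OF Q] biproductD_reassoc[OF Q]
  have [simp]: "Q \<in> Ob C" using biproduct_Ob[OF Q] by auto
  define q where "q = Cmp C Q A B f r \<oplus>\<^bsub>Hom C Q B\<^esub> Cmp C Q P B h s"
  have q [simp]: "arr C Q B q" by (simp add: q_def)
  have qi: "Cmp C A Q B q i = f" and qj: "Cmp C P Q B q j = h"
    by (simp_all add: q_def Cmp_bilinear Cmp_assoc')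
  have "is_pullback C P D Q B p g q s"
  proof (rule is_pullbackI)
    show "Cmp C Q P D p s = Cmp C Q B D g q"
      by (simp add: q_def Cmp_bilinear Cmp_reassoc[OF gf] Cmp_reassoc[OF gh])
  next
    fix T b a assume b: "arr C T P b" and a: "arr C T B a" and e: "Cmp C T P D p b = Cmp C T B D g
        a"
    have T: "T \<in> Ob C" using b arr_Ob by blast
    let ?t = "a \<oplus>\<^bsub>Hom C T B\<^esub> \<ominus>\<^bsub>Hom C T B\<^esub> (Cmp C T P B h b)"
    have "Cmp C T B D g ?t = \<zero>\<^bsub>Hom C T D\<^esub>"
      using a b T by (simp add: Cmp_bilinear Cmp_reassoc[OF gh] e)
    then obtain t where t: "arr C T A t" "Cmp C T A B f t = ?t"
      using is_kernel_ex[OF ker, of T ?t] a b by auto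
    let ?h = "Cmp C T A Q i t \<oplus>\<^bsub>Hom C T Q\<^esub> Cmp C T P Q j b"
    have "Cmp C T Q P s ?h = b" using t(1) b T by (simp add: Cmp_bilinear)
    moreover have "Cmp C T Q B q ?h = ?t \<oplus>\<^bsub>Hom C T B\<^esub> Cmp C T P B h b"
      using t b T by (simp add: Cmp_bilinear Cmp_reassoc[OF qi] Cmp_reassoc[OF qj])
    moreover have "\<dots> = a" using a b by (simp add: hom_assoc)
    ultimately show "\<exists>h. arr C T Q h \<and> Cmp C T Q P s h = b \<and> Cmp C T Q B q h = a"
      using t b by (intro exI[of _ ?h]) auto
  next
    fix T x y assume x: "arr C T Q x" and y: "arr C T Q y" and e: "Cmp C T Q P s x = Cmp C T Q P s
        y"
      and e': "Cmp C T Q B q x = Cmp C T Q B q y"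
    have "Cmp C T A B f (Cmp C T Q A r x) \<oplus>\<^bsub>Hom C T B\<^esub> Cmp C T P B h (Cmp C T Q P s x)
        = Cmp C T A B f (Cmp C T Q A r y) \<oplus>\<^bsub>Hom C T B\<^esub> Cmp C T P B h (Cmp C T Q P s y)"
      using e' x y by (simp add: q_def Cmp_bilinear Cmp_assoc')
    then have "Cmp C T A B f (Cmp C T Q A r x) = Cmp C T A B f (Cmp C T Q A r y)"
      using e x y by (simp add: hom_comm[of T B "Cmp C T A B f _"] hom_add_cancel)
    then have "Cmp C T Q A r x = Cmp C T Q A r y"
      by (rule is_kernel_mono[OF ker, where T = T, rotated 2]) (use x y in simp_all)
    then show "x = y"
      using e biproduct_split_left[OF Q x] biproduct_split_left[OF Q y] by metis
  qed simp_all
  then have "deflation E Q B q" using deflation_is_pullback[OF p] by blast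
  \<comment> \<open>Now the second half: a compatible pair \<open>(a, b)\<close> on \<open>A \<oplus> P\<close> vanishes on the kernel \<open>l\<close> of
    \<open>q = [f, h]\<close>, and so factors through the cokernel \<open>q\<close> of \<open>l\<close>.\<close>
  then obtain L l where L: "E L Q B l q" by (auto simp: deflation_def)
  note LD = is_kernelD[OF exact_is_kernel[OF L]]
  have l [simp]: "arr C L Q l" "L \<in> Ob C" using LD arr_Ob by auto
  have pk: "Cmp C K P D p k = \<zero>\<^bsub>Hom C K D\<^esub>" using KD by blast
  have "Cmp C K B D g (Cmp C K P B h k) = \<zero>\<^bsub>Hom C K D\<^esub>"
    by (simp add: Cmp_reassoc[OF gh] pk)
  then obtain m where m [simp]: "arr C K A m" and fm: "Cmp C K A B f m = Cmp C K P B h k"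
    using is_kernel_ex[OF ker, of K "Cmp C K P B h k"] by auto
  have "is_pushout C K P A B k m f h"
  proof (rule is_pushoutI)
    show "Cmp C K P B h k = Cmp C K A B f m" using fm by simp
  next
    fix T b a assume b [simp]: "arr C P T b" and a [simp]: "arr C A T a"
      and e: "Cmp C K P T b k = Cmp C K A T a m"
    have T [simp]: "T \<in> Ob C" using b arr_Ob by blast
    let ?t = "Cmp C Q A T a r \<oplus>\<^bsub>Hom C Q T\<^esub> Cmp C Q P T b s"
    let ?lA = "Cmp C L Q A r l" and ?lP = "Cmp C L Q P s l"
    have z: "Cmp C L A B f ?lA \<oplus>\<^bsub>Hom C L B\<^esub> Cmp C L P B h ?lP = \<zero>\<^bsub>Hom C L B\<^esub>"
      using LD by (simp add: q_def Cmp_bilinear Cmp_assoc')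
    have "Cmp C L B D g (Cmp C L A B f ?lA \<oplus>\<^bsub>Hom C L B\<^esub> Cmp C L P B h ?lP) = Cmp C L P D p ?lP"
      by (simp add: Cmp_bilinear Cmp_reassoc[OF gf] Cmp_reassoc[OF gh])
    then have "Cmp C L P D p ?lP = \<zero>\<^bsub>Hom C L D\<^esub>" using z by simp
    then obtain v where v [simp]: "arr C L K v" and kv: "Cmp C L K P k v = ?lP"
      using is_kernel_ex[OF exact_is_kernel[OF K], of L ?lP] by auto
    have "Cmp C L A B f (Cmp C L K A m v) = Cmp C L P B h ?lP"
      by (simp add: Cmp_reassoc[OF fm] Cmp_assoc' kv)
    then have "Cmp C L A B f (?lA \<oplus>\<^bsub>Hom C L A\<^esub> Cmp C L K A m v) = Cmp C L A B f \<zero>\<^bsub>Hom C L A\<^esub>"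
      using z by (simp add: Cmp_bilinear)
    then have "?lA \<oplus>\<^bsub>Hom C L A\<^esub> Cmp C L K A m v = \<zero>\<^bsub>Hom C L A\<^esub>"
      by (rule is_kernel_mono[OF ker, where T = L, rotated 2]) simp_all
    then have "Cmp C L A T a (?lA \<oplus>\<^bsub>Hom C L A\<^esub> Cmp C L K A m v) = \<zero>\<^bsub>Hom C L T\<^esub>"
      by simp
    moreover have "Cmp C L P T b ?lP = Cmp C L A T a (Cmp C L K A m v)"
      unfolding kv[symmetric] by (simp add: Cmp_reassoc[OF e] Cmp_assoc')
    ultimately have "Cmp C L Q T ?t l = \<zero>\<^bsub>Hom C L T\<^esub>"
      by (simp add: Cmp_bilinear Cmp_assoc')
    then obtain w where w [simp]: "arr C B T w" and wq: "Cmp C Q B T w q = ?t"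
      using is_cokernel_ex[OF exact_is_cokernel[OF L], of T ?t] by auto
    have "Cmp C P B T w h = Cmp C P Q T (Cmp C Q B T w q) j" by (simp add: Cmp_assoc' qj)
    also have "\<dots> = b" unfolding wq by (simp add: Cmp_bilinear Cmp_assoc')
    finally have 1: "Cmp C P B T w h = b" .
    have "Cmp C A B T w f = Cmp C A Q T (Cmp C Q B T w q) i" by (simp add: Cmp_assoc' qi)
    also have "\<dots> = a" unfolding wq by (simp add: Cmp_bilinear Cmp_assoc')
    finally show "\<exists>w. arr C B T w \<and> Cmp C P B T w h = b \<and> Cmp C A B T w f = a"
      using 1 w by blast
  next
    fix T x y assume x [simp]: "arr C B T x" and y [simp]: "arr C B T y"
      and e: "Cmp C P B T x h = Cmp C P B T y h" and e': "Cmp C A B T x f = Cmp C A B T y f"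
    have "Cmp C Q B T x q = Cmp C Q B T y q"
      by (simp add: q_def Cmp_bilinear Cmp_assoc e e')
    then show "x = y" using is_cokernel_epi[OF exact_is_cokernel[OF L]] x y by blast
  qed simp_all
  moreover have "inflation E K P k" using K by (auto simp: inflation_def)
  ultimately have "inflation E A B f" using inflation_is_pushout by blast
  then show ?thesis using exact_of_is_cokernel[OF _ coker] by (auto simp: inflation_def)
qed

lemma short_exact_of_projective:
  assumes E: "E A B D f g" and P: "projective C E P"
  shows "short_exact (Hom C P A) (Hom C P B) (Hom C P D) (Cmp C P A B f) (Cmp C P B D g)"
proof -
  note k = exact_is_kernel[OF E]
  note kD = is_kernelD[OF k]
  have o: "P \<in> Ob C" "A \<in> Ob C" "B \<in> Ob C" "D \<in> Ob C" using P kD arr_Ob by (auto simp: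
      projective_def)
  have c: "\<And>X Y t. X \<in> Ob C \<Longrightarrow> Y \<in> Ob C \<Longrightarrow> t \<in> carrier (Hom C X Y) \<longleftrightarrow> arr C X Y t" by (simp add:
      arr_def)
  have "inj_on (Cmp C P A B f) (carrier (Hom C P A))"
    using is_kernel_mono[OF k] o by (intro inj_onI) (simp add: c)
  moreover have "Cmp C P A B f ` carrier (Hom C P A) = {m \<in> carrier (Hom C P B). Cmp C P B D g m =
      \<zero>\<^bsub>Hom C P D\<^esub>}"
  proof safe
    fix t assume "t \<in> carrier (Hom C P A)"
    then have t: "arr C P A t" using o c by blast
    show "Cmp C P A B f t \<in> carrier (Hom C P B)" using t kD o by (simp add: c)
    show "Cmp C P B D g (Cmp C P A B f t) = \<zero>\<^bsub>Hom C P D\<^esub>" using t kD o by (simp add: Cmp_assoc)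
  next
    fix t assume "t \<in> carrier (Hom C P B)" "Cmp C P B D g t = \<zero>\<^bsub>Hom C P D\<^esub>"
    then obtain s where "arr C P A s" "Cmp C P A B f s = t" using is_kernel_ex[OF k, of P t] o c by
        blast
    then show "t \<in> Cmp C P A B f ` carrier (Hom C P A)" using o c by blast
  qed
  moreover have "deflation E B D g" using E by (auto simp: deflation_def)
  then have "Cmp C P B D g ` carrier (Hom C P B) = carrier (Hom C P D)"
    using P kD o c Cmp_arr[of P B _ D g] unfolding projective_def by (auto simp: image_iff; metis)
  ultimately show ?thesis by (simp add: short_exact_def)
qed

lemma short_exact_of_injective:
  assumes E: "E A B D f g" and P: "injective C E P"
  shows "short_exact (Hom C D P) (Hom C B P) (Hom C A P)
    (\<lambda>h. Cmp C B D P h g) (\<lambda>h. Cmp C A B P h f)"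
proof -
  note k = exact_is_cokernel[OF E]
  note kD = is_cokernelD[OF k]
  have o: "P \<in> Ob C" "A \<in> Ob C" "B \<in> Ob C" "D \<in> Ob C" using P kD arr_Ob by (auto simp:
      injective_def)
  have c: "\<And>X Y t. X \<in> Ob C \<Longrightarrow> Y \<in> Ob C \<Longrightarrow> t \<in> carrier (Hom C X Y) \<longleftrightarrow> arr C X Y t" by (simp add:
      arr_def)
  have "inj_on (\<lambda>h. Cmp C B D P h g) (carrier (Hom C D P))"
    using is_cokernel_epi[OF k] o by (intro inj_onI) (simp add: c)
  moreover have "(\<lambda>h. Cmp C B D P h g) ` carrier (Hom C D P) = {m \<in> carrier (Hom C B P). Cmp C A B P
      m f = \<zero>\<^bsub>Hom C A P\<^esub>}"
  proof safe
    fix t assume "t \<in> carrier (Hom C D P)"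
    then have t: "arr C D P t" using o c by blast
    show "Cmp C B D P t g \<in> carrier (Hom C B P)" using t kD o by (simp add: c)
    show "Cmp C A B P (Cmp C B D P t g) f = \<zero>\<^bsub>Hom C A P\<^esub>" using t kD o by (simp add: Cmp_assoc')
  next
    fix t assume "t \<in> carrier (Hom C B P)" "Cmp C A B P t f = \<zero>\<^bsub>Hom C A P\<^esub>"
    then obtain s where "arr C D P s" "Cmp C B D P s g = t" using is_cokernel_ex[OF k, of P t] o c
        by blast
    then show "t \<in> (\<lambda>h. Cmp C B D P h g) ` carrier (Hom C D P)" using o c by blast
  qed
  moreover have "inflation E A B f" using E by (auto simp: inflation_def)
  then have "(\<lambda>h. Cmp C A B P h f) ` carrier (Hom C B P) = carrier (Hom C A P)"
    using P kD o c Cmp_arr[of A B f P] unfolding injective_def by (auto simp: image_iff; metis)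
  ultimately show ?thesis by (simp add: short_exact_def)
qed

text \<open>The exact structure of a category with enough projectives and injectives in a class \<open>\<P>\<close> can
  be recovered from \<open>\<P>\<close>: covering the test objects by objects of \<open>\<P>\<close> turns exactness of the Hom
  sequences into the kernel and cokernel property, and a deflation \<open>P \<rightarrow> D\<close> with \<open>P \<in> \<P>\<close> factors
  through \<open>B \<rightarrow> D\<close>.\<close>

lemma exact_iff_short_exact:
  assumes proj: "\<And>P. P \<in> \<P> \<Longrightarrow> projective C E P" and inj: "\<And>P. P \<in> \<P> \<Longrightarrow> injective C E P"
    and enp: "\<And>X. X \<in> Ob C \<Longrightarrow> \<exists>P \<in> \<P>. \<exists>p. deflation E P X p"
    and eni: "\<And>X. X \<in> Ob C \<Longrightarrow> \<exists>P \<in> \<P>. \<exists>i. inflation E X P i"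
  shows "E A B D f g \<longleftrightarrow> arr C A B f \<and> arr C B D g \<and> (\<forall>P \<in> \<P>.
        short_exact (Hom C P A) (Hom C P B) (Hom C P D) (Cmp C P A B f) (Cmp C P B D g) \<and>
        short_exact (Hom C D P) (Hom C B P) (Hom C A P)
          (\<lambda>h. Cmp C B D P h g) (\<lambda>h. Cmp C A B P h f))" (is "_ \<longleftrightarrow> ?R")
proof
  assume "E A B D f g"
  then show ?R
    using exact_arr short_exact_of_projective[OF _ proj] short_exact_of_injective[OF _ inj] by blast
next
  assume R: ?R
  then have [simp]: "arr C A B f" "arr C B D g" by auto
  then have [simp]: "A \<in> Ob C" "B \<in> Ob C" "D \<in> Ob C" using arr_Ob by blast+
  have c: "\<And>X Y t. X \<in> Ob C \<Longrightarrow> Y \<in> Ob C \<Longrightarrow> t \<in> carrier (Hom C X Y) \<longleftrightarrow> arr C X Y t" by (simp add: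
      arr_def)
  have PO: "P \<in> Ob C" if "P \<in> \<P>" for P using proj[OF that] by (simp add: projective_def)
  have s1: "inj_on (Cmp C P A B f) (carrier (Hom C P A))" 
     "Cmp C P A B f ` carrier (Hom C P A) = {m \<in> carrier (Hom C P B). Cmp C P B D g m = \<zero>\<^bsub>Hom C P D\<^esub>}"
         
     "Cmp C P B D g ` carrier (Hom C P B) = carrier (Hom C P D)" if "P \<in> \<P>" for P
    using R that by (auto simp only: short_exact_def)
  have s2: "inj_on (\<lambda>h. Cmp C B D P h g) (carrier (Hom C D P))"
     "(\<lambda>h. Cmp C B D P h g) ` carrier (Hom C D P) = {m \<in> carrier (Hom C B P). Cmp C A B P m f = \<zero>\<^bsub>Hom
         C A P\<^esub>}"
     "(\<lambda>h. Cmp C A B P h f) ` carrier (Hom C B P) = carrier (Hom C A P)" if "P \<in> \<P>" for P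
    using R that by (auto simp only: short_exact_def)
  have monoP: "a = b" if "P \<in> \<P>" "arr C P A a" "arr C P A b" "Cmp C P A B f a = Cmp C P A B f b" for
      P a b
    using inj_onD[OF s1(1)[OF that(1)] that(4)] that PO by (simp add: c)
  have kerP: "\<exists>s. arr C P A s \<and> Cmp C P A B f s = t"
    if "P \<in> \<P>" "arr C P B t" "Cmp C P B D g t = \<zero>\<^bsub>Hom C P D\<^esub>" for P t
  proof -
    have "t \<in> Cmp C P A B f ` carrier (Hom C P A)" unfolding s1(2)[OF that(1)] using that PO c by
        simp
    then show ?thesis using that(1) PO c by auto
  qed
  have zP: "Cmp C P B D g (Cmp C P A B f t) = \<zero>\<^bsub>Hom C P D\<^esub>" if "P \<in> \<P>" "arr C P A t" for P t
  proof -
    have "Cmp C P A B f t \<in> Cmp C P A B f ` carrier (Hom C P A)" using that PO c by simp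
    then show ?thesis unfolding s1(2)[OF that(1)] by simp
  qed
  have epiP: "a = b" if "P \<in> \<P>" "arr C D P a" "arr C D P b" "Cmp C B D P a g = Cmp C B D P b g" for
      P a b
    using inj_onD[OF s2(1)[OF that(1)] that(4)] that PO by (simp add: c)
  have cokP: "\<exists>s. arr C D P s \<and> Cmp C B D P s g = t"
    if "P \<in> \<P>" "arr C B P t" "Cmp C A B P t f = \<zero>\<^bsub>Hom C A P\<^esub>" for P t
  proof -
    have "t \<in> (\<lambda>h. Cmp C B D P h g) ` carrier (Hom C D P)" unfolding s2(2)[OF that(1)] using that PO
        c by simp
    then show ?thesis using that(1) PO c by auto
  qed
  have gf: "Cmp C A B D g f = \<zero>\<^bsub>Hom C A D\<^esub>"
  proof -
    obtain P p where P: "P \<in> \<P>" "deflation E P A p" using enp[of A] by auto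
    then obtain K k where E: "E K P A k p" by (auto simp: deflation_def)
    have p: "arr C P A p" using exact_arr[OF E] by blast
    show ?thesis
    proof (rule is_cokernel_epi[OF exact_is_cokernel[OF E]])
      show "Cmp C P A D (Cmp C A B D g f) p = Cmp C P A D \<zero>\<^bsub>Hom C A D\<^esub> p"
        using zP[OF P(1) p] p by (simp add: Cmp_assoc')
    qed simp_all
  qed
  have mono: "a = b" if a: "arr C T A a" and b: "arr C T A b"
    and e: "Cmp C T A B f a = Cmp C T A B f b" for T a b
  proof -
    have T: "T \<in> Ob C" using a arr_Ob by blast
    obtain P p where P: "P \<in> \<P>" "deflation E P T p" using enp[OF T] by auto
    then obtain K k where E: "E K P T k p" by (auto simp: deflation_def)
    have p: "arr C P T p" using exact_arr[OF E] by blast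
    have "Cmp C P T A a p = Cmp C P T A b p"
      by (rule monoP[OF P(1)]) (use a b p Cmp_reassoc[OF e a] Cmp_assoc'[OF p b] in auto)
    then show ?thesis using is_cokernel_epi[OF exact_is_cokernel[OF E] a b] by blast
  qed
  have epi: "a = b" if a: "arr C D T a" and b: "arr C D T b"
    and e: "Cmp C B D T a g = Cmp C B D T b g" for T a b
  proof -
    have T: "T \<in> Ob C" using a arr_Ob by blast
    obtain P p where P: "P \<in> \<P>" "inflation E T P p" using eni[OF T] by auto
    then obtain K k where E: "E T P K p k" by (auto simp: inflation_def)
    have p: "arr C T P p" using exact_arr[OF E] by blast
    have "Cmp C D T P p a = Cmp C D T P p b"
      by (rule epiP[OF P(1)]) (use a b p e in \<open>auto simp: Cmp_assoc'\<close>)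
    then show ?thesis using is_kernel_mono[OF exact_is_kernel[OF E] a b] by blast
  qed
  have ker: "is_kernel C A B D f g"
  proof (rule is_kernelI[OF _ _ gf _ mono])
    fix T t assume t: "arr C T B t" and z: "Cmp C T B D g t = \<zero>\<^bsub>Hom C T D\<^esub>"
    have T: "T \<in> Ob C" using t arr_Ob by blast
    obtain P p where P: "P \<in> \<P>" "deflation E P T p" using enp[OF T] by auto
    then obtain K k where E: "E K P T k p" by (auto simp: deflation_def)
    note KD = is_cokernelD[OF exact_is_cokernel[OF E]]
    have p: "arr C P T p" "arr C K P k" "K \<in> Ob C" and pk: "Cmp C K P T p k = \<zero>\<^bsub>Hom C K T\<^esub>"
      using KD arr_Ob by auto
    have "Cmp C P B D g (Cmp C P T B t p) = \<zero>\<^bsub>Hom C P D\<^esub>" using p t by (simp add: Cmp_reassoc[OF z])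
    then obtain s where s: "arr C P A s" "Cmp C P A B f s = Cmp C P T B t p"
      using kerP[OF P(1), of "Cmp C P T B t p"] p t by auto
    have "Cmp C K P A s k = \<zero>\<^bsub>Hom C K A\<^esub>"
      by (rule mono[where T = K]) (use s p t in \<open>auto simp: Cmp_reassoc[OF s(2)] Cmp_assoc' pk\<close>)
    then obtain s' where s': "arr C T A s'" "Cmp C P T A s' p = s"
      using is_cokernel_ex[OF exact_is_cokernel[OF E] s(1)] by blast
    have "Cmp C T A B f s' = t"
      by (rule is_cokernel_epi[OF exact_is_cokernel[OF E]]) (use s' s t p in \<open>auto simp:
          Cmp_assoc'\<close>)
    then show "\<exists>s. arr C T A s \<and> Cmp C T A B f s = t" using s' by blast
  qed simp_all
  have coker: "is_cokernel C A B D f g"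
  proof (rule is_cokernelI[OF _ _ gf _ epi])
    fix T t assume t: "arr C B T t" and z: "Cmp C A B T t f = \<zero>\<^bsub>Hom C A T\<^esub>"
    have T: "T \<in> Ob C" using t arr_Ob by blast
    obtain P p where P: "P \<in> \<P>" "inflation E T P p" using eni[OF T] by auto
    then obtain K k where E: "E T P K p k" by (auto simp: inflation_def)
    note KD = is_kernelD[OF exact_is_kernel[OF E]]
    have p: "arr C T P p" "arr C P K k" "K \<in> Ob C" "P \<in> Ob C" and pk: "Cmp C T P K k p = \<zero>\<^bsub>Hom C T K\<^esub>"
      using KD arr_Ob by auto
    have "Cmp C A B P (Cmp C B T P p t) f = \<zero>\<^bsub>Hom C A P\<^esub>" using p t by (simp add: Cmp_assoc' z)
    then obtain s where s: "arr C D P s" "Cmp C B D P s g = Cmp C B T P p t"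
      using cokP[OF P(1), of "Cmp C B T P p t"] p t by auto
    have "Cmp C D P K k s = \<zero>\<^bsub>Hom C D K\<^esub>"
      by (rule epi[where T = K]) (use s p t in \<open>auto simp: Cmp_assoc' s(2) Cmp_reassoc[OF pk]\<close>)
    then obtain s' where s': "arr C D T s'" "Cmp C D T P p s' = s"
      using is_kernel_ex[OF exact_is_kernel[OF E] s(1)] by blast
    have "Cmp C B D T s' g = t"
      by (rule is_kernel_mono[OF exact_is_kernel[OF E]])
        (use s' s t p in \<open>auto simp: Cmp_reassoc[OF s'(2)]\<close>)
    then show "\<exists>s. arr C D T s \<and> Cmp C B D T s g = t" using s' by blast
  qed simp_all
  obtain P p where P: "P \<in> \<P>" "deflation E P D p" using enp[of D] by auto
  have "p \<in> carrier (Hom C P D)" using deflation_arr[OF P(2)] by (simp add: arr_def)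
  then obtain h where "arr C P B h" "Cmp C P B D g h = p"
    using s1(3)[OF P(1)] PO[OF P(1)] c by (metis \<open>B \<in> Ob C\<close> imageE)
  then show "E A B D f g" using exact_of_factored_deflation[OF ker coker P(2)] by blast
qed

end

section \<open>Objects with an involution\<close>

text \<open>The involution is strict, \<open>To (To X) = X\<close> and not merely up to isomorphism, as it comes from
  an involution of the set of indecomposable objects.\<close>

locale involutive_category = linear_category R C
  for R :: "('r, 'k) ring_scheme" (structure) and C :: "('o, 'm, 'r) lincat" +
  fixes To :: "'o \<Rightarrow> 'o" and Tm :: "'o \<Rightarrow> 'o \<Rightarrow> 'm \<Rightarrow> 'm"
  assumes To_Ob [simp]: "X \<in> Ob C \<Longrightarrow> To X \<in> Ob C"
    and To_To [simp]: "X \<in> Ob C \<Longrightarrow> To (To X) = X"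
    and Tm_arr [simp]: "arr C X Y f \<Longrightarrow> arr C (To X) (To Y) (Tm X Y f)"
    and Tm_Tm [simp]: "arr C X Y f \<Longrightarrow> Tm (To X) (To Y) (Tm X Y f) = f"
    and Tm_add: "\<lbrakk>arr C X Y f; arr C X Y g\<rbrakk> \<Longrightarrow>
      Tm X Y (f \<oplus>\<^bsub>Hom C X Y\<^esub> g) = Tm X Y f \<oplus>\<^bsub>Hom C (To X) (To Y)\<^esub> Tm X Y g"
    and Tm_smult: "\<lbrakk>r \<in> carrier R; arr C X Y f\<rbrakk> \<Longrightarrow>
      Tm X Y (r \<odot>\<^bsub>Hom C X Y\<^esub> f) = r \<odot>\<^bsub>Hom C (To X) (To Y)\<^esub> Tm X Y f"
    and Tm_Cmp: "\<lbrakk>arr C X Y f; arr C Y Z g\<rbrakk> \<Longrightarrow>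
      Tm X Z (Cmp C X Y Z g f) = Cmp C (To X) (To Y) (To Z) (Tm Y Z g) (Tm X Y f)"
    and Tm_Idn [simp]: "X \<in> Ob C \<Longrightarrow> Tm X X (Idn C X) = Idn C (To X)"
begin

abbreviation D where "D \<equiv> equivariant_cat C To Tm"

text \<open>The images of arrows out of or into an object of the form \<open>To X\<close>, with \<open>To (To X)\<close> replaced
  by \<open>X\<close>.\<close>

lemma Tm_arr' [simp]:
  "\<lbrakk>arr C (To X) Y f; X \<in> Ob C\<rbrakk> \<Longrightarrow> arr C X (To Y) (Tm (To X) Y f)"
  "\<lbrakk>arr C X (To Y) f; Y \<in> Ob C\<rbrakk> \<Longrightarrow> arr C (To X) Y (Tm X (To Y) f)"
  "\<lbrakk>arr C (To X) (To Y) f; X \<in> Ob C; Y \<in> Ob C\<rbrakk> \<Longrightarrow> arr C X Y (Tm (To X) (To Y) f)"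
  using Tm_arr[of "To X" Y f] Tm_arr[of X "To Y" f] Tm_arr[of "To X" "To Y" f] by simp_all

lemma Tm_Tm' [simp]:
  "\<lbrakk>arr C (To X) Y f; X \<in> Ob C\<rbrakk> \<Longrightarrow> Tm X (To Y) (Tm (To X) Y f) = f"
  "\<lbrakk>arr C X (To Y) f; Y \<in> Ob C\<rbrakk> \<Longrightarrow> Tm (To X) Y (Tm X (To Y) f) = f"
  "\<lbrakk>arr C (To X) (To Y) f; X \<in> Ob C; Y \<in> Ob C\<rbrakk> \<Longrightarrow> Tm X Y (Tm (To X) (To Y) f) = f"
  using Tm_Tm[of "To X" Y f] Tm_Tm[of X "To Y" f] Tm_Tm[of "To X" "To Y" f] by simp_all

lemma Tm_Idn' [simp]: "X \<in> Ob C \<Longrightarrow> Tm (To X) (To X) (Idn C (To X)) = Idn C X"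
  using Tm_Idn[of "To X"] by simp

lemma Tm_zero [simp]:
  assumes "X \<in> Ob C" "Y \<in> Ob C"
  shows "Tm X Y \<zero>\<^bsub>Hom C X Y\<^esub> = \<zero>\<^bsub>Hom C (To X) (To Y)\<^esub>"
proof -
  have "arr C (To X) (To Y) (Tm X Y \<zero>\<^bsub>Hom C X Y\<^esub>)" using assms by simp
  moreover have "Tm X Y \<zero>\<^bsub>Hom C X Y\<^esub> \<oplus>\<^bsub>Hom C (To X) (To Y)\<^esub> Tm X Y \<zero>\<^bsub>Hom C X Y\<^esub> = Tm X Y \<zero>\<^bsub>Hom C X Y\<^esub>"
    using assms by (simp flip: Tm_add)
  ultimately show ?thesis by (metis hom_l_neg hom_r_neg1)
qed

text \<open>Applying the involution to \<open>\<xi> \<circ> Tm \<xi> = 1\<close> yields \<open>Tm \<xi> \<circ> \<xi> = 1\<close>, so that \<open>\<xi>\<close> is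
  automatically an isomorphism.\<close>

lemma Ob_D_iff: "(X, \<xi>) \<in> Ob D \<longleftrightarrow> X \<in> Ob C \<and> arr C (To X) X \<xi> \<and>
    Cmp C X (To X) X \<xi> (Tm (To X) X \<xi>) = Idn C X"
proof -
  have "iso_arr C (To X) X \<xi>" if X: "X \<in> Ob C" "arr C (To X) X \<xi>"
    and e: "Cmp C X (To X) X \<xi> (Tm (To X) X \<xi>) = Idn C X"
  proof (rule iso_arrI)
    have "Tm X X (Cmp C X (To X) X \<xi> (Tm (To X) X \<xi>)) = Idn C (To X)" using X e by simp
    then show "Cmp C (To X) X (To X) (Tm (To X) X \<xi>) \<xi> = Idn C (To X)"
      using X by (simp add: Tm_Cmp del: Tm_Idn)
  qed (use X e in simp_all)
  then show ?thesis by (auto simp: equivariant_cat_def iso_arr_def)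
qed

lemma Ob_DD:
  assumes "(X, \<xi>) \<in> Ob D"
  shows "X \<in> Ob C" "arr C (To X) X \<xi>" "Cmp C X (To X) X \<xi> (Tm (To X) X \<xi>) = Idn C X"
    "Cmp C (To X) X (To X) (Tm (To X) X \<xi>) \<xi> = Idn C (To X)"
proof -
  show X: "X \<in> Ob C" "arr C (To X) X \<xi>" and e: "Cmp C X (To X) X \<xi> (Tm (To X) X \<xi>) = Idn C X"
    using assms by (auto simp: Ob_D_iff)
  have "Tm X X (Cmp C X (To X) X \<xi> (Tm (To X) X \<xi>)) = Idn C (To X)" using X e by simp
  then show "Cmp C (To X) X (To X) (Tm (To X) X \<xi>) \<xi> = Idn C (To X)"
    using X by (simp add: Tm_Cmp del: Tm_Idn)
qed

lemma D_simps [simp]: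
  "Cmp D (X, \<xi>) (Y, \<upsilon>) (Z, \<zeta>) = Cmp C X Y Z"
  "Idn D (X, \<xi>) = Idn C X"
  "\<zero>\<^bsub>Hom D (X, \<xi>) (Y, \<upsilon>)\<^esub> = \<zero>\<^bsub>Hom C X Y\<^esub>"
  "add (Hom D (X, \<xi>) (Y, \<upsilon>)) = add (Hom C X Y)"
  "smult (Hom D (X, \<xi>) (Y, \<upsilon>)) = smult (Hom C X Y)"
  by (simp_all add: equivariant_cat_def)

lemma arr_D_iff: "arr D (X, \<xi>) (Y, \<upsilon>) f \<longleftrightarrow> (X, \<xi>) \<in> Ob D \<and> (Y, \<upsilon>) \<in> Ob D \<and> arr C X Y f \<and>
    Cmp C (To X) X Y f \<xi> = Cmp C (To X) (To Y) Y \<upsilon> (Tm X Y f)"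
  by (auto simp: arr_def equivariant_cat_def)

text \<open>The action of the involution on all morphisms between two objects of \<open>C\<^sup>\<psi>\<close>; its fixed points
  are the morphisms of \<open>C\<^sup>\<psi>\<close>. Since it is compatible with composition, a morphism that is uniquely
  determined by equations between equivariant morphisms is itself equivariant.\<close>

definition twist :: "'o \<Rightarrow> 'm \<Rightarrow> 'o \<Rightarrow> 'm \<Rightarrow> 'm \<Rightarrow> 'm" where
  "twist X \<xi> Y \<upsilon> f = Cmp C X (To Y) Y \<upsilon> (Cmp C X (To X) (To Y) (Tm X Y f) (Tm (To X) X \<xi>))"

lemma twist_arr [simp]:
  "\<lbrakk>(X, \<xi>) \<in> Ob D; (Y, \<upsilon>) \<in> Ob D; arr C X Y f\<rbrakk> \<Longrightarrow> arr C X Y (twist X \<xi> Y \<upsilon> f)"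
  by (simp add: twist_def Ob_DD)

lemma arr_D_twist: "arr D (X, \<xi>) (Y, \<upsilon>) f \<longleftrightarrow> (X, \<xi>) \<in> Ob D \<and> (Y, \<upsilon>) \<in> Ob D \<and> arr C X Y f \<and>
    twist X \<xi> Y \<upsilon> f = f"
proof -
  have "Cmp C (To X) X Y f \<xi> = Cmp C (To X) (To Y) Y \<upsilon> (Tm X Y f) \<longleftrightarrow> twist X \<xi> Y \<upsilon> f = f"
    if X: "(X, \<xi>) \<in> Ob D" and Y: "(Y, \<upsilon>) \<in> Ob D" and f: "arr C X Y f"
  proof
    note o = Ob_DD[OF X] Ob_DD[OF Y]
    assume e: "Cmp C (To X) X Y f \<xi> = Cmp C (To X) (To Y) Y \<upsilon> (Tm X Y f)"
    have "twist X \<xi> Y \<upsilon> f = Cmp C X (To X) Y (Cmp C (To X) (To Y) Y \<upsilon> (Tm X Y f)) (Tm (To X) X \<xi>)"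
      using o(1,2,5,6) f by (simp add: twist_def Cmp_assoc)
    also have "\<dots> = f" unfolding e[symmetric] using o(1-3) f by (simp add: Cmp_assoc')
    finally show "twist X \<xi> Y \<upsilon> f = f" .
  next
    note o = Ob_DD[OF X] Ob_DD[OF Y]
    assume e: "twist X \<xi> Y \<upsilon> f = f"
    have "Cmp C (To X) X Y (twist X \<xi> Y \<upsilon> f) \<xi> = Cmp C (To X) (To Y) Y \<upsilon> (Tm X Y f)"
      using o(1,2,4,5,6) f by (simp add: twist_def Cmp_assoc')
    then show "Cmp C (To X) X Y f \<xi> = Cmp C (To X) (To Y) Y \<upsilon> (Tm X Y f)"
      unfolding e .
  qed
  then show ?thesis unfolding arr_D_iff by blast
qed

lemma twist_Cmp:
  assumes "(X, \<xi>) \<in> Ob D" "(Y, \<upsilon>) \<in> Ob D" "(Z, \<zeta>) \<in> Ob D" "arr C X Y f" "arr C Y Z g"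
  shows "twist X \<xi> Z \<zeta> (Cmp C X Y Z g f) = Cmp C X Y Z (twist Y \<upsilon> Z \<zeta> g) (twist X \<xi> Y \<upsilon> f)"
proof -
  note o = Ob_DD[OF assms(1)] Ob_DD[OF assms(2)] Ob_DD[OF assms(3)]
  show ?thesis
    using o(1,2,5,6,9,10) assms(4,5)
    by (simp add: twist_def Tm_Cmp Cmp_assoc' Cmp_reassoc[OF o(8)])
qed

lemma twist_Idn [simp]: "(X, \<xi>) \<in> Ob D \<Longrightarrow> twist X \<xi> X \<xi> (Idn C X) = Idn C X"
  by (simp add: twist_def Ob_DD)

lemma twist_twist [simp]:
  assumes "(X, \<xi>) \<in> Ob D" "(Y, \<upsilon>) \<in> Ob D" "arr C X Y f"
  shows "twist X \<xi> Y \<upsilon> (twist X \<xi> Y \<upsilon> f) = f"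
proof -
  note o = Ob_DD[OF assms(1)] Ob_DD[OF assms(2)]
  show ?thesis
    using o assms(3)
    by (simp add: twist_def Tm_Cmp Cmp_assoc' Cmp_reassoc[OF o(7)] Cmp_reassoc[OF o(3)])
qed

lemma twist_add:
  assumes "(X, \<xi>) \<in> Ob D" "(Y, \<upsilon>) \<in> Ob D" "arr C X Y f" "arr C X Y g"
  shows "twist X \<xi> Y \<upsilon> (f \<oplus>\<^bsub>Hom C X Y\<^esub> g) = twist X \<xi> Y \<upsilon> f \<oplus>\<^bsub>Hom C X Y\<^esub> twist X \<xi> Y \<upsilon> g"
  using Ob_DD[OF assms(1)] Ob_DD[OF assms(2)] assms(3,4)
  by (simp add: twist_def Tm_add Cmp_bilinear)

lemma twist_smult:
  assumes "(X, \<xi>) \<in> Ob D" "(Y, \<upsilon>) \<in> Ob D" "arr C X Y f" "r \<in> carrier R"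
  shows "twist X \<xi> Y \<upsilon> (r \<odot>\<^bsub>Hom C X Y\<^esub> f) = r \<odot>\<^bsub>Hom C X Y\<^esub> twist X \<xi> Y \<upsilon> f"
  using Ob_DD[OF assms(1)] Ob_DD[OF assms(2)] assms(3,4)
  by (simp add: twist_def Tm_smult Cmp_smult_left Cmp_smult_right)

lemma twist_zero:
  assumes "(X, \<xi>) \<in> Ob D" "(Y, \<upsilon>) \<in> Ob D"
  shows "twist X \<xi> Y \<upsilon> \<zero>\<^bsub>Hom C X Y\<^esub> = \<zero>\<^bsub>Hom C X Y\<^esub>"
  using Ob_DD[OF assms(1)] Ob_DD[OF assms(2)] by (simp add: twist_def)

lemma arr_D_Cmp:
  assumes "arr D (X, \<xi>) (Y, \<upsilon>) f" "arr D (Y, \<upsilon>) (Z, \<zeta>) g"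
  shows "arr D (X, \<xi>) (Z, \<zeta>) (Cmp C X Y Z g f)"
  using assms twist_Cmp[of X \<xi> Y \<upsilon> Z \<zeta> f g] by (simp add: arr_D_twist)

lemma arr_D_Idn: "(X, \<xi>) \<in> Ob D \<Longrightarrow> arr D (X, \<xi>) (X, \<xi>) (Idn C X)"
  by (simp add: arr_D_twist Ob_DD)

lemma arr_D_zero: "\<lbrakk>(X, \<xi>) \<in> Ob D; (Y, \<upsilon>) \<in> Ob D\<rbrakk> \<Longrightarrow> arr D (X, \<xi>) (Y, \<upsilon>) \<zero>\<^bsub>Hom C X Y\<^esub>"
  by (simp add: arr_D_twist Ob_DD twist_zero)

lemma arr_D_add: "\<lbrakk>arr D (X, \<xi>) (Y, \<upsilon>) f; arr D (X, \<xi>) (Y, \<upsilon>) g\<rbrakk> \<Longrightarrow>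
    arr D (X, \<xi>) (Y, \<upsilon>) (f \<oplus>\<^bsub>Hom C X Y\<^esub> g)"
  by (simp add: arr_D_twist twist_add)

lemma arr_D_smult: "\<lbrakk>arr D (X, \<xi>) (Y, \<upsilon>) f; r \<in> carrier R\<rbrakk> \<Longrightarrow>
    arr D (X, \<xi>) (Y, \<upsilon>) (r \<odot>\<^bsub>Hom C X Y\<^esub> f)"
  by (simp add: arr_D_twist twist_smult)

lemma twist_minus:
  assumes X: "(X, \<xi>) \<in> Ob D" and Y: "(Y, \<upsilon>) \<in> Ob D" and f: "arr C X Y f"
  shows "twist X \<xi> Y \<upsilon> (\<ominus>\<^bsub>Hom C X Y\<^esub> f) = \<ominus>\<^bsub>Hom C X Y\<^esub> twist X \<xi> Y \<upsilon> f"
proof (rule hom_minus_unique)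
  have "twist X \<xi> Y \<upsilon> (f \<oplus>\<^bsub>Hom C X Y\<^esub> \<ominus>\<^bsub>Hom C X Y\<^esub> f) = \<zero>\<^bsub>Hom C X Y\<^esub>"
    using assms by (simp add: twist_zero)
  then show "twist X \<xi> Y \<upsilon> f \<oplus>\<^bsub>Hom C X Y\<^esub> twist X \<xi> Y \<upsilon> (\<ominus>\<^bsub>Hom C X Y\<^esub> f) = \<zero>\<^bsub>Hom C X Y\<^esub>"
    using assms by (simp add: twist_add del: hom_r_neg)
qed (use assms in simp_all)

lemma arr_D_minus: "arr D (X, \<xi>) (Y, \<upsilon>) f \<Longrightarrow> arr D (X, \<xi>) (Y, \<upsilon>) (\<ominus>\<^bsub>Hom C X Y\<^esub> f)"
  by (simp add: arr_D_twist twist_minus)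

lemma Hom_D_module:
  assumes X: "(X, \<xi>) \<in> Ob D" and Y: "(Y, \<upsilon>) \<in> Ob D"
  shows "module R (Hom D (X, \<xi>) (Y, \<upsilon>))"
proof -
  let ?H = "carrier (Hom D (X, \<xi>) (Y, \<upsilon>))"
  have H: "f \<in> ?H \<longleftrightarrow> arr D (X, \<xi>) (Y, \<upsilon>) f" for f using X Y by (simp add: arr_def)
  have o: "X \<in> Ob C" "Y \<in> Ob C" using X Y Ob_DD by auto
  have m: "module R (Hom C X Y)" using o Hom_module by blast
  have "submodule ?H R (Hom C X Y)"
  proof (rule module.submoduleI[OF m])
    show "?H \<subseteq> carrier (Hom C X Y)" by (auto simp: equivariant_cat_def)
  qed (use X Y in \<open>auto simp: H arr_D_zero arr_D_minus arr_D_add arr_D_smult\<close>)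
  then have "module R (Hom C X Y\<lparr>carrier := ?H\<rparr>)"
    using submodule.submodule_is_module m by blast
  then show ?thesis by (simp add: equivariant_cat_def)
qed

lemma arr_D_C: "arr D (X, \<xi>) (Y, \<upsilon>) f \<Longrightarrow> arr C X Y f"
  by (simp add: arr_D_twist)

sublocale D: linear_category R D
proof (intro linear_category.intro linear_category_axioms.intro, goal_cases)
  case 1 show ?case by (rule is_cring)
next
  case (2 X Y) then show ?case using Hom_D_module by (cases X; cases Y) auto
next
  case (3 X) then show ?case using arr_D_Idn by (cases X) auto
next
  case (4 X Y f Z g) then show ?case using arr_D_Cmp by (cases X; cases Y; cases Z) auto
next
  case (5 X Y f) then show ?case by (cases X; cases Y) (auto dest: arr_D_C)
next
  case (6 X Y f) then show ?case by (cases X; cases Y) (auto dest: arr_D_C)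
next
  case (7 W X f Y g Z h) then show ?case
    by (cases W; cases X; cases Y; cases Z) (auto dest!: arr_D_C simp: Cmp_assoc)
next
  case (8 X Y f f' Z g) then show ?case
    by (cases X; cases Y; cases Z) (auto dest!: arr_D_C simp: Cmp_add_right)
next
  case (9 X Y f Z g g') then show ?case
    by (cases X; cases Y; cases Z) (auto dest!: arr_D_C simp: Cmp_add_left)
next
  case (10 r X Y f Z g) then show ?case
    by (cases X; cases Y; cases Z) (auto dest!: arr_D_C simp: Cmp_smult_right)
next
  case (11 r X Y f Z g) then show ?case
    by (cases X; cases Y; cases Z) (auto dest!: arr_D_C simp: Cmp_smult_left)
qed

lemma arr_D_Ob: "arr D (X, \<xi>) (Y, \<upsilon>) f \<Longrightarrow> (X, \<xi>) \<in> Ob D \<and> (Y, \<upsilon>) \<in> Ob D"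
  by (simp add: arr_D_twist)

text \<open>The inverse of an equivariant isomorphism is unique, hence equivariant.\<close>

lemma iso_arr_D_iff:
  "iso_arr D (X, \<xi>) (Y, \<upsilon>) f \<longleftrightarrow> arr D (X, \<xi>) (Y, \<upsilon>) f \<and> iso_arr C X Y f"
proof
  assume "iso_arr D (X, \<xi>) (Y, \<upsilon>) f"
  then show "arr D (X, \<xi>) (Y, \<upsilon>) f \<and> iso_arr C X Y f"
    by (auto simp: iso_arr_def dest: arr_D_C)
next
  assume a: "arr D (X, \<xi>) (Y, \<upsilon>) f \<and> iso_arr C X Y f"
  then obtain g where g: "arr C Y X g" "Cmp C X Y X g f = Idn C X" "Cmp C Y X Y f g = Idn C Y"
    by (auto simp: iso_arr_def)
  have f: "(X, \<xi>) \<in> Ob D" "(Y, \<upsilon>) \<in> Ob D" "arr C X Y f" "twist X \<xi> Y \<upsilon> f = f" using a by (auto simp: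
      arr_D_twist)
  let ?g = "twist Y \<upsilon> X \<xi> g"
  have t: "arr C Y X ?g" using f g by simp
  have gf: "Cmp C X Y X ?g f = Idn C X"
    using twist_Cmp[OF f(1,2,1,3) g(1)] f g by simp
  have "?g = Cmp C Y X X (Cmp C X Y X ?g f) g" using t f(3) g by (simp add: Cmp_assoc')
  also have "\<dots> = g" using gf g by simp
  finally have "arr D (Y, \<upsilon>) (X, \<xi>) g" using f g by (simp add: arr_D_twist)
  then show "iso_arr D (X, \<xi>) (Y, \<upsilon>) f" using a g by (auto simp: iso_arr_def)
qed

lemma biproduct_D_iff: "D.biproduct (X, \<xi>) (A, \<alpha>) (B, \<beta>) i p j q \<longleftrightarrow>
    arr D (A, \<alpha>) (X, \<xi>) i \<and> arr D (X, \<xi>) (A, \<alpha>) p \<and> arr D (B, \<beta>) (X, \<xi>) j \<and> arr D (X, \<xi>) (B, \<beta>) q \<and>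
    biproduct X A B i p j q"
  unfolding D.biproduct_def biproduct_def by (auto dest: arr_D_C)

text \<open>The idempotent \<open>1 - f g\<close> commutes with the involution, so that \<open>\<xi>\<close> restricts to its image
  \<open>V\<close>.\<close>

lemma equivariant_complement:
  assumes f: "arr D (W, \<omega>) (X, \<xi>) f" and g: "arr D (X, \<xi>) (W, \<omega>) g"
    and b: "biproduct X W V f g i p"
  obtains \<eta> where "D.biproduct (X, \<xi>) (W, \<omega>) (V, \<eta>) f g i p"
proof -
  note bD [simp] = biproductD[OF b] biproductD_reassoc[OF b]
  have [simp]: "X \<in> Ob C" "W \<in> Ob C" "V \<in> Ob C" using biproduct_Ob[OF b] by auto
  have X: "(X, \<xi>) \<in> Ob D" and W: "(W, \<omega>) \<in> Ob D" using arr_D_Ob[OF f] by auto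
  have o [simp]: "arr C (To X) X \<xi>" "arr C (To W) W \<omega>" using Ob_DD X W by auto
  \<comment> \<open>\<open>\<xi>\<close> maps the image of \<open>Tm i\<close> into that of \<open>i\<close>, since \<open>g\<close> is equivariant and \<open>g i = 0\<close>; \<open>\<eta>\<close> is
    the induced map.\<close>
  define \<eta> where "\<eta> = Cmp C (To V) X V p (Cmp C (To V) (To X) X \<xi> (Tm V X i))"
  have \<eta> [simp]: "arr C (To V) V \<eta>" by (simp add: \<eta>_def)
  have fe: "Cmp C (To W) W X f \<omega> = Cmp C (To W) (To X) X \<xi> (Tm W X f)"
    and ge: "Cmp C (To X) X W g \<xi> = Cmp C (To X) (To W) W \<omega> (Tm X W g)"
    using f g by (auto simp: arr_D_iff)
  have gi: "Cmp C (To V) (To X) (To W) (Tm X W g) (Tm V X i) = \<zero>\<^bsub>Hom C (To V) (To W)\<^esub>"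
    by (simp flip: Tm_Cmp)
  have "Cmp C (To V) X W g (Cmp C (To V) (To X) X \<xi> (Tm V X i)) = \<zero>\<^bsub>Hom C (To V) W\<^esub>"
    by (simp add: Cmp_reassoc[OF ge] Cmp_assoc' gi)
  then have ie: "Cmp C (To V) V X i \<eta> = Cmp C (To V) (To X) X \<xi> (Tm V X i)"
    using biproduct_split_left[OF b, of "To V" "Cmp C (To V) (To X) X \<xi> (Tm V X i)"]
    by (simp add: \<eta>_def)
  have pf: "Cmp C (To W) X V p (Cmp C (To W) (To X) X \<xi> (Tm W X f)) = \<zero>\<^bsub>Hom C (To W) V\<^esub>"
    by (simp flip: fe)
  have Tid: "Cmp C (To X) (To W) (To X) (Tm W X f) (Tm X W g) \<oplus>\<^bsub>Hom C (To X) (To X)\<^esub>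
      Cmp C (To X) (To V) (To X) (Tm V X i) (Tm X V p) = Idn C (To X)"
    by (simp flip: Tm_Cmp Tm_add)
  have "Cmp C (To X) X V p \<xi> = Cmp C (To X) X V p (Cmp C (To X) (To X) X \<xi>
     (Cmp C (To X) (To W) (To X) (Tm W X f) (Tm X W g) \<oplus>\<^bsub>Hom C (To X) (To X)\<^esub>
      Cmp C (To X) (To V) (To X) (Tm V X i) (Tm X V p)))" unfolding Tid by simp
  also have "\<dots> = Cmp C (To X) (To W) V (Cmp C (To W) X V p (Cmp C (To W) (To X) X \<xi> (Tm W X f))) (Tm
      X W g)
      \<oplus>\<^bsub>Hom C (To X) V\<^esub> Cmp C (To X) (To V) V \<eta> (Tm X V p)"
    by (simp add: \<eta>_def Cmp_bilinear Cmp_assoc')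
  also have "\<dots> = Cmp C (To X) (To V) V \<eta> (Tm X V p)" unfolding pf by simp
  finally have pe: "Cmp C (To X) X V p \<xi> = Cmp C (To X) (To V) V \<eta> (Tm X V p)" .
  have "Cmp C V (To V) V \<eta> (Tm (To V) V \<eta>) =
      Cmp C V X V p (Cmp C V (To X) X \<xi> (Tm (To V) X (Cmp C (To V) V X i \<eta>)))"
    by (simp add: \<eta>_def Tm_Cmp Cmp_assoc')
  also have "\<dots> = Cmp C V X V p (Cmp C V X X (Cmp C X (To X) X \<xi> (Tm (To X) X \<xi>)) i)"
    unfolding ie by (simp add: Tm_Cmp Cmp_assoc')
  also have "\<dots> = Idn C V" using Ob_DD[OF X] by simp
  finally have V: "(V, \<eta>) \<in> Ob D" by (simp add: Ob_D_iff)
  have "D.biproduct (X, \<xi>) (W, \<omega>) (V, \<eta>) f g i p"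
    unfolding biproduct_D_iff using f g b V X ie pe by (simp add: arr_D_iff)
  then show ?thesis using that by blast
qed

lemma equivariant_biproduct:
  assumes A: "(A, \<alpha>) \<in> Ob D" and B: "(B, \<beta>) \<in> Ob D" and b: "biproduct X A B i p j q"
  shows "\<exists>\<xi>. D.biproduct (X, \<xi>) (A, \<alpha>) (B, \<beta>) i p j q"
proof -
  note bD [simp] = biproductD[OF b] biproductD_reassoc[OF b]
  have [simp]: "X \<in> Ob C" "A \<in> Ob C" "B \<in> Ob C" using biproduct_Ob[OF b] by auto
  note o = Ob_DD[OF A] Ob_DD[OF B]
  have [simp]: "arr C (To A) A \<alpha>" "arr C (To B) B \<beta>" using o by auto
  have T: "Cmp C (To A) (To X) (To A) (Tm X A p) (Tm A X i) = Idn C (To A)"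
    "Cmp C (To B) (To X) (To B) (Tm X B q) (Tm B X j) = Idn C (To B)"
    "Cmp C (To B) (To X) (To A) (Tm X A p) (Tm B X j) = \<zero>\<^bsub>Hom C (To B) (To A)\<^esub>"
    "Cmp C (To A) (To X) (To B) (Tm X B q) (Tm A X i) = \<zero>\<^bsub>Hom C (To A) (To B)\<^esub>"
    by (simp_all flip: Tm_Cmp)
  define \<xi> where "\<xi> = Cmp C (To X) A X i (Cmp C (To X) (To A) A \<alpha> (Tm X A p)) \<oplus>\<^bsub>Hom C (To X) X\<^esub>
     Cmp C (To X) B X j (Cmp C (To X) (To B) B \<beta> (Tm X B q))"
  have \<xi> [simp]: "arr C (To X) X \<xi>" by (simp add: \<xi>_def)
  have Tx: "Tm (To X) X \<xi> = Cmp C X (To A) (To X) (Tm A X i) (Cmp C X A (To A) (Tm (To A) A \<alpha>) p)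
     \<oplus>\<^bsub>Hom C X (To X)\<^esub> Cmp C X (To B) (To X) (Tm B X j) (Cmp C X B (To B) (Tm (To B) B \<beta>) q)"
    by (simp add: \<xi>_def Tm_Cmp Tm_add)
  have "Cmp C X (To X) X \<xi> (Tm (To X) X \<xi>) = Idn C X"
    unfolding Tx unfolding \<xi>_def
    by (simp add: Cmp_bilinear Cmp_assoc' Cmp_reassoc[OF T(1)] Cmp_reassoc[OF T(2)] Cmp_reassoc[OF
        T(3)]
        Cmp_reassoc[OF T(4)] Cmp_reassoc[OF o(3)] Cmp_reassoc[OF o(7)])
  then have X: "(X, \<xi>) \<in> Ob D" by (simp add: Ob_D_iff)
  have "D.biproduct (X, \<xi>) (A, \<alpha>) (B, \<beta>) i p j q"
    unfolding biproduct_D_iff using b X A B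
    by (simp add: arr_D_iff \<xi>_def Cmp_bilinear Cmp_assoc' T)
  then show ?thesis by blast
qed

text \<open>For the free object on \<open>P\<close>, with underlying object \<open>Y = P \<oplus> To P\<close> and the swap as its
  structure, equivariant morphisms to and from it correspond to all morphisms to and from \<open>P\<close>.\<close>

definition swap where
  "swap Y P i p j q = Cmp C (To Y) P Y i (Tm Y (To P) q) \<oplus>\<^bsub>Hom C (To Y) Y\<^esub>
     Cmp C (To Y) (To P) Y j (Tm Y P p)"

lemma free_object:
  assumes b: "biproduct Y P (To P) i p j q" and P: "P \<in> Ob C"
  shows "(Y, swap Y P i p j q) \<in> Ob D"
    and "\<lbrakk>(X, \<xi>) \<in> Ob D; arr C P X e\<rbrakk> \<Longrightarrow> arr D (Y, swap Y P i p j q) (X, \<xi>)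
      (Cmp C Y P X e p \<oplus>\<^bsub>Hom C Y X\<^esub> Cmp C Y (To P) X (Cmp C (To P) (To X) X \<xi> (Tm P X e)) q)"
    and "\<lbrakk>(X, \<xi>) \<in> Ob D; arr C X P m\<rbrakk> \<Longrightarrow> arr D (X, \<xi>) (Y, swap Y P i p j q)
      (Cmp C X P Y i m \<oplus>\<^bsub>Hom C X Y\<^esub> Cmp C X (To P) Y j (Cmp C X (To X) (To P) (Tm X P m) (Tm (To X) X
          \<xi>)))"
proof -
  note bD [simp] = biproductD[OF b] biproductD_reassoc[OF b]
  note P [simp]
  have [simp]: "Y \<in> Ob C" using biproduct_Ob[OF b] by auto
  have T [simp]: "Cmp C (To P) (To Y) (To P) (Tm Y P p) (Tm P Y i) = Idn C (To P)"
    "Cmp C P (To Y) P (Tm Y (To P) q) (Tm (To P) Y j) = Idn C P"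
    "Cmp C P (To Y) (To P) (Tm Y P p) (Tm (To P) Y j) = \<zero>\<^bsub>Hom C P (To P)\<^esub>"
    "Cmp C (To P) (To Y) P (Tm Y (To P) q) (Tm P Y i) = \<zero>\<^bsub>Hom C (To P) P\<^esub>"
    using Tm_Cmp[of P Y i P p, symmetric] Tm_Cmp[of "To P" Y j "To P" q, symmetric]
      Tm_Cmp[of "To P" Y j P p, symmetric] Tm_Cmp[of P Y i "To P" q, symmetric] by simp_all
  have T' [simp]: 
    "arr C Z (To P) t \<Longrightarrow> Cmp C Z (To Y) (To P) (Tm Y P p) (Cmp C Z (To P) (To Y) (Tm P Y i) t) = t"
    "arr C Z P s \<Longrightarrow> Cmp C Z (To Y) P (Tm Y (To P) q) (Cmp C Z P (To Y) (Tm (To P) Y j) s) = s"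
    "arr C Z P s \<Longrightarrow> Cmp C Z (To Y) (To P) (Tm Y P p) (Cmp C Z P (To Y) (Tm (To P) Y j) s) = \<zero>\<^bsub>Hom C Z
        (To P)\<^esub>"
    "arr C Z (To P) t \<Longrightarrow> Cmp C Z (To Y) P (Tm Y (To P) q) (Cmp C Z (To P) (To Y) (Tm P Y i) t) = \<zero>\<^bsub>Hom
        C Z P\<^esub>"
    for Z s t
    by (simp_all add: Cmp_assoc)
  let ?\<omega> = "swap Y P i p j q"
  have \<omega> [simp]: "arr C (To Y) Y ?\<omega>" by (simp add: swap_def)
  have T\<omega>: "Tm (To Y) Y ?\<omega> = Cmp C Y (To P) (To Y) (Tm P Y i) q \<oplus>\<^bsub>Hom C Y (To Y)\<^esub>
      Cmp C Y P (To Y) (Tm (To P) Y j) p"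
    by (simp add: swap_def Tm_Cmp Tm_add)
  have "Cmp C Y (To Y) Y ?\<omega> (Tm (To Y) Y ?\<omega>) = Idn C Y"
    unfolding T\<omega> unfolding swap_def by (simp add: Cmp_bilinear Cmp_assoc' hom_ac)
  then show Y: "(Y, ?\<omega>) \<in> Ob D" by (simp add: Ob_D_iff)
  show "arr D (Y, ?\<omega>) (X, \<xi>)
      (Cmp C Y P X e p \<oplus>\<^bsub>Hom C Y X\<^esub> Cmp C Y (To P) X (Cmp C (To P) (To X) X \<xi> (Tm P X e)) q)" (is "arr
          _ _ _ ?e")
    if X: "(X, \<xi>) \<in> Ob D" and e: "arr C P X e"
  proof -
    note o = Ob_DD[OF X]
    have "Cmp C (To Y) Y X ?e ?\<omega> = Cmp C (To Y) (To X) X \<xi> (Tm Y X ?e)"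
      using o(1,2) e
      by (simp add: swap_def Cmp_bilinear Cmp_assoc' Tm_add Tm_Cmp Cmp_reassoc[OF o(3)] hom_comm)
    then show ?thesis using X Y e o(1,2) by (simp add: arr_D_iff)
  qed
  show "arr D (X, \<xi>) (Y, ?\<omega>)
      (Cmp C X P Y i m \<oplus>\<^bsub>Hom C X Y\<^esub> Cmp C X (To P) Y j (Cmp C X (To X) (To P) (Tm X P m) (Tm (To X) X
          \<xi>)))" (is "arr _ _ _ ?e")
    if X: "(X, \<xi>) \<in> Ob D" and e: "arr C X P m"
  proof -
    note o = Ob_DD[OF X]
    have "Cmp C (To X) X Y ?e \<xi> = Cmp C (To X) (To Y) Y ?\<omega> (Tm X Y ?e)"
      using o(1,2) e
      by (simp add: swap_def Cmp_bilinear Cmp_assoc' Tm_add Tm_Cmp o(4) hom_comm)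
    then show ?thesis using X Y e o(1,2) by (simp add: arr_D_iff)
  qed
qed

end

locale involutive_additive_category = involutive_category R C To Tm + additive_category R C
  for R :: "('r, 'k) ring_scheme" (structure) and C :: "('o, 'm, 'r) lincat"
    and To :: "'o \<Rightarrow> 'o" and Tm :: "'o \<Rightarrow> 'o \<Rightarrow> 'm \<Rightarrow> 'm"
begin

sublocale D: additive_category R D
proof unfold_locales
  obtain Z where Z: "Z \<in> Ob C" "Idn C Z = \<zero>\<^bsub>Hom C Z Z\<^esub>"
    using ex_zero_object by (auto simp: zero_object_iff)
  then have "(Z, \<zero>\<^bsub>Hom C (To Z) Z\<^esub>) \<in> Ob D" by (simp add: Ob_D_iff)
  then show "\<exists>Z. zero_object D Z" using Z by (auto simp: D.zero_object_iff)
next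
  fix A B assume A: "A \<in> Ob D" and B: "B \<in> Ob D"
  obtain A' \<alpha> B' \<beta> where e: "A = (A', \<alpha>)" "B = (B', \<beta>)" by fastforce
  then have "A' \<in> Ob C" "B' \<in> Ob C" using A B Ob_DD by auto
  then obtain X i p j q where "biproduct X A' B' i p j q"
    using ex_direct_sum by (force simp: direct_sum_two_iff)
  then show "\<exists>X. direct_sum D X [A, B]"
    using A B e equivariant_biproduct unfolding D.direct_sum_two_iff by blast
qed

end

section \<open>Projectives and split conflations\<close>

context exact_category
begin

lemma projective_retract:
  assumes P: "projective C E P" and s: "arr C Q P s" and r: "arr C P Q r"
    and rs: "Cmp C Q P Q r s = Idn C Q"
  shows "projective C E Q"
  unfolding projective_def
proof (intro conjI allI impI)
  show "Q \<in> Ob C" using arr_Ob[OF s] by blast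
  fix Y Z g h assume gh: "deflation E Y Z g \<and> arr C Q Z h"
  then have g: "arr C Y Z g" using deflation_arr by blast
  have "arr C P Z (Cmp C P Q Z h r)" using r gh by auto
  then obtain k where k: "arr C P Y k" "Cmp C P Y Z g k = Cmp C P Q Z h r"
    using P gh unfolding projective_def by meson
  have "Cmp C Q Y Z g (Cmp C Q P Y k s) = h"
    using k(1) s r g gh by (simp add: Cmp_reassoc[OF k(2)] Cmp_assoc' rs)
  moreover have "arr C Q Y (Cmp C Q P Y k s)" using k s by simp
  ultimately show "\<exists>k. arr C Q Y k \<and> Cmp C Q Y Z g k = h" by blast
qed

lemma injective_retract:
  assumes P: "injective C E P" and s: "arr C Q P s" and r: "arr C P Q r"
    and rs: "Cmp C Q P Q r s = Idn C Q"
  shows "injective C E Q"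
  unfolding injective_def
proof (intro conjI allI impI)
  show "Q \<in> Ob C" using arr_Ob[OF s] by blast
  fix X Y f h assume fh: "inflation E X Y f \<and> arr C X Q h"
  then have f: "arr C X Y f" using inflation_arr by blast
  have "arr C X P (Cmp C X Q P s h)" using s fh by auto
  then obtain k where k: "arr C Y P k" "Cmp C X Y P k f = Cmp C X Q P s h"
    using P fh unfolding injective_def by meson
  have "Cmp C X Y Q (Cmp C Y P Q r k) f = h"
    using k(1) s r f fh by (simp add: Cmp_assoc' k(2) Cmp_reassoc[OF rs])
  moreover have "arr C Y Q (Cmp C Y P Q r k)" using k r by simp
  ultimately show "\<exists>k. arr C Y Q k \<and> Cmp C X Y Q k f = h" by blast
qed

lemma projective_biproduct:
  assumes A: "projective C E A" and B: "projective C E B" and b: "biproduct X A B i p j q"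
  shows "projective C E X"
  unfolding projective_def
proof (intro conjI allI impI)
  show "X \<in> Ob C" using biproduct_Ob[OF b] by blast
  note bD = biproductD[OF b]
  fix Y Z g h assume gh: "deflation E Y Z g \<and> arr C X Z h"
  then have g: "arr C Y Z g" using deflation_arr by blast
  have "arr C A Z (Cmp C A X Z h i)" using bD gh by auto
  then obtain k where k: "arr C A Y k" "Cmp C A Y Z g k = Cmp C A X Z h i"
    using A gh unfolding projective_def by meson
  have "arr C B Z (Cmp C B X Z h j)" using bD gh by auto
  then obtain l where l: "arr C B Y l" "Cmp C B Y Z g l = Cmp C B X Z h j"
    using B gh unfolding projective_def by meson
  let ?k = "Cmp C X A Y k p \<oplus>\<^bsub>Hom C X Y\<^esub> Cmp C X B Y l q"
  have "Cmp C X Y Z g ?k = Cmp C X A Z (Cmp C A X Z h i) p \<oplus>\<^bsub>Hom C X Z\<^esub> Cmp C X B Z (Cmp C B X Z h j)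
      q"
    using k l bD(1-4) g gh by (simp add: Cmp_bilinear Cmp_reassoc[OF k(2)] Cmp_reassoc[OF l(2)])
  then have "Cmp C X Y Z g ?k = h" using biproduct_split_right[OF b] gh by simp
  moreover have "arr C X Y ?k" using k l bD by simp
  ultimately show "\<exists>k. arr C X Y k \<and> Cmp C X Y Z g k = h" by blast
qed

lemma injective_biproduct:
  assumes A: "injective C E A" and B: "injective C E B" and b: "biproduct I A B i p j q"
  shows "injective C E I"
  unfolding injective_def
proof (intro conjI allI impI)
  show "I \<in> Ob C" using biproduct_Ob[OF b] by blast
  note bD = biproductD[OF b]
  fix X Y f h assume fh: "inflation E X Y f \<and> arr C X I h"
  then have f: "arr C X Y f" using inflation_arr by blast
  have "arr C X A (Cmp C X I A p h)" using bD fh by auto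
  then obtain k where k: "arr C Y A k" "Cmp C X Y A k f = Cmp C X I A p h"
    using A fh unfolding injective_def by meson
  have "arr C X B (Cmp C X I B q h)" using bD fh by auto
  then obtain l where l: "arr C Y B l" "Cmp C X Y B l f = Cmp C X I B q h"
    using B fh unfolding injective_def by meson
  let ?k = "Cmp C Y A I i k \<oplus>\<^bsub>Hom C Y I\<^esub> Cmp C Y B I j l"
  have "Cmp C X Y I ?k f = Cmp C X A I i (Cmp C X I A p h) \<oplus>\<^bsub>Hom C X I\<^esub> Cmp C X B I j (Cmp C X I B q
      h)"
    using k l bD(1-4) f fh by (simp add: Cmp_bilinear Cmp_assoc')
  then have "Cmp C X Y I ?k f = h" using biproduct_split_left[OF b] fh by simp
  moreover have "arr C Y I ?k" using k l bD by simp
  ultimately show "\<exists>k. arr C Y I k \<and> Cmp C X Y I k f = h" by blast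
qed

text \<open>The cokernel of an identity morphism is a zero object.\<close>

lemma deflation_to_zero:
  assumes Q: "Q \<in> Ob C"
  obtains Z where "zero_object C Z" "deflation E Q Z \<zero>\<^bsub>Hom C Q Z\<^esub>"
proof -
  obtain Z g where E: "E Q Q Z (Idn C Q) g"
    using Idn_inflation[OF Q] by (auto simp: inflation_def)
  note k = is_cokernelD[OF exact_is_cokernel[OF E]]
  have g: "g = \<zero>\<^bsub>Hom C Q Z\<^esub>" "Z \<in> Ob C" using k arr_Ob Q by auto
  have "Idn C Z = \<zero>\<^bsub>Hom C Z Z\<^esub>"
    by (rule is_cokernel_epi[OF exact_is_cokernel[OF E], where T = Z]) (use g Q in auto)
  then have "zero_object C Z" using g zero_objectI by blast
  then show ?thesis using that E g by (auto simp: deflation_def)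
qed

lemma inflation_from_zero:
  assumes Q: "Q \<in> Ob C"
  obtains Z where "zero_object C Z" "inflation E Z Q \<zero>\<^bsub>Hom C Z Q\<^esub>"
proof -
  obtain Z g where E: "E Z Q Q g (Idn C Q)"
    using Idn_deflation[OF Q] by (auto simp: deflation_def)
  note k = is_kernelD[OF exact_is_kernel[OF E]]
  have g: "g = \<zero>\<^bsub>Hom C Z Q\<^esub>" "Z \<in> Ob C" using k arr_Ob Q by auto
  have "Idn C Z = \<zero>\<^bsub>Hom C Z Z\<^esub>"
    by (rule is_kernel_mono[OF exact_is_kernel[OF E], where T = Z]) (use g Q in auto)
  then have "zero_object C Z" using g zero_objectI by blast
  then show ?thesis using that E g by (auto simp: inflation_def)
qed

text \<open>Up to an automorphism of \<open>P \<oplus> Q\<close>, the arrow \<open>[1, r]\<close> is a projection, which is a pullback of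
  the deflation \<open>Q \<rightarrow> 0\<close>.\<close>

lemma deflation_of_biproduct:
  assumes b: "biproduct Y P Q i p j q" and r: "arr C Q P r"
  shows "deflation E Y P (p \<oplus>\<^bsub>Hom C Y P\<^esub> Cmp C Y Q P r q)"
proof -
  note bD [simp] = biproductD[OF b] biproductD_reassoc[OF b] and r [simp]
  have o [simp]: "Y \<in> Ob C" "P \<in> Ob C" "Q \<in> Ob C" using biproduct_Ob[OF b] by auto
  obtain Z where Z: "zero_object C Z" "deflation E Q Z \<zero>\<^bsub>Hom C Q Z\<^esub>" using deflation_to_zero[OF o(3)]
      .
  have [simp]: "Z \<in> Ob C" using Z by (simp add: zero_object_def)
  have "is_pullback C Q Z Y P \<zero>\<^bsub>Hom C Q Z\<^esub> \<zero>\<^bsub>Hom C P Z\<^esub> (p \<oplus>\<^bsub>Hom C Y P\<^esub> Cmp C Y Q P r q) q"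
  proof (rule is_pullbackI)
    fix T b a assume b: "arr C T Q b" and a: "arr C T P a"
    have [simp]: "T \<in> Ob C" using b arr_Ob by blast
    let ?h = "Cmp C T P Y i (a \<oplus>\<^bsub>Hom C T P\<^esub> \<ominus>\<^bsub>Hom C T P\<^esub> Cmp C T Q P r b) \<oplus>\<^bsub>Hom C T Y\<^esub> Cmp C T Q Y j b"
    have "arr C T Y ?h" "Cmp C T Y Q q ?h = b"
        "Cmp C T Y P (p \<oplus>\<^bsub>Hom C Y P\<^esub> Cmp C Y Q P r q) ?h = a"
      using a b by (simp_all add: Cmp_bilinear Cmp_assoc' hom_assoc)
    then show "\<exists>h. arr C T Y h \<and> Cmp C T Y Q q h = b \<and>
        Cmp C T Y P (p \<oplus>\<^bsub>Hom C Y P\<^esub> Cmp C Y Q P r q) h = a" by blast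
  next
    fix T x y assume x: "arr C T Y x" and y: "arr C T Y y" and e: "Cmp C T Y Q q x = Cmp C T Y Q q
        y"
      and e': "Cmp C T Y P (p \<oplus>\<^bsub>Hom C Y P\<^esub> Cmp C Y Q P r q) x = Cmp C T Y P (p \<oplus>\<^bsub>Hom C Y P\<^esub> Cmp C Y Q P
          r q) y"
    have "Cmp C T Q P r (Cmp C T Y Q q y) \<oplus>\<^bsub>Hom C T P\<^esub> Cmp C T Y P p x
        = Cmp C T Q P r (Cmp C T Y Q q y) \<oplus>\<^bsub>Hom C T P\<^esub> Cmp C T Y P p y"
      using e' x y e by (simp add: Cmp_bilinear Cmp_assoc' hom_comm)
    then have "Cmp C T Y P p x = Cmp C T Y P p y" using x y by (simp add: hom_add_cancel)
    then show "x = y" using e biproduct_split_left[OF b x] biproduct_split_left[OF b y] by metis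
  qed simp_all
  then show ?thesis using deflation_is_pullback[OF Z(2)] by blast
qed

lemma inflation_of_biproduct:
  assumes b: "biproduct Y P Q i p j q" and r: "arr C P Q r"
  shows "inflation E P Y (i \<oplus>\<^bsub>Hom C P Y\<^esub> Cmp C P Q Y j r)"
proof -
  note bD [simp] = biproductD[OF b] biproductD_reassoc[OF b] and r [simp]
  have o [simp]: "Y \<in> Ob C" "P \<in> Ob C" "Q \<in> Ob C" using biproduct_Ob[OF b] by auto
  obtain Z where Z: "zero_object C Z" "inflation E Z Q \<zero>\<^bsub>Hom C Z Q\<^esub>" using inflation_from_zero[OF
      o(3)] .
  have [simp]: "Z \<in> Ob C" using Z by (simp add: zero_object_def)
  have "is_pushout C Z Q P Y \<zero>\<^bsub>Hom C Z Q\<^esub> \<zero>\<^bsub>Hom C Z P\<^esub> (i \<oplus>\<^bsub>Hom C P Y\<^esub> Cmp C P Q Y j r) j"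
  proof (rule is_pushoutI)
    fix T b a assume b: "arr C Q T b" and a: "arr C P T a"
    have [simp]: "T \<in> Ob C" using b arr_Ob by blast
    let ?h = "Cmp C Y P T (a \<oplus>\<^bsub>Hom C P T\<^esub> \<ominus>\<^bsub>Hom C P T\<^esub> Cmp C P Q T b r) p \<oplus>\<^bsub>Hom C Y T\<^esub> Cmp C Y Q T b q"
    have "arr C Y T ?h" "Cmp C Q Y T ?h j = b"
        "Cmp C P Y T ?h (i \<oplus>\<^bsub>Hom C P Y\<^esub> Cmp C P Q Y j r) = a"
      using a b by (simp_all add: Cmp_bilinear Cmp_assoc' hom_assoc)
    then show "\<exists>h. arr C Y T h \<and> Cmp C Q Y T h j = b \<and>
        Cmp C P Y T h (i \<oplus>\<^bsub>Hom C P Y\<^esub> Cmp C P Q Y j r) = a" by blast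
  next
    fix T x y assume x: "arr C Y T x" and y: "arr C Y T y" and e: "Cmp C Q Y T x j = Cmp C Q Y T y
        j"
      and e': "Cmp C P Y T x (i \<oplus>\<^bsub>Hom C P Y\<^esub> Cmp C P Q Y j r) = Cmp C P Y T y (i \<oplus>\<^bsub>Hom C P Y\<^esub> Cmp C P Q
          Y j r)"
    have "Cmp C P Q T (Cmp C Q Y T y j) r \<oplus>\<^bsub>Hom C P T\<^esub> Cmp C P Y T x i
        = Cmp C P Q T (Cmp C Q Y T y j) r \<oplus>\<^bsub>Hom C P T\<^esub> Cmp C P Y T y i"
      using e' x y unfolding e[symmetric] by (simp add: Cmp_bilinear Cmp_assoc hom_comm e)
    then have "Cmp C P Y T x i = Cmp C P Y T y i" using x y by (simp add: hom_add_cancel)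
    then show "x = y" using e biproduct_split_right[OF b x] biproduct_split_right[OF b y] by metis
  qed simp_all
  then show ?thesis using inflation_is_pushout[OF Z(2)] by blast
qed

end

section \<open>The Frobenius structure on objects with an involution\<close>

locale involutive_exact_category = involutive_additive_category R C To Tm + exact_category R C E
  for R :: "('r, 'k) ring_scheme" (structure) and C :: "('o, 'm, 'r) lincat"
    and To :: "'o \<Rightarrow> 'o" and Tm :: "'o \<Rightarrow> 'o \<Rightarrow> 'm \<Rightarrow> 'm" and E :: "('o, 'm) seq_class" +
  assumes exact_Tm: "E X Y Z f g \<Longrightarrow> E (To X) (To Y) (To Z) (Tm X Y f) (Tm Y Z g)"
begin

abbreviation ED where "ED \<equiv> equivariant_exact D E"

lemma ED_iff: "ED (X, \<xi>) (Y, \<upsilon>) (Z, \<zeta>) f g \<longleftrightarrow>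
    arr D (X, \<xi>) (Y, \<upsilon>) f \<and> arr D (Y, \<upsilon>) (Z, \<zeta>) g \<and> E X Y Z f g"
  by (simp add: equivariant_exact_def)

text \<open>The cokernel \<open>Z\<close> of an equivariant inflation acquires a structure from its universal
  property. This produces a morphism \<open>h : Z \<rightarrow> To Z\<close>, the inverse of the structure, and the latter
  is obtained as \<open>Tm h\<close>.\<close>

lemma inflation_D_iff: "inflation ED (X, \<xi>) (Y, \<upsilon>) f \<longleftrightarrow> arr D (X, \<xi>) (Y, \<upsilon>) f \<and> inflation E X Y f"
proof
  assume "inflation ED (X, \<xi>) (Y, \<upsilon>) f"
  then show "arr D (X, \<xi>) (Y, \<upsilon>) f \<and> inflation E X Y f"
    by (auto simp: inflation_def equivariant_exact_def)
next
  assume f: "arr D (X, \<xi>) (Y, \<upsilon>) f \<and> inflation E X Y f"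
  then obtain Z g where E: "E X Y Z f g" by (auto simp: inflation_def)
  note k = exact_is_cokernel[OF E]
  note kD = is_cokernelD[OF k]
  have XY: "(X, \<xi>) \<in> Ob D" "(Y, \<upsilon>) \<in> Ob D" using f arr_D_Ob by blast+
  note o = Ob_DD[OF XY(1)] Ob_DD[OF XY(2)]
  have [simp]: "arr C X Y f" "arr C Y Z g" "X \<in> Ob C" "Y \<in> Ob C" "Z \<in> Ob C"
    "arr C (To X) X \<xi>" "arr C (To Y) Y \<upsilon>" using kD arr_Ob o by auto
  have gf: "Cmp C X Y Z g f = \<zero>\<^bsub>Hom C X Z\<^esub>" using kD by blast
  have fe: "Cmp C (To X) X Y f \<xi> = Cmp C (To X) (To Y) Y \<upsilon> (Tm X Y f)" using f by (simp add:
      arr_D_iff)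
  have fe': "Cmp C X Y (To Y) (Tm (To Y) Y \<upsilon>) f = Cmp C X (To X) (To Y) (Tm X Y f) (Tm (To X) X \<xi>)"
    using arg_cong[OF fe, of "Tm (To X) Y"] by (simp add: Tm_Cmp)
  let ?t = "Cmp C Y (To Y) (To Z) (Tm Y Z g) (Tm (To Y) Y \<upsilon>)"
  have "Cmp C X Y (To Z) ?t f = Cmp C X (To X) (To Z) (Cmp C (To X) (To Y) (To Z) (Tm Y Z g) (Tm X Y
      f)) (Tm (To X) X \<xi>)"
    by (simp add: Cmp_assoc' fe')
  also have "\<dots> = \<zero>\<^bsub>Hom C X (To Z)\<^esub>" by (simp flip: Tm_Cmp add: gf)
  finally obtain h where h [simp]: "arr C Z (To Z) h" and hg: "Cmp C Y Z (To Z) h g = ?t"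
    using is_cokernel_ex[OF k, of "To Z" ?t] by auto
  have thg: "Cmp C (To Y) (To Z) Z (Tm Z (To Z) h) (Tm Y Z g) = Cmp C (To Y) Y Z g \<upsilon>"
    using arg_cong[OF hg, of "Tm Y (To Z)"] by (simp add: Tm_Cmp)
  have "Cmp C Z (To Z) Z (Tm Z (To Z) h) h = Idn C Z"
    by (rule is_cokernel_epi[OF k, where T = Z]) (simp_all add: Cmp_assoc' hg Cmp_reassoc[OF thg]
        o(7))
  then have Z: "(Z, Tm Z (To Z) h) \<in> Ob D" by (simp add: Ob_D_iff)
  then have "arr D (Y, \<upsilon>) (Z, Tm Z (To Z) h) g" using XY by (simp add: arr_D_iff thg)
  then show "inflation ED (X, \<xi>) (Y, \<upsilon>) f" using f E unfolding inflation_def ED_iff[symmetric]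
    using ED_iff by blast
qed

text \<open>Dually, the kernel of an equivariant deflation acquires a structure, now directly as a
  morphism \<open>To X \<rightarrow> X\<close>.\<close>

lemma deflation_D_iff: "deflation ED (Y, \<upsilon>) (Z, \<zeta>) g \<longleftrightarrow> arr D (Y, \<upsilon>) (Z, \<zeta>) g \<and> deflation E Y Z g"
proof
  assume "deflation ED (Y, \<upsilon>) (Z, \<zeta>) g"
  then show "arr D (Y, \<upsilon>) (Z, \<zeta>) g \<and> deflation E Y Z g"
    by (auto simp: deflation_def equivariant_exact_def)
next
  assume g: "arr D (Y, \<upsilon>) (Z, \<zeta>) g \<and> deflation E Y Z g"
  then obtain X f where E: "E X Y Z f g" by (auto simp: deflation_def)
  note k = exact_is_kernel[OF E]
  note kD = is_kernelD[OF k]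
  have YZ: "(Y, \<upsilon>) \<in> Ob D" "(Z, \<zeta>) \<in> Ob D" using g arr_D_Ob by blast+
  note o = Ob_DD[OF YZ(1)] Ob_DD[OF YZ(2)]
  have [simp]: "arr C X Y f" "arr C Y Z g" "X \<in> Ob C" "Y \<in> Ob C" "Z \<in> Ob C"
    "arr C (To Y) Y \<upsilon>" "arr C (To Z) Z \<zeta>" using kD arr_Ob o by auto
  have gf: "Cmp C X Y Z g f = \<zero>\<^bsub>Hom C X Z\<^esub>" using kD by blast
  have ge: "Cmp C (To Y) Y Z g \<upsilon> = Cmp C (To Y) (To Z) Z \<zeta> (Tm Y Z g)" using g by (simp add:
      arr_D_iff)
  let ?t = "Cmp C (To X) (To Y) Y \<upsilon> (Tm X Y f)"
  have "Cmp C (To X) Y Z g ?t = Cmp C (To X) (To Z) Z \<zeta> (Cmp C (To X) (To Y) (To Z) (Tm Y Z g) (Tm X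
      Y f))"
    by (simp add: Cmp_reassoc[OF ge] Cmp_assoc')
  also have "\<dots> = \<zero>\<^bsub>Hom C (To X) Z\<^esub>" by (simp flip: Tm_Cmp add: gf)
  finally obtain h where h [simp]: "arr C (To X) X h" and fh: "Cmp C (To X) X Y f h = ?t"
    using is_kernel_ex[OF k, of "To X" ?t] by auto
  have fth: "Cmp C X (To X) (To Y) (Tm X Y f) (Tm (To X) X h) = Cmp C X Y (To Y) (Tm (To Y) Y \<upsilon>) f"
    using arg_cong[OF fh, of "Tm (To X) Y"] by (simp add: Tm_Cmp)
  have "Cmp C X (To X) X h (Tm (To X) X h) = Idn C X"
    by (rule is_kernel_mono[OF k, where T = X]) (simp_all add: Cmp_reassoc[OF fh] Cmp_assoc' fth
        Cmp_reassoc[OF o(3)])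
  then have X: "(X, h) \<in> Ob D" by (simp add: Ob_D_iff)
  then have "arr D (X, h) (Y, \<upsilon>) f" using YZ by (simp add: arr_D_iff fh)
  then show "deflation ED (Y, \<upsilon>) (Z, \<zeta>) g" using g E unfolding deflation_def
    using ED_iff by blast
qed

text \<open>The factorization of an equivariant morphism through a kernel in \<open>C\<close> is unique, hence fixed
  by \<open>twist\<close>. The same reasoning applies to the other universal properties below.\<close>

lemma is_kernel_D:
  assumes k: "is_kernel C X Y Z f g" and f: "arr D (X, \<xi>) (Y, \<upsilon>) f" and g: "arr D (Y, \<upsilon>) (Z, \<zeta>) g"
  shows "is_kernel D (X, \<xi>) (Y, \<upsilon>) (Z, \<zeta>) f g"
proof (rule D.is_kernelI[OF f g])
  show "Cmp D (X, \<xi>) (Y, \<upsilon>) (Z, \<zeta>) g f = \<zero>\<^bsub>Hom D (X, \<xi>) (Z, \<zeta>)\<^esub>"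
    using is_kernelD[OF k] by simp
next
  fix T t assume t': "arr D T (Y, \<upsilon>) t" and z: "Cmp D T (Y, \<upsilon>) (Z, \<zeta>) g t = \<zero>\<^bsub>Hom D T (Z, \<zeta>)\<^esub>"
  obtain T0 \<tau> where T: "T = (T0, \<tau>)" by fastforce
  have t: "(T0, \<tau>) \<in> Ob D" "arr C T0 Y t" "twist T0 \<tau> Y \<upsilon> t = t"
    using t' by (auto simp: arr_D_twist T)
  have f': "(X, \<xi>) \<in> Ob D" "(Y, \<upsilon>) \<in> Ob D" "arr C X Y f" "twist X \<xi> Y \<upsilon> f = f" using f by (auto
      simp: arr_D_twist)
  obtain s where s: "arr C T0 X s" "Cmp C T0 X Y f s = t"
    using is_kernel_ex[OF k t(2)] z by (auto simp: T)
  have "twist T0 \<tau> X \<xi> s = s"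
  proof (rule is_kernel_mono[OF k])
    show "Cmp C T0 X Y f (twist T0 \<tau> X \<xi> s) = Cmp C T0 X Y f s"
      using twist_Cmp[OF t(1) f'(1,2) s(1) f'(3)] by (simp only: s(2) t(3) f'(4))
  qed (use s t f' in simp_all)
  then have "arr D T (X, \<xi>) s" using t f' s by (simp add: arr_D_twist T)
  then show "\<exists>s. arr D T (X, \<xi>) s \<and> Cmp D T (X, \<xi>) (Y, \<upsilon>) f s = t" using s T by auto
next
  fix T a b assume ab: "arr D T (X, \<xi>) a" "arr D T (X, \<xi>) b"
    "Cmp D T (X, \<xi>) (Y, \<upsilon>) f a = Cmp D T (X, \<xi>) (Y, \<upsilon>) f b"
  then show "a = b" using is_kernel_mono[OF k] by (cases T) (auto dest!: arr_D_C)
qed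

lemma is_cokernel_D:
  assumes k: "is_cokernel C X Y Z f g" and f: "arr D (X, \<xi>) (Y, \<upsilon>) f" and g: "arr D (Y, \<upsilon>) (Z, \<zeta>) g"
  shows "is_cokernel D (X, \<xi>) (Y, \<upsilon>) (Z, \<zeta>) f g"
proof (rule D.is_cokernelI[OF f g])
  show "Cmp D (X, \<xi>) (Y, \<upsilon>) (Z, \<zeta>) g f = \<zero>\<^bsub>Hom D (X, \<xi>) (Z, \<zeta>)\<^esub>"
    using is_cokernelD[OF k] by simp
next
  fix T t assume t': "arr D (Y, \<upsilon>) T t" and z: "Cmp D (X, \<xi>) (Y, \<upsilon>) T t f = \<zero>\<^bsub>Hom D (X, \<xi>) T\<^esub>"
  obtain T0 \<tau> where T: "T = (T0, \<tau>)" by fastforce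
  have t: "(T0, \<tau>) \<in> Ob D" "arr C Y T0 t" "twist Y \<upsilon> T0 \<tau> t = t"
    using t' by (auto simp: arr_D_twist T)
  have g': "(Y, \<upsilon>) \<in> Ob D" "(Z, \<zeta>) \<in> Ob D" "arr C Y Z g" "twist Y \<upsilon> Z \<zeta> g = g" using g by (auto
      simp: arr_D_twist)
  obtain s where s: "arr C Z T0 s" "Cmp C Y Z T0 s g = t"
    using is_cokernel_ex[OF k t(2)] z by (auto simp: T)
  have "twist Z \<zeta> T0 \<tau> s = s"
  proof (rule is_cokernel_epi[OF k])
    show "Cmp C Y Z T0 (twist Z \<zeta> T0 \<tau> s) g = Cmp C Y Z T0 s g"
      using twist_Cmp[OF g'(1,2) t(1) g'(3) s(1)] by (simp only: s(2) t(3) g'(4))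
  qed (use s t g' in simp_all)
  then have "arr D (Z, \<zeta>) T s" using t g' s by (simp add: arr_D_twist T)
  then show "\<exists>s. arr D (Z, \<zeta>) T s \<and> Cmp D (Y, \<upsilon>) (Z, \<zeta>) T s g = t" using s T by auto
next
  fix T a b assume ab: "arr D (Z, \<zeta>) T a" "arr D (Z, \<zeta>) T b"
    "Cmp D (Y, \<upsilon>) (Z, \<zeta>) T a g = Cmp D (Y, \<upsilon>) (Z, \<zeta>) T b g"
  then show "a = b" using is_cokernel_epi[OF k] by (cases T) (auto dest!: arr_D_C)
qed

text \<open>As for cokernels, the universal property of the pushout \<open>B'\<close> yields \<open>h : B' \<rightarrow> To B'\<close>, and
  \<open>Tm h\<close> is the structure of \<open>B'\<close>.\<close>

lemma pushout_D:
  assumes i: "arr D (A, \<alpha>) (B, \<beta>) i" and f: "arr D (A, \<alpha>) (A', \<alpha>') f"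
    and p: "is_pushout C A B A' B' i f i' f'"
  obtains \<beta>' where "is_pushout D (A, \<alpha>) (B, \<beta>) (A', \<alpha>') (B', \<beta>') i f i' f'"
proof -
  note pD = is_pushoutD[OF p]
  have A: "(A, \<alpha>) \<in> Ob D" and B: "(B, \<beta>) \<in> Ob D" and A': "(A', \<alpha>') \<in> Ob D" using i f arr_D_Ob by
      blast+
  note o = Ob_DD[OF A] Ob_DD[OF B] Ob_DD[OF A']
  have [simp]: "arr C A B i" "arr C A A' f" "arr C A' B' i'" "arr C B B' f'" "A \<in> Ob C" "B \<in> Ob C"
      "A' \<in> Ob C" "B' \<in> Ob C"
    "arr C (To A) A \<alpha>" "arr C (To B) B \<beta>" "arr C (To A') A' \<alpha>'" using pD o arr_Ob by auto
  have sq: "Cmp C A B B' f' i = Cmp C A A' B' i' f" using pD by blast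
  have "Cmp C (To A) A B i \<alpha> = Cmp C (To A) (To B) B \<beta> (Tm A B i)"
    and "Cmp C (To A) A A' f \<alpha> = Cmp C (To A) (To A') A' \<alpha>' (Tm A A' f)" using i f by (auto simp:
        arr_D_iff)
  then have ie: "Cmp C A B (To B) (Tm (To B) B \<beta>) i = Cmp C A (To A) (To B) (Tm A B i) (Tm (To A) A
      \<alpha>)"
    and fe: "Cmp C A A' (To A') (Tm (To A') A' \<alpha>') f = Cmp C A (To A) (To A') (Tm A A' f) (Tm (To A)
        A \<alpha>)"
    using Tm_Cmp[of "To A" A \<alpha> B i] Tm_Cmp[of "To A" A \<alpha> A' f] by (simp_all add: Tm_Cmp)
  let ?b = "Cmp C B (To B) (To B') (Tm B B' f') (Tm (To B) B \<beta>)"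
    and ?a = "Cmp C A' (To A') (To B') (Tm A' B' i') (Tm (To A') A' \<alpha>')"
  have Tsq: "Cmp C (To A) (To B) (To B') (Tm B B' f') (Tm A B i) = Cmp C (To A) (To A') (To B') (Tm
      A' B' i') (Tm A A' f)"
    by (simp flip: Tm_Cmp add: sq)
  have "Cmp C A B (To B') ?b i = Cmp C A A' (To B') ?a f"
    by (simp add: Cmp_assoc' ie fe Cmp_reassoc[OF Tsq])
  then obtain h where h [simp]: "arr C B' (To B') h" and hf: "Cmp C B B' (To B') h f' = ?b"
    and hi: "Cmp C A' B' (To B') h i' = ?a"
    using is_pushout_ex[OF p, of "To B'" ?b ?a] by auto
  have thf: "Cmp C (To B) (To B') B' (Tm B' (To B') h) (Tm B B' f') = Cmp C (To B) B B' f' \<beta>"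
    and thi: "Cmp C (To A') (To B') B' (Tm B' (To B') h) (Tm A' B' i') = Cmp C (To A') A' B' i' \<alpha>'"
    using arg_cong[OF hf, of "Tm B (To B')"] arg_cong[OF hi, of "Tm A' (To B')"] by (simp_all add:
        Tm_Cmp)
  have "Cmp C B' (To B') B' (Tm B' (To B') h) h = Idn C B'"
    by (rule is_pushout_eqI[OF p, where T = B'])
       (simp_all add: Cmp_assoc' hf hi Cmp_reassoc[OF thf] Cmp_reassoc[OF thi] o(7,11))
  then have B': "(B', Tm B' (To B') h) \<in> Ob D" by (simp add: Ob_D_iff)
  let ?\<beta> = "Tm B' (To B') h"
  have i': "arr D (A', \<alpha>') (B', ?\<beta>) i'" and f': "arr D (B, \<beta>) (B', ?\<beta>) f'"
    using A' B B' by (simp_all add: arr_D_iff thi thf)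
  have "is_pushout D (A, \<alpha>) (B, \<beta>) (A', \<alpha>') (B', ?\<beta>) i f i' f'"
  proof (rule D.is_pushoutI[OF i f i' f'])
    show "Cmp D (A, \<alpha>) (B, \<beta>) (B', ?\<beta>) f' i = Cmp D (A, \<alpha>) (A', \<alpha>') (B', ?\<beta>) i' f" using sq by simp
  next
    fix T b a assume ab: "arr D (B, \<beta>) T b" "arr D (A', \<alpha>') T a"
      "Cmp D (A, \<alpha>) (B, \<beta>) T b i = Cmp D (A, \<alpha>) (A', \<alpha>') T a f"
    obtain T0 \<tau> where T: "T = (T0, \<tau>)" by fastforce
    have t: "(T0, \<tau>) \<in> Ob D" "arr C B T0 b" "arr C A' T0 a" "twist B \<beta> T0 \<tau> b = b" "twist A' \<alpha>' T0 \<tau>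
        a = a"
      "Cmp C A B T0 b i = Cmp C A A' T0 a f"
      using ab by (auto simp: arr_D_twist T)
    obtain k where k: "arr C B' T0 k" "Cmp C B B' T0 k f' = b" "Cmp C A' B' T0 k i' = a"
      using is_pushout_ex[OF p t(2,3,6)] by blast
    have tw: "twist B \<beta> B' ?\<beta> f' = f'" "twist A' \<alpha>' B' ?\<beta> i' = i'" using i' f' by (auto simp:
        arr_D_twist)
    have "twist B' ?\<beta> T0 \<tau> k = k"
    proof (rule is_pushout_eqI[OF p])
      show "Cmp C B B' T0 (twist B' ?\<beta> T0 \<tau> k) f' = Cmp C B B' T0 k f'"
        using twist_Cmp[OF B B' t(1) arr_D_C[OF f'] k(1)] by (simp only: k(2) t(4) tw(1))
      show "Cmp C A' B' T0 (twist B' ?\<beta> T0 \<tau> k) i' = Cmp C A' B' T0 k i'"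
        using twist_Cmp[OF A' B' t(1) arr_D_C[OF i'] k(1)] by (simp only: k(3) t(5) tw(2))
    qed (use k t B' in simp_all)
    then have "arr D (B', ?\<beta>) T k" using k t B' by (simp add: arr_D_twist T)
    then show "\<exists>h. arr D (B', ?\<beta>) T h \<and> Cmp D (B, \<beta>) (B', ?\<beta>) T h f' = b \<and> Cmp D (A', \<alpha>') (B', ?\<beta>) T
        h i' = a"
      using k T by auto
  next
    fix T x y assume xy: "arr D (B', ?\<beta>) T x" "arr D (B', ?\<beta>) T y"
      "Cmp D (B, \<beta>) (B', ?\<beta>) T x f' = Cmp D (B, \<beta>) (B', ?\<beta>) T y f'"
      "Cmp D (A', \<alpha>') (B', ?\<beta>) T x i' = Cmp D (A', \<alpha>') (B', ?\<beta>) T y i'"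
    then show "x = y" using is_pushout_eqI[OF p, of _ x y] by (cases T) (auto dest!: arr_D_C)
  qed
  then show ?thesis using that by blast
qed

lemma pullback_D:
  assumes p: "arr D (B, \<beta>) (A, \<alpha>) p" and f: "arr D (A', \<alpha>') (A, \<alpha>) f"
    and q: "is_pullback C B A B' A' p f p' f'"
  obtains \<beta>' where "is_pullback D (B, \<beta>) (A, \<alpha>) (B', \<beta>') (A', \<alpha>') p f p' f'"
proof -
  note qD = is_pullbackD[OF q]
  have A: "(A, \<alpha>) \<in> Ob D" and B: "(B, \<beta>) \<in> Ob D" and A': "(A', \<alpha>') \<in> Ob D" using p f arr_D_Ob by
      blast+
  note o = Ob_DD[OF A] Ob_DD[OF B] Ob_DD[OF A']
  have [simp]: "arr C B A p" "arr C A' A f" "arr C B' A' p'" "arr C B' B f'" "A \<in> Ob C" "B \<in> Ob C"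
      "A' \<in> Ob C" "B' \<in> Ob C"
    "arr C (To A) A \<alpha>" "arr C (To B) B \<beta>" "arr C (To A') A' \<alpha>'" using qD o arr_Ob by auto
  have sq: "Cmp C B' B A p f' = Cmp C B' A' A f p'" using qD by blast
  have pe: "Cmp C (To B) B A p \<beta> = Cmp C (To B) (To A) A \<alpha> (Tm B A p)"
    and fe: "Cmp C (To A') A' A f \<alpha>' = Cmp C (To A') (To A) A \<alpha> (Tm A' A f)" using p f by (auto
        simp: arr_D_iff)
  let ?b = "Cmp C (To B') (To B) B \<beta> (Tm B' B f')"
    and ?a = "Cmp C (To B') (To A') A' \<alpha>' (Tm B' A' p')"
  have Tsq: "Cmp C (To B') (To B) (To A) (Tm B A p) (Tm B' B f') = Cmp C (To B') (To A') (To A) (Tm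
      A' A f) (Tm B' A' p')"
    by (simp flip: Tm_Cmp add: sq)
  have "Cmp C (To B') B A p ?b = Cmp C (To B') A' A f ?a"
    by (simp add: Cmp_reassoc[OF pe] Cmp_reassoc[OF fe] Cmp_assoc' Tsq)
  then obtain h where h [simp]: "arr C (To B') B' h" and fh: "Cmp C (To B') B' B f' h = ?b"
    and ph: "Cmp C (To B') B' A' p' h = ?a"
    using is_pullback_ex[OF q, of "To B'" ?b ?a] by auto
  have fth: "Cmp C B' (To B') (To B) (Tm B' B f') (Tm (To B') B' h) = Cmp C B' B (To B) (Tm (To B) B
      \<beta>) f'"
    and pth: "Cmp C B' (To B') (To A') (Tm B' A' p') (Tm (To B') B' h) = Cmp C B' A' (To A') (Tm (To
        A') A' \<alpha>') p'"
    using arg_cong[OF fh, of "Tm (To B') B"] arg_cong[OF ph, of "Tm (To B') A'"] by (simp_all add: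
        Tm_Cmp)
  have "Cmp C B' (To B') B' h (Tm (To B') B' h) = Idn C B'"
    by (rule is_pullback_eqI[OF q, where T = B'])
       (simp_all add: Cmp_reassoc[OF fh] Cmp_reassoc[OF ph] Cmp_assoc' fth pth Cmp_reassoc[OF o(7)]
           Cmp_reassoc[OF o(11)])
  then have B': "(B', h) \<in> Ob D" by (simp add: Ob_D_iff)
  have p': "arr D (B', h) (A', \<alpha>') p'" and f': "arr D (B', h) (B, \<beta>) f'"
    using A' B B' by (simp_all add: arr_D_iff fh ph)
  have "is_pullback D (B, \<beta>) (A, \<alpha>) (B', h) (A', \<alpha>') p f p' f'"
  proof (rule D.is_pullbackI[OF p f p' f'])
    show "Cmp D (B', h) (B, \<beta>) (A, \<alpha>) p f' = Cmp D (B', h) (A', \<alpha>') (A, \<alpha>) f p'" using sq by simp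
  next
    fix T b a assume ab: "arr D T (B, \<beta>) b" "arr D T (A', \<alpha>') a"
      "Cmp D T (B, \<beta>) (A, \<alpha>) p b = Cmp D T (A', \<alpha>') (A, \<alpha>) f a"
    obtain T0 \<tau> where T: "T = (T0, \<tau>)" by fastforce
    have t: "(T0, \<tau>) \<in> Ob D" "arr C T0 B b" "arr C T0 A' a" "twist T0 \<tau> B \<beta> b = b" "twist T0 \<tau> A' \<alpha>'
        a = a"
      "Cmp C T0 B A p b = Cmp C T0 A' A f a"
      using ab by (auto simp: arr_D_twist T)
    obtain k where k: "arr C T0 B' k" "Cmp C T0 B' B f' k = b" "Cmp C T0 B' A' p' k = a"
      using is_pullback_ex[OF q t(2,3,6)] by blast
    have tw: "twist B' h B \<beta> f' = f'" "twist B' h A' \<alpha>' p' = p'" using p' f' by (auto simp: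
        arr_D_twist)
    have "twist T0 \<tau> B' h k = k"
    proof (rule is_pullback_eqI[OF q])
      show "Cmp C T0 B' B f' (twist T0 \<tau> B' h k) = Cmp C T0 B' B f' k"
        using twist_Cmp[OF t(1) B' B k(1) arr_D_C[OF f']] by (simp only: k(2) t(4) tw(1))
      show "Cmp C T0 B' A' p' (twist T0 \<tau> B' h k) = Cmp C T0 B' A' p' k"
        using twist_Cmp[OF t(1) B' A' k(1) arr_D_C[OF p']] by (simp only: k(3) t(5) tw(2))
    qed (use k t B' in simp_all)
    then have "arr D T (B', h) k" using k t B' by (simp add: arr_D_twist T)
    then show "\<exists>k. arr D T (B', h) k \<and> Cmp D T (B', h) (B, \<beta>) f' k = b \<and> Cmp D T (B', h) (A', \<alpha>') p'
        k = a"
      using k T by auto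
  next
    fix T x y assume xy: "arr D T (B', h) x" "arr D T (B', h) y"
      "Cmp D T (B', h) (B, \<beta>) f' x = Cmp D T (B', h) (B, \<beta>) f' y"
      "Cmp D T (B', h) (A', \<alpha>') p' x = Cmp D T (B', h) (A', \<alpha>') p' y"
    then show "x = y" using is_pullback_eqI[OF q, of _ x y] by (cases T) (auto dest!: arr_D_C)
  qed
  then show ?thesis using that by blast
qed

sublocale D: exact_category R D ED
proof (unfold_locales, goal_cases)
  case (1 X Y Z f g)
  then show ?case
    using exact_is_kernel exact_is_cokernel is_kernel_D is_cokernel_D
    by (cases X; cases Y; cases Z) (auto simp: ED_iff)
next
  case (2 X Y Z f g X' Y' f' Z' g' a b d)
  obtain X0 \<xi> Y0 \<upsilon> Z0 \<zeta> X1 \<xi>' Y1 \<upsilon>' Z1 \<zeta>' where e: "X = (X0, \<xi>)" "Y = (Y0, \<upsilon>)" "Z = (Z0, \<zeta>)"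
    "X' = (X1, \<xi>')" "Y' = (Y1, \<upsilon>')" "Z' = (Z1, \<zeta>')" by (metis surj_pair)
  have "E X1 Y1 Z1 f' g'"
    by (rule iso_closed[of X0 Y0 Z0 f g X1 Y1 f' Z1 g' a b d])
      (use 2 in \<open>auto simp: e ED_iff iso_arr_D_iff dest: arr_D_C\<close>)
  then show ?case using 2 by (simp add: e ED_iff)
next
  case (3 X)
  then show ?case using Idn_inflation arr_D_Idn Ob_DD(1) by (cases X) (auto simp: inflation_D_iff)
next
  case (4 X)
  then show ?case using Idn_deflation arr_D_Idn Ob_DD(1) by (cases X) (auto simp: deflation_D_iff)
next
  case (5 X Y f Z g)
  then show ?case using Cmp_inflation arr_D_Cmp by (cases X; cases Y; cases Z) (auto simp:
      inflation_D_iff)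
next
  case (6 X Y f Z g)
  then show ?case using Cmp_deflation arr_D_Cmp by (cases X; cases Y; cases Z) (auto simp:
      deflation_D_iff)
next
  case (7 A' B' i' A'' f')
  obtain A \<alpha> B \<beta> A1 \<alpha>1 where e: "A' = (A, \<alpha>)" "B' = (B, \<beta>)" "A'' = (A1, \<alpha>1)" by (metis surj_pair)
  have i: "arr D (A, \<alpha>) (B, \<beta>) i'" "inflation E A B i'" and f: "arr D (A, \<alpha>) (A1, \<alpha>1) f'"
    using 7 by (auto simp: e inflation_D_iff)
  obtain Bn i1 f1 where p: "is_pushout C A B A1 Bn i' f' i1 f1" and i1: "inflation E A1 Bn i1"
    using pushout_inflation[OF i(2) arr_D_C[OF f]] by blast
  obtain \<beta>' where q: "is_pushout D (A, \<alpha>) (B, \<beta>) (A1, \<alpha>1) (Bn, \<beta>') i' f' i1 f1"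
    using pushout_D[OF i(1) f p] .
  then have "inflation ED (A1, \<alpha>1) (Bn, \<beta>') i1" using i1 D.is_pushoutD[OF q] by (simp add:
      inflation_D_iff)
  then show ?case using q unfolding e by blast
next
  case (8 B' A' i' A'' f')
  obtain A \<alpha> B \<beta> A1 \<alpha>1 where e: "A' = (A, \<alpha>)" "B' = (B, \<beta>)" "A'' = (A1, \<alpha>1)" by (metis surj_pair)
  have i: "arr D (B, \<beta>) (A, \<alpha>) i'" "deflation E B A i'" and f: "arr D (A1, \<alpha>1) (A, \<alpha>) f'"
    using 8 by (auto simp: e deflation_D_iff)
  obtain Bn i1 f1 where p: "is_pullback C B A Bn A1 i' f' i1 f1" and i1: "deflation E Bn A1 i1"
    using pullback_deflation[OF i(2) arr_D_C[OF f]] by blast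
  obtain \<beta>' where q: "is_pullback D (B, \<beta>) (A, \<alpha>) (Bn, \<beta>') (A1, \<alpha>1) i' f' i1 f1"
    using pullback_D[OF i(1) f p] .
  then have "deflation ED (Bn, \<beta>') (A1, \<alpha>1) i1" using i1 D.is_pullbackD[OF q] by (simp add:
      deflation_D_iff)
  then show ?case using q unfolding e by blast
qed

lemma deflation_Tm: "deflation E Y Z g \<Longrightarrow> deflation E (To Y) (To Z) (Tm Y Z g)"
  unfolding deflation_def using exact_Tm by blast

lemma inflation_Tm: "inflation E Y Z g \<Longrightarrow> inflation E (To Y) (To Z) (Tm Y Z g)"
  unfolding inflation_def using exact_Tm by blast

lemma projective_To:
  assumes P: "projective C E P"
  shows "projective C E (To P)"
  unfolding projective_def
proof (intro conjI allI impI)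
  have o [simp]: "P \<in> Ob C" using P by (simp add: projective_def)
  then show "To P \<in> Ob C" by simp
  fix Y Z g h assume gh: "deflation E Y Z g \<and> arr C (To P) Z h"
  have g [simp]: "arr C Y Z g" "arr C (To P) Z h" using gh deflation_arr by auto
  then have [simp]: "Y \<in> Ob C" "Z \<in> Ob C" using arr_Ob by blast+
  obtain k where k [simp]: "arr C P (To Y) k" and e: "Cmp C P (To Y) (To Z) (Tm Y Z g) k = Tm (To P)
      Z h"
    using P deflation_Tm[of Y Z g] gh unfolding projective_def by (metis Tm_arr'(1) o g(2))
  have "Cmp C (To P) Y Z g (Tm P (To Y) k) = h"
    using arg_cong[OF e, of "Tm P (To Z)"] by (simp add: Tm_Cmp)
  then show "\<exists>k. arr C (To P) Y k \<and> Cmp C (To P) Y Z g k = h"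
    by (intro exI[of _ "Tm P (To Y) k"]) simp
qed

lemma injective_To:
  assumes P: "injective C E P"
  shows "injective C E (To P)"
  unfolding injective_def
proof (intro conjI allI impI)
  have o [simp]: "P \<in> Ob C" using P by (simp add: injective_def)
  then show "To P \<in> Ob C" by simp
  fix Y Z g h assume gh: "inflation E Y Z g \<and> arr C Y (To P) h"
  have g [simp]: "arr C Y Z g" "arr C Y (To P) h" using gh inflation_arr by auto
  then have [simp]: "Y \<in> Ob C" "Z \<in> Ob C" using arr_Ob by blast+
  obtain k where k [simp]: "arr C (To Z) P k" and e: "Cmp C (To Y) (To Z) P k (Tm Y Z g) = Tm Y (To
      P) h"
    using P inflation_Tm[of Y Z g] gh unfolding injective_def by (metis Tm_arr'(2) o g(2))
  have "Cmp C Y Z (To P) (Tm (To Z) P k) g = h"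
    using arg_cong[OF e, of "Tm (To Y) P"] by (simp add: Tm_Cmp)
  then show "\<exists>k. arr C Z (To P) k \<and> Cmp C Y Z (To P) k g = h"
    by (intro exI[of _ "Tm (To Z) P k"]) simp
qed

end

locale involutive_frobenius_category = involutive_exact_category R C To Tm E + frobenius_category R
    C E
  for R :: "('r, 'k) ring_scheme" (structure) and C :: "('o, 'm, 'r) lincat"
    and To :: "'o \<Rightarrow> 'o" and Tm :: "'o \<Rightarrow> 'o \<Rightarrow> 'm \<Rightarrow> 'm" and E :: "('o, 'm) seq_class" +
  assumes two_Unit: "\<one> \<oplus> \<one> \<in> Units R"
begin

lemma half:
  obtains r where "r \<in> carrier R" "r \<otimes> (\<one> \<oplus> \<one>) = \<one>"
  using two_Unit by (meson Units_inv_closed Units_l_inv)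

text \<open>The mean of \<open>k\<close> and its twist is equivariant, and it still solves every equivariant equation
  that \<open>k\<close> solves.\<close>

lemma average:
  assumes X: "(X, \<xi>) \<in> Ob D" and Y: "(Y, \<upsilon>) \<in> Ob D" and k: "arr C X Y k"
  obtains k' where "arr D (X, \<xi>) (Y, \<upsilon>) k'"
    "\<And>Z \<zeta> g h. \<lbrakk>arr D (Y, \<upsilon>) (Z, \<zeta>) g; arr D (X, \<xi>) (Z, \<zeta>) h; Cmp C X Y Z g k = h\<rbrakk> \<Longrightarrow> Cmp C X Y Z g
        k' = h"
    "\<And>Z \<zeta> g h. \<lbrakk>arr D (Z, \<zeta>) (X, \<xi>) g; arr D (Z, \<zeta>) (Y, \<upsilon>) h; Cmp C Z X Y k g = h\<rbrakk> \<Longrightarrow> Cmp C Z X Y k'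
        g = h"
proof -
  obtain r where r: "r \<in> carrier R" "r \<otimes> (\<one> \<oplus> \<one>) = \<one>" using half .
  have r2: "r \<odot>\<^bsub>Hom C A B\<^esub> (h \<oplus>\<^bsub>Hom C A B\<^esub> h) = h" if "arr C A B h" for A B h
  proof -
    interpret m: module R "Hom C A B" using that arr_Ob Hom_module by blast
    have h: "h \<in> carrier (Hom C A B)" using that by (simp add: arr_def)
    have "h \<oplus>\<^bsub>Hom C A B\<^esub> h = (\<one> \<oplus> \<one>) \<odot>\<^bsub>Hom C A B\<^esub> h" using h by (simp add: m.smult_l_distr)
    then show ?thesis using r h by (simp flip: m.smult_assoc1)
  qed
  let ?k = "r \<odot>\<^bsub>Hom C X Y\<^esub> (k \<oplus>\<^bsub>Hom C X Y\<^esub> twist X \<xi> Y \<upsilon> k)"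
  have "arr D (X, \<xi>) (Y, \<upsilon>) ?k"
    using X Y k r by (simp add: arr_D_twist twist_smult twist_add hom_comm)
  moreover have "Cmp C X Y Z g ?k = h"
    if g: "arr D (Y, \<upsilon>) (Z, \<zeta>) g" and h: "arr D (X, \<xi>) (Z, \<zeta>) h" and e: "Cmp C X Y Z g k = h" for Z
        \<zeta> g h
  proof -
    have g': "(Z, \<zeta>) \<in> Ob D" "arr C Y Z g" "twist Y \<upsilon> Z \<zeta> g = g" "arr C X Z h" "twist X \<xi> Z \<zeta> h = h"
      using g h by (auto simp: arr_D_twist)
    have "Cmp C X Y Z g (twist X \<xi> Y \<upsilon> k) = h"
      using twist_Cmp[OF X Y g'(1) k g'(2)] g' e by simp
    then show ?thesis using X Y k r g' e by (simp add: Cmp_smult_right Cmp_add_right r2)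
  qed
  moreover have "Cmp C Z X Y ?k g = h"
    if g: "arr D (Z, \<zeta>) (X, \<xi>) g" and h: "arr D (Z, \<zeta>) (Y, \<upsilon>) h" and e: "Cmp C Z X Y k g = h" for Z
        \<zeta> g h
  proof -
    have g': "(Z, \<zeta>) \<in> Ob D" "arr C Z X g" "twist Z \<zeta> X \<xi> g = g" "arr C Z Y h" "twist Z \<zeta> Y \<upsilon> h = h"
      using g h by (auto simp: arr_D_twist)
    have "Cmp C Z X Y (twist X \<xi> Y \<upsilon> k) g = h"
      using twist_Cmp[OF g'(1) X Y g'(2) k] g' e by simp
    then show ?thesis using X Y k r g' e by (simp add: Cmp_smult_left Cmp_add_left r2)
  qed
  ultimately show ?thesis using that by blast
qed

lemma projective_D_of_C:
  assumes P: "(P, \<rho>) \<in> Ob D" "projective C E P"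
  shows "projective D ED (P, \<rho>)"
  unfolding projective_def
proof (intro conjI allI impI P(1))
  fix Y' Z' g h assume gh: "deflation ED Y' Z' g \<and> arr D (P, \<rho>) Z' h"
  obtain Y \<upsilon> Z \<zeta> where e: "Y' = (Y, \<upsilon>)" "Z' = (Z, \<zeta>)" by fastforce
  have g: "arr D (Y, \<upsilon>) (Z, \<zeta>) g" "deflation E Y Z g" and h: "arr D (P, \<rho>) (Z, \<zeta>) h"
    using gh by (auto simp: e deflation_D_iff)
  obtain k where k: "arr C P Y k" "Cmp C P Y Z g k = h"
    using P(2) g(2) arr_D_C[OF h] unfolding projective_def by blast
  have "(Y, \<upsilon>) \<in> Ob D" using g arr_D_Ob by blast
  then obtain k' where "arr D (P, \<rho>) (Y, \<upsilon>) k'" "Cmp C P Y Z g k' = h"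
    using average[OF P(1) _ k(1)] g(1) h k(2) by metis
  then show "\<exists>k. arr D (P, \<rho>) Y' k \<and> Cmp D (P, \<rho>) Y' Z' g k = h" unfolding e by auto
qed

lemma injective_D_of_C:
  assumes P: "(P, \<rho>) \<in> Ob D" "injective C E P"
  shows "injective D ED (P, \<rho>)"
  unfolding injective_def
proof (intro conjI allI impI P(1))
  fix Y' Z' g h assume gh: "inflation ED Y' Z' g \<and> arr D Y' (P, \<rho>) h"
  obtain Y \<upsilon> Z \<zeta> where e: "Y' = (Y, \<upsilon>)" "Z' = (Z, \<zeta>)" by fastforce
  have g: "arr D (Y, \<upsilon>) (Z, \<zeta>) g" "inflation E Y Z g" and h: "arr D (Y, \<upsilon>) (P, \<rho>) h"
    using gh by (auto simp: e inflation_D_iff)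
  obtain k where k: "arr C Z P k" "Cmp C Y Z P k g = h"
    using P(2) g(2) arr_D_C[OF h] unfolding injective_def by blast
  have "(Z, \<zeta>) \<in> Ob D" using g arr_D_Ob by blast
  then obtain k' where "arr D (Z, \<zeta>) (P, \<rho>) k'" "Cmp C Y Z P k' g = h"
    using average[OF _ P(1) k(1)] g(1) h k(2) by metis
  then show "\<exists>k. arr D Z' (P, \<rho>) k \<and> Cmp D Y' Z' (P, \<rho>) k g = h" unfolding e by auto
qed

text \<open>A deflation \<open>e : P \<rightarrow> X\<close> from a projective induces an equivariant arrow
  \<open>[e, q] : P \<oplus> To P \<rightarrow> X\<close>. As \<open>To P\<close> is projective too, \<open>q\<close> factors as \<open>q = e r\<close>, and
  \<open>[e, q] = e [1, r]\<close> is a composite of deflations.\<close>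

lemma equivariant_projective_cover:
  assumes X: "(X, \<xi>) \<in> Ob D"
  obtains Y \<upsilon> g where "(Y, \<upsilon>) \<in> Ob D" "projective C E Y" "deflation ED (Y, \<upsilon>) (X, \<xi>) g"
proof -
  note o = Ob_DD[OF X]
  obtain P e where P: "projective C E P" and d: "deflation E P X e" using enough_projectives[OF
      o(1)] by blast
  have e [simp]: "arr C P X e" using d deflation_arr by blast
  have [simp]: "P \<in> Ob C" "X \<in> Ob C" "arr C (To X) X \<xi>" using P o by (auto simp: projective_def)
  obtain Y i p j q where b: "biproduct Y P (To P) i p j q"
    using ex_direct_sum[of P "To P"] by (auto simp: direct_sum_two_iff)
  note [simp] = biproductD(1-4)[OF b]
  note PT = projective_To[OF P]
  let ?q = "Cmp C (To P) (To X) X \<xi> (Tm P X e)"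
  let ?e = "Cmp C Y P X e p \<oplus>\<^bsub>Hom C Y X\<^esub> Cmp C Y (To P) X ?q q"
  have eD: "arr D (Y, swap Y P i p j q) (X, \<xi>) ?e" using free_object(2)[OF b _ X e] by simp
  obtain r where r [simp]: "arr C (To P) P r" and er: "Cmp C (To P) P X e r = ?q"
    using PT d unfolding projective_def by (metis Cmp_arr Tm_arr e o(2))
  have "deflation E Y X (Cmp C Y P X e (p \<oplus>\<^bsub>Hom C Y P\<^esub> Cmp C Y (To P) P r q))"
    using Cmp_deflation[OF deflation_of_biproduct[OF b r] d] .
  also have "Cmp C Y P X e (p \<oplus>\<^bsub>Hom C Y P\<^esub> Cmp C Y (To P) P r q) = ?e"
    by (simp add: Cmp_bilinear Cmp_reassoc[OF er])
  finally have "deflation ED (Y, swap Y P i p j q) (X, \<xi>) ?e" using eD by (simp add: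
      deflation_D_iff)
  then show ?thesis using that arr_D_Ob[OF eD] projective_biproduct[OF P PT b] by blast
qed

lemma equivariant_injective_hull:
  assumes X: "(X, \<xi>) \<in> Ob D"
  obtains Y \<upsilon> g where "(Y, \<upsilon>) \<in> Ob D" "injective C E Y" "inflation ED (X, \<xi>) (Y, \<upsilon>) g"
proof -
  note o = Ob_DD[OF X]
  obtain P e where P: "injective C E P" and d: "inflation E X P e" using enough_injectives[OF o(1)]
      by blast
  have e [simp]: "arr C X P e" using d inflation_arr by blast
  have [simp]: "P \<in> Ob C" "X \<in> Ob C" "arr C (To X) X \<xi>" using P o by (auto simp: injective_def)
  obtain Y i p j q where b: "biproduct Y P (To P) i p j q"
    using ex_direct_sum[of P "To P"] by (auto simp: direct_sum_two_iff)
  note [simp] = biproductD(1-4)[OF b]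
  note PT = injective_To[OF P]
  let ?q = "Cmp C X (To X) (To P) (Tm X P e) (Tm (To X) X \<xi>)"
  let ?e = "Cmp C X P Y i e \<oplus>\<^bsub>Hom C X Y\<^esub> Cmp C X (To P) Y j ?q"
  have eD: "arr D (X, \<xi>) (Y, swap Y P i p j q) ?e" using free_object(3)[OF b _ X e] by simp
  have "arr C X (To P) ?q" by simp
  then obtain r where r [simp]: "arr C P (To P) r" and er: "Cmp C X P (To P) r e = ?q"
    using PT d unfolding injective_def by metis
  have "inflation E X Y (Cmp C X P Y (i \<oplus>\<^bsub>Hom C P Y\<^esub> Cmp C P (To P) Y j r) e)"
    using Cmp_inflation[OF d inflation_of_biproduct[OF b r]] .
  also have "Cmp C X P Y (i \<oplus>\<^bsub>Hom C P Y\<^esub> Cmp C P (To P) Y j r) e = ?e"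
    by (simp add: Cmp_bilinear Cmp_assoc' er)
  finally have "inflation ED (X, \<xi>) (Y, swap Y P i p j q) ?e" using eD by (simp add:
      inflation_D_iff)
  then show ?thesis using that arr_D_Ob[OF eD] injective_biproduct[OF P PT b] by blast
qed

text \<open>A projective object of \<open>C\<^sup>\<psi>\<close> is a retract of its free cover, whose underlying object is
  projective in \<open>C\<close>; the converse is averaging.\<close>

lemma projective_D_iff: "projective D ED (P, \<rho>) \<longleftrightarrow> (P, \<rho>) \<in> Ob D \<and> projective C E P"
proof
  assume P: "projective D ED (P, \<rho>)"
  then have PO: "(P, \<rho>) \<in> Ob D" by (simp add: projective_def)
  obtain Y \<upsilon> g where Y: "(Y, \<upsilon>) \<in> Ob D" "projective C E Y" "deflation ED (Y, \<upsilon>) (P, \<rho>) g"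
    using equivariant_projective_cover[OF PO] .
  have "\<exists>k. arr D (P, \<rho>) (Y, \<upsilon>) k \<and> Cmp D (P, \<rho>) (Y, \<upsilon>) (P, \<rho>) g k = Idn C P"
    using P Y(3) arr_D_Idn[OF PO] unfolding projective_def by blast
  then obtain k where k: "arr D (P, \<rho>) (Y, \<upsilon>) k" "Cmp C P Y P g k = Idn C P" by auto
  have "arr C Y P g" using Y(3) by (auto simp: deflation_D_iff dest: arr_D_C)
  then show "(P, \<rho>) \<in> Ob D \<and> projective C E P"
    using projective_retract[OF Y(2) arr_D_C[OF k(1)]] k(2) PO by blast
qed (use projective_D_of_C in blast)

lemma injective_D_iff: "injective D ED (P, \<rho>) \<longleftrightarrow> (P, \<rho>) \<in> Ob D \<and> injective C E P"
proof
  assume P: "injective D ED (P, \<rho>)"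
  then have PO: "(P, \<rho>) \<in> Ob D" by (simp add: injective_def)
  obtain Y \<upsilon> g where Y: "(Y, \<upsilon>) \<in> Ob D" "injective C E Y" "inflation ED (P, \<rho>) (Y, \<upsilon>) g"
    using equivariant_injective_hull[OF PO] .
  have "\<exists>k. arr D (Y, \<upsilon>) (P, \<rho>) k \<and> Cmp D (P, \<rho>) (Y, \<upsilon>) (P, \<rho>) k g = Idn C P"
    using P Y(3) arr_D_Idn[OF PO] unfolding injective_def by blast
  then obtain k where k: "arr D (Y, \<upsilon>) (P, \<rho>) k" "Cmp C P Y P k g = Idn C P" by auto
  have "arr C P Y g" using Y(3) by (auto simp: inflation_D_iff dest: arr_D_C)
  then show "(P, \<rho>) \<in> Ob D \<and> injective C E P"
    using injective_retract[OF Y(2) _ arr_D_C[OF k(1)]] k(2) PO by blast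
qed (use injective_D_of_C in blast)

sublocale D: frobenius_category R D ED
proof (unfold_locales, goal_cases)
  case (1 X)
  then show ?case using equivariant_projective_cover projective_D_of_C by (cases X) metis
next
  case (2 X)
  then show ?case using equivariant_injective_hull injective_D_of_C by (cases X) metis
next
  case (3 A)
  then show ?case using projective_iff_injective
    by (cases A) (auto simp: projective_D_iff injective_D_iff)
qed

end

section \<open>Local endomorphism rings\<close>

context linear_category
begin

lemma End_ring_is_ring: "X \<in> Ob C \<Longrightarrow> ring (End_ring C X)"
proof (rule ringI)
  assume X: "X \<in> Ob C"
  interpret M: abelian_group "Hom C X X" using X Hom_abelian_group by blast
  have c: "f \<in> carrier (Hom C X X) \<longleftrightarrow> arr C X X f" for f using X by (simp add: arr_def)
  show "abelian_group (End_ring C X)"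
    by (rule abelian_groupI)
      (auto simp: End_ring_def M.a_ac intro: M.l_neg[OF _] bexI[of _ "\<ominus>\<^bsub>Hom C X X\<^esub> _"])
  show "monoid (End_ring C X)"
    using X by (intro monoidI) (simp_all add: End_ring_def c Cmp_assoc)
qed (simp_all add: End_ring_def arr_def Cmp_bilinear)

lemma Units_End_ring: "X \<in> Ob C \<Longrightarrow> f \<in> Units (End_ring C X) \<longleftrightarrow> iso_arr C X X f"
  by (auto simp: Units_def End_ring_def iso_arr_def arr_def)

lemma local_End_ring_iff: "X \<in> Ob C \<Longrightarrow> local_ring (End_ring C X) \<longleftrightarrow>
    Idn C X \<noteq> \<zero>\<^bsub>Hom C X X\<^esub> \<and> (\<forall>f g. arr C X X f \<and> arr C X X g \<and>
      iso_arr C X X (f \<oplus>\<^bsub>Hom C X X\<^esub> g) \<longrightarrow> iso_arr C X X f \<or> iso_arr C X X g)"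
proof -
  assume X: "X \<in> Ob C"
  have "carrier (End_ring C X) = {f. arr C X X f}" "add (End_ring C X) = add (Hom C X X)"
    "\<one>\<^bsub>End_ring C X\<^esub> = Idn C X" "\<zero>\<^bsub>End_ring C X\<^esub> = \<zero>\<^bsub>Hom C X X\<^esub>"
    using X by (auto simp: End_ring_def arr_def)
  moreover have "Units (End_ring C X) = {f. iso_arr C X X f}" using Units_End_ring[OF X] by blast
  ultimately show ?thesis
    unfolding local_ring_def using End_ring_is_ring[OF X] by simp blast
qed

text \<open>An endomorphism ring is local once an additive map to a local ring detects its units. For
  the objects considered here this is an entry of the matrix of an endomorphism.\<close>

lemma local_End_ring_of_hom:
  assumes X: "X \<in> Ob C" and R: "local_ring R"
    and cl: "\<And>f. arr C X X f \<Longrightarrow> \<phi> f \<in> carrier R"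
    and add: "\<And>f g. \<lbrakk>arr C X X f; arr C X X g\<rbrakk> \<Longrightarrow> \<phi> (f \<oplus>\<^bsub>Hom C X X\<^esub> g) = \<phi> f \<oplus> \<phi> g"
    and iso: "\<And>f. arr C X X f \<Longrightarrow> iso_arr C X X f \<longleftrightarrow> \<phi> f \<in> Units R"
  shows "local_ring (End_ring C X)"
  unfolding local_End_ring_iff[OF X]
proof (intro conjI allI impI notI)
  let ?z = "\<zero>\<^bsub>Hom C X X\<^esub>"
  assume "Idn C X = ?z"
  then have "iso_arr C X X ?z" using iso_arr_Idn[OF X] by simp
  then have u: "\<phi> ?z \<in> Units R" using iso X by simp
  have "\<phi> ?z = \<phi> ?z \<oplus> \<phi> ?z" using add[of ?z ?z] X by simp
  then have "\<phi> ?z = \<zero>" using u by (metis Units_closed add.r_cancel_one')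
  then show False using u R unfolding local_ring_def by (metis Units_closed Units_r_inv
      Units_inv_closed l_null)
next
  fix f g assume fg: "arr C X X f \<and> arr C X X g \<and> iso_arr C X X (f \<oplus>\<^bsub>Hom C X X\<^esub> g)"
  then have "\<phi> f \<oplus> \<phi> g \<in> Units R" using iso[of "f \<oplus>\<^bsub>Hom C X X\<^esub> g"] add by simp
  then have "\<phi> f \<in> Units R \<or> \<phi> g \<in> Units R" using R cl fg unfolding local_ring_def by blast
  then show "iso_arr C X X f \<or> iso_arr C X X g" using iso fg by blast
qed

lemma zero_object_of_iso_idempotent:
  assumes b: "biproduct X A B i p j q" and iso: "iso_arr C X X (Cmp C X A X i p)"
  shows "zero_object C B"
proof -
  note bD = biproductD[OF b] biproductD_reassoc[OF b]
  have o: "X \<in> Ob C" "A \<in> Ob C" "B \<in> Ob C" using biproduct_Ob[OF b] by auto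
  obtain h where h: "arr C X X h" "Cmp C X X X h (Cmp C X A X i p) = Idn C X"
    using iso by (auto simp: iso_arr_def)
  have "j = Cmp C B X X (Cmp C X X X h (Cmp C X A X i p)) j" using bD h by simp
  also have "\<dots> = \<zero>\<^bsub>Hom C B X\<^esub>" using bD h(1) o by (simp add: Cmp_assoc')
  finally have "Idn C B = \<zero>\<^bsub>Hom C B B\<^esub>" using bD o by (metis Cmp_zero_right)
  then show ?thesis using o zero_objectI by blast
qed

text \<open>If \<open>X = A \<oplus> B\<close> then the idempotents \<open>i p\<close> and \<open>j q\<close> have sum \<open>1\<close>, so one of them is
  invertible and the other summand vanishes.\<close>

lemma indecomposable_of_local:
  assumes X: "X \<in> Ob C" and l: "local_ring (End_ring C X)"
  shows "indecomposable C X"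
  unfolding indecomposable_def
proof (intro conjI allI impI X)
  show "\<not> zero_object C X" using l X by (simp add: local_End_ring_iff zero_object_iff)
  fix A B assume "direct_sum C X [A, B]"
  then obtain i p j q where b: "biproduct X A B i p j q" by (auto simp: direct_sum_two_iff)
  note bD = biproductD[OF b]
  have "iso_arr C X X (Cmp C X A X i p) \<or> iso_arr C X X (Cmp C X B X j q)"
    using l bD iso_arr_Idn[OF X] unfolding local_End_ring_iff[OF X] by auto
  then show "zero_object C A \<or> zero_object C B"
    using zero_object_of_iso_idempotent[OF b] zero_object_of_iso_idempotent[OF biproduct_swap[OF b]]
        by blast
qed

lemma isomorphic_of_biproduct_zero:
  assumes b: "biproduct X A B i p j q" and B: "zero_object C B"
  shows "isomorphic C X A"
proof -
  note bD = biproductD[OF b]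
  have o: "X \<in> Ob C" "B \<in> Ob C" using biproduct_Ob[OF b] by auto
  have "q = \<zero>\<^bsub>Hom C X B\<^esub>" using zero_object_to[OF B bD(4)] .
  then have "Cmp C X A X i p = Idn C X" using bD o by simp
  then show ?thesis using bD unfolding isomorphic_def iso_arr_def by blast
qed

text \<open>Splitting off a sum \<open>W = A \<oplus> B\<close> along given maps, one summand after the other.\<close>

lemma biproduct_iterate:
  assumes w: "biproduct W A B i p j q" and f: "arr C W X f" and g: "arr C X W g"
    and gf: "Cmp C W X W g f = Idn C W"
    and V: "biproduct X A V (Cmp C A W X f i) (Cmp C X W A p g) k r"
    and V': "biproduct V B V' (Cmp C B X V r (Cmp C B W X f j)) (Cmp C V W B q (Cmp C V X W g k)) l
        s"
  shows "biproduct X W V' f g (Cmp C V' V X k l) (Cmp C X V V' s r)"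
proof -
  note wD [simp] = biproductD(1-8)[OF w] biproductD_reassoc[OF w]
  note vD = biproductD[OF V] and vD' = biproductD[OF V']
  note fg [simp] = f g
  note a [simp] = vD(3,4) vD'(3,4)
  have o [simp]: "X \<in> Ob C" "W \<in> Ob C" "A \<in> Ob C" "B \<in> Ob C" "V \<in> Ob C" "V' \<in> Ob C"
    using biproduct_Ob[OF w] biproduct_Ob[OF V] biproduct_Ob[OF V'] by auto
  define f1 f2 g1 g2 where d: "f1 = Cmp C A W X f i" "f2 = Cmp C B W X f j" "g1 = Cmp C X W A p g"
      "g2 = Cmp C X W B q g"
  have a2 [simp]: "arr C A X f1" "arr C B X f2" "arr C X A g1" "arr C X B g2" by (simp_all add: d)
  have kr: "Cmp C X A X f1 g1 \<oplus>\<^bsub>Hom C X X\<^esub> Cmp C X V X k r = Idn C X" using vD(9) unfolding d .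
  have ls: "Cmp C V B V (Cmp C B X V r f2) (Cmp C V X B g2 k) \<oplus>\<^bsub>Hom C V V\<^esub> Cmp C V V' V l s = Idn C V"
    using vD'(9) unfolding d by (simp add: Cmp_assoc')
  have gfz: "Cmp C B X A g1 f2 = \<zero>\<^bsub>Hom C B A\<^esub>" "Cmp C A X B g2 f1 = \<zero>\<^bsub>Hom C A B\<^esub>"
    by (simp_all add: d Cmp_assoc' Cmp_reassoc[OF gf])
  have krf: "Cmp C B V X k (Cmp C B X V r f2) = f2"
    using arg_cong[OF kr, of "\<lambda>t. Cmp C B X X t f2"] by (simp add: Cmp_bilinear Cmp_assoc' gfz)
  have gkr: "Cmp C X V B (Cmp C V X B g2 k) r = g2"
    using arg_cong[OF kr, of "\<lambda>t. Cmp C X X B g2 t"] by (simp add: Cmp_bilinear Cmp_assoc gfz)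
  have "Cmp C X V X k (Cmp C X V V (Cmp C V B V (Cmp C B X V r f2) (Cmp C V X B g2 k) \<oplus>\<^bsub>Hom C V V\<^esub> Cmp
      C V V' V l s) r)
      = Cmp C X B X (Cmp C B V X k (Cmp C B X V r f2)) (Cmp C X V B (Cmp C V X B g2 k) r) \<oplus>\<^bsub>Hom C X X\<^esub>
      Cmp C X V X k (Cmp C X V V (Cmp C V V' V l s) r)"
    by (simp add: Cmp_bilinear Cmp_assoc')
  then have kr': "Cmp C X V X k r = Cmp C X B X f2 g2 \<oplus>\<^bsub>Hom C X X\<^esub> Cmp C X V' X (Cmp C V' V X k l)
      (Cmp C X V V' s r)"
    unfolding ls krf gkr by (simp add: Cmp_assoc')
  have "Cmp C X W X f g = Cmp C X W X f (Cmp C X W W (Cmp C W A W i p \<oplus>\<^bsub>Hom C W W\<^esub> Cmp C W B W j q)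
      g)"
    using biproductD(9)[OF w] by simp
  also have "\<dots> = Cmp C X A X f1 g1 \<oplus>\<^bsub>Hom C X X\<^esub> Cmp C X B X f2 g2"
    by (simp add: d Cmp_bilinear Cmp_assoc')
  finally have "Cmp C X W X f g \<oplus>\<^bsub>Hom C X X\<^esub> Cmp C X V' X (Cmp C V' V X k l) (Cmp C X V V' s r) = Idn
      C X"
    using kr unfolding kr' by (simp add: hom_assoc)
  moreover have "Cmp C V' X V' (Cmp C X V V' s r) (Cmp C V' V X k l) = Idn C V'"
    using vD(6) vD'(6) Cmp_reassoc[OF vD(6)] by (simp add: Cmp_assoc')
  ultimately show ?thesis unfolding biproduct_def using gf by simp
qed

end

section \<open>The additive closure of a cyclic poset over a local ring\<close>

text \<open>Locality of \<open>R\<close> makes the elements of \<open>\<X>\<close> objects with local endomorphism rings. Since \<open>u\<close>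
  is not a unit, a composite \<open>x \<rightarrow> y \<rightarrow> x\<close> of multiples of basic morphisms can only be invertible if
  \<open>c x y x = 0\<close>.\<close>

locale local_cyclic_poset = cring R for R :: "('r, 'k) ring_scheme" (structure) +
  fixes u :: 'r and \<X> :: "'x set" and c :: "'x \<Rightarrow> 'x \<Rightarrow> 'x \<Rightarrow> nat"
  assumes local: "local_ring R" and u_closed [simp]: "u \<in> carrier R" and u_not_Unit: "u \<notin> Units R"
    and cocycle: "reduced_cocycle \<X> c"
    and additive: "additive_category R (addP R u \<X> c)"
begin

abbreviation F where "F \<equiv> addP R u \<X> c"

sublocale F: additive_category R F by (rule additive)

lemma Units_add: "\<lbrakk>a \<oplus> b \<in> Units R; a \<in> carrier R; b \<in> carrier R\<rbrakk> \<Longrightarrow> a \<in> Units R \<or> b \<in> Units R"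
  using local unfolding local_ring_def by blast

lemma one_not_zero: "\<one> \<noteq> \<zero>" using local by (simp add: local_ring_def)

lemma Units_mult_iff: "\<lbrakk>a \<in> carrier R; b \<in> carrier R\<rbrakk> \<Longrightarrow> a \<otimes> b \<in> Units R \<longleftrightarrow> a \<in> Units R \<and> b \<in> Units R"
  by (metis Units_m_closed m_comm unit_factor)

lemma u_pow_Unit_iff: "u [^] (n::nat) \<in> Units R \<longleftrightarrow> n = 0"
  by (cases n) (simp_all add: Units_mult_iff u_not_Unit)

lemma c_degenerate [simp]: "\<lbrakk>x \<in> \<X>; y \<in> \<X>\<rbrakk> \<Longrightarrow> c x x y = 0 \<and> c x y y = 0"
  using cocycle unfolding reduced_cocycle_def by blast

text \<open>The cocycle condition at \<open>(y, x, y, x)\<close>. The two composites between \<open>x\<close> and \<open>y\<close> therefore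
  involve the same power of \<open>u\<close>.\<close>

lemma c_sym:
  assumes "x \<in> \<X>" "y \<in> \<X>"
  shows "c x y x = c y x y"
proof -
  have "int (c x y x) - int (c y y x) + int (c y x x) - int (c y x y) = 0"
    using cocycle assms unfolding reduced_cocycle_def by blast
  then show ?thesis using assms by simp
qed

lemma Ob_F [simp]: "A \<in> Ob F \<longleftrightarrow> set A \<subseteq> \<X>"
  by (simp add: add_cat_def P_cat_def)

lemma arr_F_iff: "arr F A B M \<longleftrightarrow> set A \<subseteq> \<X> \<and> set B \<subseteq> \<X> \<and> M \<in> carrier_mat (length B) (length A) \<and>
    (\<forall>i < length B. \<forall>j < length A. M $$ (i, j) \<in> carrier R)"
  by (auto simp: arr_def add_cat_def P_cat_def)

lemma zero_F: "\<zero>\<^bsub>Hom F A B\<^esub> = mat (length B) (length A) (\<lambda>_. \<zero>)"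
  by (simp add: add_cat_def P_cat_def split_def)

lemma add_F: "M \<oplus>\<^bsub>Hom F A B\<^esub> N = mat (length B) (length A) (\<lambda>(i, j). M $$ (i, j) \<oplus> N $$ (i, j))"
  by (simp add: add_cat_def P_cat_def)

lemma Idn_F: "Idn F A = mat (length A) (length A) (\<lambda>(i, j). if i = j then \<one> else \<zero>)"
  by (simp add: add_cat_def P_cat_def cong: if_cong)

lemma Cmp_F: "Cmp F A B D N M = mat (length D) (length A) (\<lambda>(i, k).
    \<Oplus>j\<in>{..<length B}. u [^] c (A ! k) (B ! j) (D ! i) \<otimes> (N $$ (i, j) \<otimes> M $$ (j, k)))"
  \<comment> \<open>\<open>R\<close> and the Hom modules are records of different types; only unfolding the sums identifies
    them.\<close>
  by (simp add: add_cat_def P_cat_def finsum_def finprod_def)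

lemma finsum_single:
  assumes "finite A" "i \<in> A" "f i \<in> carrier R" "\<And>j. \<lbrakk>j \<in> A; j \<noteq> i\<rbrakk> \<Longrightarrow> f j = \<zero>"
  shows "finsum R f A = f i"
proof -
  have "finsum R f A = finsum R (\<lambda>j. if i = j then f i else \<zero>) A"
    using assms by (intro finsum_cong') auto
  also have "\<dots> = f i" using assms by (simp add: add.finprod_singleton[where f = "\<lambda>_. f i"])
  finally show ?thesis .
qed

subsection \<open>Morphisms between indecomposable objects\<close>

text \<open>The matrix of the morphism \<open>r f\<^sub>x\<^sub>y\<close>, for any \<open>x\<close> and \<open>y\<close>.\<close>

definition scalar :: "'r \<Rightarrow> 'r mat" where
  "scalar r = mat 1 1 (\<lambda>_. r)"

lemma scalar_index [simp]: "scalar r $$ (0, 0) = r"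
  by (simp add: scalar_def)

lemma arr_scalar [simp]: "arr F [x] [y] (scalar r) \<longleftrightarrow> x \<in> \<X> \<and> y \<in> \<X> \<and> r \<in> carrier R"
  by (auto simp: arr_F_iff scalar_def)

lemma arr_singleton:
  assumes "arr F [x] [y] M"
  shows "M = scalar (M $$ (0, 0))" "M $$ (0, 0) \<in> carrier R" "x \<in> \<X>" "y \<in> \<X>"
  using assms by (auto simp: arr_F_iff scalar_def intro!: eq_matI)

lemma Cmp_scalar: "\<lbrakk>r \<in> carrier R; s \<in> carrier R\<rbrakk> \<Longrightarrow>
    Cmp F [x] [y] [z] (scalar s) (scalar r) = scalar (u [^] c x y z \<otimes> (s \<otimes> r))"
  by (auto simp: Cmp_F scalar_def lessThan_Suc intro!: eq_matI)

lemma add_scalar: "scalar r \<oplus>\<^bsub>Hom F [x] [y]\<^esub> scalar s = scalar (r \<oplus> s)"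
  by (auto simp: add_F scalar_def intro!: eq_matI)

lemma zero_scalar: "\<zero>\<^bsub>Hom F [x] [y]\<^esub> = scalar \<zero>"
  by (auto simp: zero_F scalar_def intro!: eq_matI)

lemma Idn_scalar: "Idn F [x] = scalar \<one>"
  by (auto simp: Idn_F scalar_def intro!: eq_matI)

lemma scalar_inject [simp]: "scalar r = scalar s \<longleftrightarrow> r = s"
  by (metis scalar_index)

lemma iso_scalar_iff:
  assumes "x \<in> \<X>" "y \<in> \<X>" "r \<in> carrier R"
  shows "iso_arr F [x] [y] (scalar r) \<longleftrightarrow> r \<in> Units R \<and> c x y x = 0"
proof
  assume "iso_arr F [x] [y] (scalar r)"
  then obtain g where g: "arr F [y] [x] g" "Cmp F [x] [y] [x] g (scalar r) = Idn F [x]"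
    by (auto simp: iso_arr_def)
  then obtain s where s: "g = scalar s" "s \<in> carrier R" using arr_singleton by blast
  have "u [^] c x y x \<otimes> (s \<otimes> r) = \<one>" using g s assms by (simp add: Cmp_scalar Idn_scalar)
  then have "u [^] c x y x \<otimes> (s \<otimes> r) \<in> Units R" by simp
  then show "r \<in> Units R \<and> c x y x = 0" using assms s by (simp add: Units_mult_iff u_pow_Unit_iff)
next
  assume r: "r \<in> Units R \<and> c x y x = 0"
  then have "c y x y = 0" using c_sym assms by simp
  then show "iso_arr F [x] [y] (scalar r)"
    using r assms by (intro F.iso_arrI[of _ _ _ "scalar (inv r)"]) (auto simp: Cmp_scalar
        Idn_scalar)
qed

lemma isomorphic_singletons_iff: "\<lbrakk>x \<in> \<X>; y \<in> \<X>\<rbrakk> \<Longrightarrow> isomorphic F [x] [y] \<longleftrightarrow> c x y x = 0"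
  unfolding isomorphic_def
  by (metis Units_one_closed arr_singleton(1,2) iso_arr_def iso_scalar_iff one_closed)

lemma local_End_singleton: "x \<in> \<X> \<Longrightarrow> local_ring (End_ring F [x])"
proof (rule F.local_End_ring_of_hom[where \<phi> = "\<lambda>M. M $$ (0, 0)"])
  fix f g assume "arr F [x] [x] f" "arr F [x] [x] g"
  then show "(f \<oplus>\<^bsub>Hom F [x] [x]\<^esub> g) $$ (0, 0) = f $$ (0, 0) \<oplus> g $$ (0, 0)" by (simp add: add_F)
next
  fix f assume "x \<in> \<X>" "arr F [x] [x] f"
  then show "iso_arr F [x] [x] f \<longleftrightarrow> f $$ (0, 0) \<in> Units R"
    using iso_scalar_iff[of x x "f $$ (0, 0)"] arr_singleton[of x x f] by simp
qed (use local arr_singleton in auto)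

lemma indecomposable_singleton: "x \<in> \<X> \<Longrightarrow> indecomposable F [x]"
  using local_End_singleton F.indecomposable_of_local by simp

subsection \<open>Splitting off a coordinate\<close>

definition inj_head :: "nat \<Rightarrow> 'r mat" where
  "inj_head n = mat (Suc n) 1 (\<lambda>(i, j). if i = 0 then \<one> else \<zero>)"

definition proj_head :: "nat \<Rightarrow> 'r mat" where
  "proj_head n = mat 1 (Suc n) (\<lambda>(i, j). if j = 0 then \<one> else \<zero>)"

definition inj_tail :: "nat \<Rightarrow> 'r mat" where
  "inj_tail n = mat (Suc n) n (\<lambda>(i, j). if i = Suc j then \<one> else \<zero>)"

definition proj_tail :: "nat \<Rightarrow> 'r mat" where
  "proj_tail n = mat n (Suc n) (\<lambda>(i, j). if j = Suc i then \<one> else \<zero>)"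

lemma biproduct_Cons:
  assumes X: "set (x # xs) \<subseteq> \<X>"
  shows "F.biproduct (x # xs) [x] xs (inj_head (length xs)) (proj_head (length xs))
    (inj_tail (length xs)) (proj_tail (length xs))"
  unfolding F.biproduct_def
proof (intro conjI)
  let ?n = "length xs"
  note d = inj_head_def proj_head_def inj_tail_def proj_tail_def
  have nth: "i < ?n \<Longrightarrow> xs ! i \<in> \<X>" for i using X by auto
  have nth': "i < Suc ?n \<Longrightarrow> (x # xs) ! i \<in> \<X>" for i using X by (metis length_Cons nth_mem subsetD)
  show "arr F [x] (x # xs) (inj_head ?n)" "arr F (x # xs) [x] (proj_head ?n)"
      "arr F xs (x # xs) (inj_tail ?n)" "arr F (x # xs) xs (proj_tail ?n)"
    using X by (auto simp: arr_F_iff d)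
  have "(\<Oplus>j\<in>{..<Suc ?n}. u [^] c x ((x # xs) ! j) x \<otimes>
      (proj_head ?n $$ (0, j) \<otimes> inj_head ?n $$ (j, 0))) = \<one>"
    using X by (subst finsum_single[of _ 0]) (auto simp: d)
  then show "Cmp F [x] (x # xs) [x] (proj_head ?n) (inj_head ?n) = Idn F [x]"
    by (auto simp: Cmp_F Idn_F intro!: eq_matI)
  have "(\<Oplus>k\<in>{..<Suc ?n}. u [^] c (xs ! j) ((x # xs) ! k) (xs ! i) \<otimes>
      (proj_tail ?n $$ (i, k) \<otimes> inj_tail ?n $$ (k, j))) = (if i = j then \<one> else \<zero>)"
    if "i < ?n" "j < ?n" for i j
    using that nth by (subst finsum_single[of _ "Suc i"]) (auto simp: d)
  then show "Cmp F xs (x # xs) xs (proj_tail ?n) (inj_tail ?n) = Idn F xs"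
    by (auto simp: Cmp_F Idn_F intro!: eq_matI)
  have 1: "(\<Oplus>k\<in>{..<Suc 0}. u [^] c ((x # xs) ! j) ([x] ! k) ((x # xs) ! i) \<otimes>
      (inj_head ?n $$ (i, k) \<otimes> proj_head ?n $$ (k, j))) = (if i = 0 \<and> j = 0 then \<one> else \<zero>)"
    if "i < Suc ?n" "j < Suc ?n" for i j
    using that X by (subst finsum_single[of _ 0]) (auto simp: d)
  have 2: "(\<Oplus>k\<in>{..<?n}. u [^] c ((x # xs) ! j) (xs ! k) ((x # xs) ! i) \<otimes>
      (inj_tail ?n $$ (i, k) \<otimes> proj_tail ?n $$ (k, j))) = (if i = j \<and> i \<noteq> 0 then \<one> else \<zero>)"
    if "i < Suc ?n" "j < Suc ?n" for i j
  proof (cases i)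
    case 0
    then show ?thesis using that by (simp add: d) (intro add.finprod_one_eqI, auto)
  next
    case (Suc k)
    then show ?thesis using that nth nth'[of j] by (subst finsum_single[of _ k]) (auto simp: d)
  qed
  show "Cmp F (x # xs) [x] (x # xs) (inj_head ?n) (proj_head ?n) \<oplus>\<^bsub>Hom F (x # xs) (x # xs)\<^esub>
      Cmp F (x # xs) xs (x # xs) (inj_tail ?n) (proj_tail ?n) = Idn F (x # xs)"
    by (rule eq_matI) (auto simp: Cmp_F Idn_F add_F 1 2)
qed

lemma Idn_Nil: "Idn F [] = \<zero>\<^bsub>Hom F [] []\<^esub>"
  by (auto simp: Idn_F zero_F)

lemma zero_object_Nil: "zero_object F []"
  by (simp add: F.zero_object_iff Idn_Nil)

lemma not_zero_singleton: "x \<in> \<X> \<Longrightarrow> \<not> zero_object F [x]"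
  using indecomposable_singleton by (simp add: indecomposable_def)

text \<open>In \<open>1 = g f = \<Sum> g\<^sub>j f\<^sub>j\<close> some summand is a unit of the local ring \<open>End w\<close>, so that the
  corresponding coordinate of \<open>X\<close> is isomorphic to \<open>w\<close> and may be exchanged for it.\<close>

lemma retract_complement_singleton:
  assumes "arr F [w] X f" "arr F X [w] g" "Cmp F [w] X [w] g f = Idn F [w]"
  shows "\<exists>V i p. F.biproduct X [w] V f g i p \<and> length X = Suc (length V)"
  using assms
proof (induction X arbitrary: f g)
  case Nil
  have w: "w \<in> \<X>" using F.arr_Ob[OF Nil(1)] by simp
  have "f = \<zero>\<^bsub>Hom F [w] []\<^esub>" using F.zero_object_to[OF zero_object_Nil Nil(1)] .
  then have "Idn F [w] = \<zero>\<^bsub>Hom F [w] [w]\<^esub>" using Nil w by (metis F.Cmp_zero_right F.arr_Ob)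
  then show ?case using not_zero_singleton[OF w] w by (simp add: F.zero_object_iff)
next
  case (Cons a X)
  have o: "w \<in> \<X>" "a \<in> \<X>" "set X \<subseteq> \<X>" using F.arr_Ob[OF Cons(2)] by auto
  obtain i1 p1 i2 p2 where b: "F.biproduct (a # X) [a] X i1 p1 i2 p2"
    using biproduct_Cons[of a X] o by auto
  note bD = F.biproductD[OF b]
  note fg [simp] = Cons.prems(1,2) bD(1-4)
  let ?s = "Cmp F [a] (a # X) [w] g i1" and ?r = "Cmp F [w] (a # X) [a] p1 f"
  let ?v = "Cmp F [w] X [w] (Cmp F X (a # X) [w] g i2) (Cmp F [w] (a # X) X p2 f)"
  obtain s r where s: "?s = scalar s" "s \<in> carrier R" and r: "?r = scalar r" "r \<in> carrier R"
    using arr_singleton[of a w ?s] arr_singleton[of w a ?r] by auto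
  obtain v where v: "?v = scalar v" "v \<in> carrier R" using arr_singleton[of w w ?v] by auto
  have "Cmp F [w] [a] [w] ?s ?r \<oplus>\<^bsub>Hom F [w] [w]\<^esub> ?v = Cmp F [w] (a # X) [w] g
      (Cmp F [w] (a # X) (a # X) (Cmp F (a # X) [a] (a # X) i1 p1 \<oplus>\<^bsub>Hom F (a # X) (a # X)\<^esub> Cmp F (a #
          X) X (a # X) i2 p2) f)"
    by (simp add: F.Cmp_bilinear F.Cmp_assoc')
  also have "\<dots> = Idn F [w]" using bD(9) Cons.prems by simp
  finally have "u [^] c w a w \<otimes> (s \<otimes> r) \<oplus> v = \<one>"
    unfolding s r v using s r by (simp add: Cmp_scalar add_scalar Idn_scalar)
  then have "u [^] c w a w \<otimes> (s \<otimes> r) \<in> Units R \<or> v \<in> Units R"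
    using Units_add s r v by simp
  then show ?case
  proof
    assume "u [^] c w a w \<otimes> (s \<otimes> r) \<in> Units R"
    then have "s \<in> Units R" "c a w a = 0"
      using s r o c_sym[of a w] by (simp_all add: Units_mult_iff u_pow_Unit_iff)
    then have "iso_arr F [a] [w] ?s" using s o by (simp add: iso_scalar_iff)
    then obtain j q where "F.biproduct (a # X) [w] X f g j q"
      using F.biproduct_exchange[OF b Cons.prems] by blast
    then show ?case by fastforce
  next
    assume vU: "v \<in> Units R"
    let ?f = "Cmp F [w] [w] X (Cmp F [w] (a # X) X p2 f) (scalar (inv v))" and ?g = "Cmp F X (a # X)
        [w] g i2"
    have [simp]: "inv v \<in> carrier R" "w \<in> \<X>" using vU o by auto
    have "Cmp F [w] X [w] ?g ?f = Cmp F [w] [w] [w] ?v (scalar (inv v))"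
      by (rule F.Cmp_assoc) (use vU o in simp_all)
    also have "\<dots> = Idn F [w]" unfolding v(1) using vU v(2) o by (simp add: Cmp_scalar Idn_scalar)
    finally have gf: "Cmp F [w] X [w] ?g ?f = Idn F [w]" .
    then obtain V i p where V: "F.biproduct X [w] V ?f ?g i p" and l: "length X = Suc (length V)"
      using Cons.IH[of ?f ?g] by auto
    have "set (a # V) \<subseteq> \<X>" using F.biproduct_Ob[OF V] o by auto
    then obtain k r l' t where Y: "F.biproduct (a # V) [a] V k r l' t" using biproduct_Cons[of a V]
        by blast
    obtain j q where B: "F.biproduct (a # X) [w] (a # V) (Cmp F [w] X (a # X) i2 ?f) (Cmp F (a # X)
        X [w] ?g p2) j q"
      using F.biproduct_assoc[OF b V Y] by blast
    have "Cmp F [w] (a # X) [w] g (Cmp F [w] X (a # X) i2 ?f) = Idn F [w]"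
      using gf by (simp add: F.Cmp_assoc')
    then have "iso_arr F [w] [w] (Cmp F [w] (a # X) [w] g (Cmp F [w] X (a # X) i2 ?f))"
      using F.iso_arr_Idn[of "[w]"] o by simp
    then obtain j' q' where "F.biproduct (a # X) [w] (a # V) f g j' q'"
      using F.biproduct_exchange[OF B Cons.prems] by blast
    then show ?case using l by fastforce
  qed
qed

text \<open>Peeling off the summands of \<open>W\<close> one at a time.\<close>

lemma retract_complement:
  assumes "arr F W X f" "arr F X W g" "Cmp F W X W g f = Idn F W"
  shows "\<exists>V i p. F.biproduct X W V f g i p \<and> length X = length W + length V"
  using assms
proof (induction W arbitrary: X f g)
  case Nil
  have X: "set X \<subseteq> \<X>" using F.arr_Ob[OF Nil(1)] by simp
  have "f = \<zero>\<^bsub>Hom F [] X\<^esub>" using F.zero_object_from[OF zero_object_Nil Nil(1)] .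
  then have "F.biproduct X [] X f g (Idn F X) (Idn F X)"
    unfolding F.biproduct_def using Nil X by simp
  then show ?case by auto
next
  case (Cons w W)
  have o: "w \<in> \<X>" "set W \<subseteq> \<X>" using F.arr_Ob[OF Cons(2)] by auto
  obtain i p j q where b: "F.biproduct (w # W) [w] W i p j q" using biproduct_Cons[of w W] o by auto
  note bD = F.biproductD[OF b] F.biproductD_reassoc[OF b]
  note fg [simp] = Cons.prems(1,2) bD(1-4)
  note gf = Cons.prems(3)
  let ?f1 = "Cmp F [w] (w # W) X f i" and ?g1 = "Cmp F X (w # W) [w] p g"
  have "Cmp F [w] X [w] ?g1 ?f1 = Idn F [w]" using bD by (simp add: F.Cmp_assoc' F.Cmp_reassoc[OF
      gf])
  then obtain V k r where V: "F.biproduct X [w] V ?f1 ?g1 k r" and l: "length X = Suc (length V)"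
    using retract_complement_singleton[of w X ?f1 ?g1] by auto
  note vD = F.biproductD[OF V]
  note [simp] = vD(3,4)
  let ?f2 = "Cmp F W X V r (Cmp F W (w # W) X f j)" and ?g2 = "Cmp F V (w # W) W q (Cmp F V X (w #
      W) g k)"
  have "Cmp F W (w # W) X f j = Cmp F W X X (Cmp F X [w] X ?f1 ?g1 \<oplus>\<^bsub>Hom F X X\<^esub> Cmp F X V X k r) (Cmp
      F W (w # W) X f j)"
    using vD(9) by simp
  also have "\<dots> = Cmp F W V X k ?f2"
    using bD o by (simp add: F.Cmp_bilinear F.Cmp_assoc' F.Cmp_reassoc[OF gf])
  finally have kf: "Cmp F W V X k ?f2 = Cmp F W (w # W) X f j" by simp
  have "Cmp F W V W ?g2 ?f2 = Cmp F W (w # W) W q (Cmp F W X (w # W) g (Cmp F W V X k ?f2))"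
    by (simp add: F.Cmp_assoc')
  also have "\<dots> = Idn F W" unfolding kf using bD o by (simp add: F.Cmp_reassoc[OF gf])
  finally obtain V' l s where V': "F.biproduct V W V' ?f2 ?g2 l s" and l': "length V = length W +
      length V'"
    using Cons.IH[of V ?f2 ?g2] by auto
  have "F.biproduct X (w # W) V' f g (Cmp F V' V X k l) (Cmp F X V V' s r)"
    by (rule F.biproduct_iterate[OF b Cons.prems V V'])
  then show ?case using l l' by auto
qed

end

section \<open>Decomposition of the objects with an involution\<close>

locale involutive_cyclic_poset = local_cyclic_poset R u \<X> c
  for R :: "('r, 'k) ring_scheme" (structure) and u :: 'r and \<X> :: "'x set"
    and c :: "'x \<Rightarrow> 'x \<Rightarrow> 'x \<Rightarrow> nat" +
  fixes \<psi> :: "'x \<Rightarrow> 'x"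
  assumes \<psi>_closed [simp]: "x \<in> \<X> \<Longrightarrow> \<psi> x \<in> \<X>" and \<psi>_\<psi> [simp]: "x \<in> \<X> \<Longrightarrow> \<psi> (\<psi> x) = x"
    and c_\<psi>: "\<lbrakk>x \<in> \<X>; y \<in> \<X>; z \<in> \<X>\<rbrakk> \<Longrightarrow> c (\<psi> x) (\<psi> y) (\<psi> z) = c x y z"
    and two: "\<one> \<oplus> \<one> \<in> Units R"
begin

lemma Hom_map: "Hom F (map \<psi> A) (map \<psi> B) = Hom F A B"
  by (simp add: add_cat_def P_cat_def)

text \<open>The action of \<open>\<psi>\<close> leaves matrices unchanged, and it is a functor because \<open>c\<close> is invariant.\<close>

lemma Cmp_map:
  assumes M: "arr F A B M" and N: "arr F B D N"
  shows "Cmp F (map \<psi> A) (map \<psi> B) (map \<psi> D) N M = Cmp F A B D N M"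
proof (rule eq_matI)
  fix i k assume "i < dim_row (Cmp F A B D N M)" "k < dim_col (Cmp F A B D N M)"
  then have i: "i < length D" and k: "k < length A" by (simp_all add: Cmp_F)
  have s: "set A \<subseteq> \<X>" "set B \<subseteq> \<X>" "set D \<subseteq> \<X>" using F.arr_Ob[OF M] F.arr_Ob[OF N] by auto
  have n: "\<And>j. j < length B \<Longrightarrow> N $$ (i, j) \<in> carrier R" "\<And>j. j < length B \<Longrightarrow> M $$ (j, k) \<in> carrier R"
    using M N i k by (auto simp: arr_F_iff)
  have "(\<Oplus>j\<in>{..<length B}. u [^] c (map \<psi> A ! k) (map \<psi> B ! j) (map \<psi> D ! i) \<otimes> (N $$ (i, j) \<otimes> M $$
      (j, k)))
      = (\<Oplus>j\<in>{..<length B}. u [^] c (A ! k) (B ! j) (D ! i) \<otimes> (N $$ (i, j) \<otimes> M $$ (j, k)))"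
  proof (rule finsum_cong')
    fix j assume j: "j \<in> {..<length B}"
    then have "A ! k \<in> \<X>" "B ! j \<in> \<X>" "D ! i \<in> \<X>" using s i k nth_mem by (blast, auto)
    then show "u [^] c (map \<psi> A ! k) (map \<psi> B ! j) (map \<psi> D ! i) \<otimes> (N $$ (i, j) \<otimes> M $$ (j, k)) =
        u [^] c (A ! k) (B ! j) (D ! i) \<otimes> (N $$ (i, j) \<otimes> M $$ (j, k))"
      using i j k by (simp add: c_\<psi>)
  qed (use n in auto)
  then show "Cmp F (map \<psi> A) (map \<psi> B) (map \<psi> D) N M $$ (i, k) = Cmp F A B D N M $$ (i, k)"
    using i k by (simp add: Cmp_F)
qed (simp_all add: Cmp_F)

lemma map_\<psi>_\<psi> [simp]: "set A \<subseteq> \<X> \<Longrightarrow> map (\<psi> \<circ> \<psi>) A = A"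
  by (induction A) auto

sublocale T: involutive_additive_category R F "map \<psi>" "\<lambda>A B M. M"
proof (intro involutive_additive_category.intro involutive_category.intro
    involutive_category_axioms.intro
    F.linear_category_axioms F.additive_category_axioms, goal_cases)
  case (1 X) then show ?case by auto
next
  case (2 X) then show ?case by simp
next
  case (3 X Y f) then show ?case by (auto simp: arr_F_iff)
next
  case (5 X Y f g) then show ?case by (simp only: Hom_map)
next
  case (6 r X Y f) then show ?case by (simp only: Hom_map)
next
  case (7 X Y f Z g) then show ?case using Cmp_map by simp
next
  case (8 X) then show ?case by (simp add: Idn_F)
qed auto

abbreviation D where "D \<equiv> F_psi R u \<X> c \<psi>"

text \<open>Composing \<open>g\<close> with the inverse of \<open>g f\<close> turns it into a retraction of \<open>f\<close>, whose complement
  inherits an equivariant structure.\<close>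

lemma split_off:
  assumes f: "arr D (W, \<omega>) (X, \<xi>) f" and g: "arr D (X, \<xi>) (W, \<omega>) g"
    and iso: "iso_arr F W W (Cmp F W X W g f)"
  shows "\<exists>V \<eta> f g i p. T.D.biproduct (X, \<xi>) (W, \<omega>) (V, \<eta>) f g i p \<and> length X = length W + length V"
proof -
  have "iso_arr D (W, \<omega>) (W, \<omega>) (Cmp F W X W g f)"
    using T.arr_D_Cmp[OF f g] iso by (simp add: T.iso_arr_D_iff)
  then obtain h where h: "arr D (W, \<omega>) (W, \<omega>) h" "Cmp F W W W h (Cmp F W X W g f) = Idn F W"
    unfolding iso_arr_def by (metis T.D_simps(1,2))
  let ?g = "Cmp F X W W h g"
  have g': "arr D (X, \<xi>) (W, \<omega>) ?g" using T.arr_D_Cmp[OF g h(1)] .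
  have "Cmp F W X W ?g f = Idn F W"
    using h(2) F.Cmp_assoc[OF T.arr_D_C[OF f] T.arr_D_C[OF g] T.arr_D_C[OF h(1)]] by (simp only:)
  then obtain V i p where V: "F.biproduct X W V f ?g i p" "length X = length W + length V"
    using retract_complement[OF T.arr_D_C[OF f] T.arr_D_C[OF g']] by blast
  obtain \<eta> where "T.D.biproduct (X, \<xi>) (W, \<omega>) (V, \<eta>) f ?g i p"
    using T.equivariant_complement[OF f g' V(1)] .
  then show ?thesis using V(2) by blast
qed

subsection \<open>The singular case\<close>

lemma sign_square: "\<epsilon> = \<one> \<or> \<epsilon> = \<ominus> \<one> \<Longrightarrow> \<epsilon> \<in> carrier R \<and> \<epsilon> \<otimes> \<epsilon> = \<one>"
  by (auto simp: l_minus)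

lemma singular_Ob:
  assumes "y \<in> \<X>" "c y (\<psi> y) y = 0" "\<epsilon> = \<one> \<or> \<epsilon> = \<ominus> \<one>"
  shows "([y], scalar \<epsilon>) \<in> Ob D"
  using assms sign_square[OF assms(3)] by (simp add: T.Ob_D_iff Cmp_scalar Idn_scalar)

lemma singular_local_End:
  assumes "y \<in> \<X>" "c y (\<psi> y) y = 0" "\<epsilon> = \<one> \<or> \<epsilon> = \<ominus> \<one>"
  shows "local_ring (End_ring D ([y], scalar \<epsilon>))"
proof (rule T.D.local_End_ring_of_hom[where \<phi> = "\<lambda>M. M $$ (0, 0)"])
  show "([y], scalar \<epsilon>) \<in> Ob D" using singular_Ob[OF assms] .
  fix f assume f: "arr D ([y], scalar \<epsilon>) ([y], scalar \<epsilon>) f"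
  then have fF: "arr F [y] [y] f" by (rule T.arr_D_C)
  then show "f $$ (0, 0) \<in> carrier R" using arr_singleton by blast
  show "iso_arr D ([y], scalar \<epsilon>) ([y], scalar \<epsilon>) f \<longleftrightarrow> f $$ (0, 0) \<in> Units R"
    using iso_scalar_iff[of y y "f $$ (0, 0)"] arr_singleton[OF fF] f assms(1) by (simp add:
        T.iso_arr_D_iff)
qed (simp_all add: local add_F)

text \<open>For a sign \<open>\<epsilon>\<close>, the symmetrizations of the inclusion \<open>e\<close> and the projection \<open>p\<close> of the first
  summand are equivariant maps between \<open>(x, \<epsilon> \<zeta>)\<close> and \<open>X\<close>. Their composite is \<open>2(1 + \<epsilon> \<alpha>)\<close>, where
  \<open>p \<circ> \<xi> \<circ> \<psi>e = \<alpha> \<zeta>\<close>. Since \<open>(1 + \<alpha>) + (1 - \<alpha>) = 2\<close> is a unit, \<open>1 + \<epsilon> \<alpha>\<close> is a unit for one of the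
  two signs.\<close>

lemma singular_split:
  assumes X: "(x # xs, \<xi>) \<in> Ob D" and s: "c x (\<psi> x) x = 0"
  shows "\<exists>\<epsilon> V \<eta> f g i p. (\<epsilon> = \<one> \<or> \<epsilon> = \<ominus> \<one>) \<and>
    T.D.biproduct (x # xs, \<xi>) ([x], scalar \<epsilon>) (V, \<eta>) f g i p \<and> length (x # xs) = Suc (length V)"
proof -
  let ?X = "x # xs"
  note o = T.Ob_DD[OF X]
  have x [simp]: "x \<in> \<X>" "set xs \<subseteq> \<X>" and \<xi> [simp]: "arr F (map \<psi> ?X) ?X \<xi>" using o by auto
  obtain e p j q where b: "F.biproduct ?X [x] xs e p j q" using biproduct_Cons[of x xs] by auto
  note bD [simp] = F.biproductD(1-5)[OF b]
  have Te [simp]: "arr F [\<psi> x] (map \<psi> ?X) e" using T.Tm_arr[OF bD(1)] by simp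
  let ?a = "Cmp F [\<psi> x] ?X [x] p (Cmp F [\<psi> x] (map \<psi> ?X) ?X \<xi> e)"
  have "arr F [\<psi> x] [x] ?a" using \<xi> Te by (intro F.Cmp_arr[of "[\<psi> x]" ?X]) simp_all
  then obtain \<alpha> where \<alpha>: "?a = scalar \<alpha>" "\<alpha> \<in> carrier R" using arr_singleton by blast
  have "(\<one> \<oplus> \<alpha> \<otimes> \<one>) \<oplus> (\<one> \<oplus> \<alpha> \<otimes> \<ominus> \<one>) = \<one> \<oplus> \<one>" using \<alpha>(2) by algebra
  then have "\<one> \<oplus> \<alpha> \<otimes> \<one> \<in> Units R \<or> \<one> \<oplus> \<alpha> \<otimes> \<ominus> \<one> \<in> Units R"
    using Units_add[of "\<one> \<oplus> \<alpha> \<otimes> \<one>" "\<one> \<oplus> \<alpha> \<otimes> \<ominus> \<one>"] two \<alpha>(2) by auto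
  then obtain \<epsilon> where \<epsilon>: "\<epsilon> = \<one> \<or> \<epsilon> = \<ominus> \<one>" and k: "\<one> \<oplus> \<alpha> \<otimes> \<epsilon> \<in> Units R" by blast
  have \<epsilon>s: "\<epsilon> \<in> carrier R" "\<epsilon> \<otimes> \<epsilon> = \<one>" using sign_square[OF \<epsilon>] by auto
  note Z = singular_Ob[OF x(1) s \<epsilon>]
  let ?\<zeta> = "scalar \<epsilon>"
  let ?t = "T.twist [x] ?\<zeta> ?X \<xi> e" and ?k = "\<one> \<oplus> \<alpha> \<otimes> \<epsilon>"
  let ?f = "e \<oplus>\<^bsub>Hom F [x] ?X\<^esub> ?t" and ?g = "p \<oplus>\<^bsub>Hom F ?X [x]\<^esub> T.twist ?X \<xi> [x] ?\<zeta> p"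
  have t [simp]: "arr F [x] ?X ?t" using Z X by simp
  have tp [simp]: "arr F ?X [x] (T.twist ?X \<xi> [x] ?\<zeta> p)" using Z X by simp
  have f: "arr D ([x], ?\<zeta>) (?X, \<xi>) ?f" and g: "arr D (?X, \<xi>) ([x], ?\<zeta>) ?g"
    using Z X by (simp_all add: T.arr_D_twist T.twist_add F.hom_comm)
  have "Cmp F [x] ?X [x] p ?t = Cmp F [x] [\<psi> x] [x] ?a ?\<zeta>"
    using x \<epsilon>s \<xi> Te
      F.Cmp_assoc[of "[x]" "[\<psi> x]" ?\<zeta> "map \<psi> ?X" e ?X \<xi>]
      F.Cmp_assoc[of "[x]" "[\<psi> x]" ?\<zeta> ?X "Cmp F [\<psi> x] (map \<psi> ?X) ?X \<xi> e" "[x]" p]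
    by (simp add: T.twist_def)
  then have pt: "Cmp F [x] ?X [x] p ?t = scalar (\<alpha> \<otimes> \<epsilon>)"
    unfolding \<alpha>(1) using \<alpha>(2) \<epsilon>s s by (simp add: Cmp_scalar)
  have pf: "Cmp F [x] ?X [x] p ?f = scalar ?k"
    by (simp add: F.Cmp_bilinear pt Idn_scalar add_scalar)
  have "Cmp F [x] ?X [x] (T.twist ?X \<xi> [x] ?\<zeta> p) ?f = T.twist [x] ?\<zeta> [x] ?\<zeta> (scalar ?k)"
    using T.twist_Cmp[OF Z X Z T.arr_D_C[OF f] bD(2)] f unfolding pf by (simp add: T.arr_D_twist)
  also have "\<dots> = scalar ?k"
  proof -
    have "c x x (\<psi> x) = 0" using x by simp
    moreover have "\<epsilon> \<otimes> (?k \<otimes> \<epsilon>) = (\<epsilon> \<otimes> \<epsilon>) \<otimes> ?k" using \<epsilon>s(1) \<alpha>(2) by algebra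
    ultimately show ?thesis
      using \<epsilon>s \<alpha>(2) s x by (simp add: T.twist_def Cmp_scalar)
  qed
  finally have "Cmp F [x] ?X [x] ?g ?f = scalar (?k \<oplus> ?k)"
    using T.arr_D_C[OF f] by (simp add: F.Cmp_add_left pf add_scalar)
  moreover have "?k \<oplus> ?k = (\<one> \<oplus> \<one>) \<otimes> ?k" using \<alpha>(2) \<epsilon>s(1) by algebra
  then have "?k \<oplus> ?k \<in> Units R" using two k by simp
  ultimately have "iso_arr F [x] [x] (Cmp F [x] ?X [x] ?g ?f)"
    using \<alpha>(2) \<epsilon>s(1) by (simp add: iso_scalar_iff)
  then show ?thesis using split_off[OF f g] \<epsilon> by fastforce
qed

subsection \<open>The regular case\<close>

abbreviation S where "S \<equiv> mat 2 2 (\<lambda>(i, j). if i = j then \<zero> else \<one>)"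

lemma finsum_lessThan_2:
  "\<lbrakk>f 0 \<in> carrier R; f (Suc 0) \<in> carrier R\<rbrakk> \<Longrightarrow> finsum R f {..<Suc (Suc 0)} = f 0 \<oplus> f (Suc 0)"
  by (simp add: lessThan_Suc a_comm)

text \<open>This identifies \<open>Sx\<close> with the free object on \<open>x\<close>.\<close>

lemma regular_swap:
  assumes x: "x \<in> \<X>"
  shows "T.swap [x, \<psi> x] [x] (inj_head (Suc 0)) (proj_head (Suc 0)) (inj_tail (Suc 0)) (proj_tail
      (Suc 0)) = S"
proof (rule eq_matI)
  fix i j assume "i < dim_row S" "j < dim_col S"
  then have "i = 0 \<or> i = Suc 0" "j = 0 \<or> j = Suc 0" by auto
  then show "T.swap [x, \<psi> x] [x] (inj_head (Suc 0)) (proj_head (Suc 0)) (inj_tail (Suc 0))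
      (proj_tail (Suc 0)) $$ (i, j) = S $$ (i, j)"
    using x
    by (auto simp: T.swap_def add_F Cmp_F lessThan_Suc inj_head_def proj_head_def inj_tail_def
        proj_tail_def)
qed (simp_all add: T.swap_def add_F)

lemma regular_biproduct: "x \<in> \<X> \<Longrightarrow> F.biproduct [x, \<psi> x] [x] (map \<psi> [x])
    (inj_head (Suc 0)) (proj_head (Suc 0)) (inj_tail (Suc 0)) (proj_tail (Suc 0))"
  using biproduct_Cons[of x "[\<psi> x]"] by simp

lemma regular_Ob: "x \<in> \<X> \<Longrightarrow> ([x, \<psi> x], S) \<in> Ob D"
  using T.free_object(1)[OF regular_biproduct] by (simp add: regular_swap)

text \<open>The endomorphisms of \<open>SX\<close> are the matrices with rows \<open>(a, b)\<close> and \<open>(b, a)\<close>. They form the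
  ring obtained from \<open>R\<close> by adjoining a square root of \<open>u\<close> to the power \<open>c(X, \<psi>X, X) > 0\<close>, where
  \<open>a + b \<surd>u\<^sup>c\<close> is a unit if and only if \<open>a\<close> is.\<close>

lemma regular_End:
  assumes x: "x \<in> \<X>" and M: "arr D ([x, \<psi> x], S) ([x, \<psi> x], S) M"
  shows "M $$ (Suc 0, Suc 0) = M $$ (0, 0)" "M $$ (0, Suc 0) = M $$ (Suc 0, 0)"
proof -
  let ?Y = "[x, \<psi> x]"
  have m: "M $$ (0, 0) \<in> carrier R" "M $$ (0, Suc 0) \<in> carrier R" "M $$ (Suc 0, 0) \<in> carrier R"
    "M $$ (Suc 0, Suc 0) \<in> carrier R"
    using T.arr_D_C[OF M] by (auto simp: arr_F_iff)
  have e: "Cmp F (map \<psi> ?Y) ?Y ?Y M S = Cmp F (map \<psi> ?Y) (map \<psi> ?Y) ?Y S M"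
    using M by (simp only: T.arr_D_iff)
  show "M $$ (Suc 0, Suc 0) = M $$ (0, 0)"
    using arg_cong[OF e, of "\<lambda>A. A $$ (Suc 0, 0)"] x m by (simp add: Cmp_F finsum_lessThan_2)
  show "M $$ (0, Suc 0) = M $$ (Suc 0, 0)"
    using arg_cong[OF e, of "\<lambda>A. A $$ (0, 0)"] x m by (simp add: Cmp_F finsum_lessThan_2)
qed

text \<open>Since \<open>w = u\<^sup>c\<close> is not a unit, the norm \<open>a\<^sup>2 - w b\<^sup>2\<close> of \<open>a + b \<surd>w\<close> is a unit if and only if
  \<open>a\<close> is. The inverse is the conjugate \<open>a - b \<surd>w\<close> divided by the norm.\<close>

lemma regular_iso_iff:
  assumes x: "x \<in> \<X>" and r: "c x (\<psi> x) x \<noteq> 0" and M: "arr D ([x, \<psi> x], S) ([x, \<psi> x], S) M"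
  shows "iso_arr F [x, \<psi> x] [x, \<psi> x] M \<longleftrightarrow> M $$ (0, 0) \<in> Units R"
proof
  let ?Y = "[x, \<psi> x]"
  have m: "M $$ (0, 0) \<in> carrier R" "M $$ (Suc 0, 0) \<in> carrier R"
    using T.arr_D_C[OF M] by (auto simp: arr_F_iff)
  assume "iso_arr F ?Y ?Y M"
  then obtain N where N: "arr F ?Y ?Y N" "Cmp F ?Y ?Y ?Y N M = Idn F ?Y"
    unfolding iso_arr_def by blast
  have n: "N $$ (0, 0) \<in> carrier R" "N $$ (0, Suc 0) \<in> carrier R" using N(1) by (auto simp:
      arr_F_iff)
  have "N $$ (0, 0) \<otimes> M $$ (0, 0) \<oplus> u [^] c x (\<psi> x) x \<otimes> (N $$ (0, Suc 0) \<otimes> M $$ (Suc 0, 0)) = \<one>"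
    using arg_cong[OF N(2), of "\<lambda>A. A $$ (0, 0)"] x m n by (simp add: Cmp_F Idn_F finsum_lessThan_2)
  then have "N $$ (0, 0) \<otimes> M $$ (0, 0) \<in> Units R \<or>
      u [^] c x (\<psi> x) x \<otimes> (N $$ (0, Suc 0) \<otimes> M $$ (Suc 0, 0)) \<in> Units R"
    using m n by (intro Units_add) simp_all
  then show "M $$ (0, 0) \<in> Units R" using m n r by (simp add: Units_mult_iff u_pow_Unit_iff)
next
  let ?Y = "[x, \<psi> x]"
  assume aU: "M $$ (0, 0) \<in> Units R"
  obtain a b where ab: "M $$ (0, 0) = a" "M $$ (Suc 0, Suc 0) = a" "M $$ (0, Suc 0) = b" "M $$ (Suc
      0, 0) = b"
    using regular_End[OF x M] by metis
  have MF: "arr F ?Y ?Y M" using T.arr_D_C[OF M] .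
  have [simp]: "a \<in> carrier R" "b \<in> carrier R" using MF ab by (auto simp: arr_F_iff)
  define w where "w = u [^] c x (\<psi> x) x"
  have w [simp]: "w \<in> carrier R" "w \<notin> Units R" using r by (auto simp: w_def u_pow_Unit_iff)
  have cw: "u [^] c (\<psi> x) x (\<psi> x) = w" using c_sym[of x "\<psi> x"] x by (simp add: w_def)
  let ?d = "a \<otimes> a \<ominus> w \<otimes> (b \<otimes> b)"
  have "?d \<oplus> w \<otimes> (b \<otimes> b) = a \<otimes> a" using \<open>a \<in> carrier R\<close> \<open>b \<in> carrier R\<close> w(1) by algebra
  then have "?d \<oplus> w \<otimes> (b \<otimes> b) \<in> Units R" using aU ab by simp
  then have dU: "?d \<in> Units R" using Units_add[of ?d "w \<otimes> (b \<otimes> b)"] by (auto simp: Units_mult_iff)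
  define \<delta> where "\<delta> = inv ?d"
  have \<delta> [simp]: "\<delta> \<in> carrier R" and \<delta>d: "\<delta> \<otimes> ?d = \<one>" using dU by (auto simp: \<delta>_def)
  define N where "N = mat 2 2 (\<lambda>(i, j). if i = j then \<delta> \<otimes> a else \<ominus> (\<delta> \<otimes> b))"
  have n: "N $$ (0, 0) = \<delta> \<otimes> a" "N $$ (Suc 0, Suc 0) = \<delta> \<otimes> a" "N $$ (0, Suc 0) = \<ominus> (\<delta> \<otimes> b)"
    "N $$ (Suc 0, 0) = \<ominus> (\<delta> \<otimes> b)" by (simp_all add: N_def)
  have NF: "arr F ?Y ?Y N" using x by (auto simp: arr_F_iff N_def)
  note cl = \<open>a \<in> carrier R\<close> \<open>b \<in> carrier R\<close> w(1) \<delta>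
  have e1: "\<delta> \<otimes> a \<otimes> a \<oplus> w \<otimes> (\<ominus> (\<delta> \<otimes> b) \<otimes> b) = \<one>" "w \<otimes> (\<ominus> (\<delta> \<otimes> b) \<otimes> b) \<oplus> \<delta> \<otimes> a \<otimes> a = \<one>"
    "a \<otimes> (\<delta> \<otimes> a) \<oplus> w \<otimes> (b \<otimes> \<ominus> (\<delta> \<otimes> b)) = \<one>" "w \<otimes> (b \<otimes> \<ominus> (\<delta> \<otimes> b)) \<oplus> a \<otimes> (\<delta> \<otimes> a) = \<one>"
    unfolding \<delta>d[symmetric] using cl by algebra+
  have e2: "\<delta> \<otimes> a \<otimes> b \<oplus> \<ominus> (\<delta> \<otimes> b) \<otimes> a = \<zero>" "\<ominus> (\<delta> \<otimes> b) \<otimes> a \<oplus> \<delta> \<otimes> a \<otimes> b = \<zero>"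
    "a \<otimes> \<ominus> (\<delta> \<otimes> b) \<oplus> b \<otimes> (\<delta> \<otimes> a) = \<zero>" "b \<otimes> (\<delta> \<otimes> a) \<oplus> a \<otimes> \<ominus> (\<delta> \<otimes> b) = \<zero>"
    using cl by algebra+
  have "Cmp F ?Y ?Y ?Y N M = Idn F ?Y"
  proof (rule eq_matI)
    fix i j assume "i < dim_row (Idn F ?Y)" "j < dim_col (Idn F ?Y)"
    then have "i = 0 \<or> i = Suc 0" "j = 0 \<or> j = Suc 0" by (auto simp: Idn_F)
    then show "Cmp F ?Y ?Y ?Y N M $$ (i, j) = Idn F ?Y $$ (i, j)"
      using x e1 e2 by (elim disjE) (simp_all add: Cmp_F Idn_F finsum_lessThan_2 n ab cw
          w_def[symmetric])
  qed (simp_all add: Cmp_F Idn_F)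
  moreover have "Cmp F ?Y ?Y ?Y M N = Idn F ?Y"
  proof (rule eq_matI)
    fix i j assume "i < dim_row (Idn F ?Y)" "j < dim_col (Idn F ?Y)"
    then have "i = 0 \<or> i = Suc 0" "j = 0 \<or> j = Suc 0" by (auto simp: Idn_F)
    then show "Cmp F ?Y ?Y ?Y M N $$ (i, j) = Idn F ?Y $$ (i, j)"
      using x e1 e2 by (elim disjE) (simp_all add: Cmp_F Idn_F finsum_lessThan_2 n ab cw
          w_def[symmetric])
  qed (simp_all add: Cmp_F Idn_F)
  ultimately show "iso_arr F ?Y ?Y M" using MF NF by (rule F.iso_arrI[rotated 2])
qed

lemma regular_local_End:
  assumes "x \<in> \<X>" "c x (\<psi> x) x \<noteq> 0"
  shows "local_ring (End_ring D ([x, \<psi> x], S))"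
proof (rule T.D.local_End_ring_of_hom[where \<phi> = "\<lambda>M. M $$ (0, 0)"])
  show "([x, \<psi> x], S) \<in> Ob D" using regular_Ob[OF assms(1)] .
  fix f assume f: "arr D ([x, \<psi> x], S) ([x, \<psi> x], S) f"
  then have "arr F [x, \<psi> x] [x, \<psi> x] f" by (rule T.arr_D_C)
  then show "f $$ (0, 0) \<in> carrier R" by (auto simp: arr_F_iff)
  show "iso_arr D ([x, \<psi> x], S) ([x, \<psi> x], S) f \<longleftrightarrow> f $$ (0, 0) \<in> Units R"
    using regular_iso_iff[OF assms f] f by (simp add: T.iso_arr_D_iff)
qed (simp_all add: local add_F)

lemma head_entry:
  assumes "arr F (x # xs) (y # ys) M"
  shows "Cmp F [x] (y # ys) [y] (proj_head (length ys)) (Cmp F [x] (x # xs) (y # ys) M (inj_head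
      (length xs)))
    = scalar (M $$ (0, 0))"
proof -
  have o: "x \<in> \<X>" "y \<in> \<X>" "set xs \<subseteq> \<X>" "set ys \<subseteq> \<X>" using F.arr_Ob[OF assms] by auto
  have m: "i < Suc (length ys) \<Longrightarrow> M $$ (i, 0) \<in> carrier R" for i using assms by (simp add: arr_F_iff)
  have nth: "i < Suc (length ys) \<Longrightarrow> (y # ys) ! i \<in> \<X>" for i using o by (cases i) auto
  have 1: "(\<Oplus>j\<in>{..<Suc (length xs)}. u [^] c x ((x # xs) ! j) ((y # ys) ! i) \<otimes> (M $$ (i, j) \<otimes>
      inj_head (length xs) $$ (j, 0)))
      = M $$ (i, 0)" if i: "i < Suc (length ys)" for i
  proof -
    have "M $$ (i, j) \<in> carrier R" if "j < Suc (length xs)" for j using assms i that by (simp add: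
        arr_F_iff)
    then show ?thesis
      using o nth[OF i] m[OF i] by (subst finsum_single[of _ 0]) (auto simp: inj_head_def)
  qed
  have "(\<Oplus>j\<in>{..<Suc (length ys)}. u [^] c x ((y # ys) ! j) y \<otimes> (proj_head (length ys) $$ (0, j) \<otimes> M
      $$ (j, 0))) = M $$ (0, 0)"
    using o m by (subst finsum_single[of _ 0]) (auto simp: proj_head_def)
  then have "(\<Oplus>j\<in>{..<Suc (length ys)}. u [^] c x ((y # ys) ! j) y \<otimes> (proj_head (length ys) $$ (0, j)
      \<otimes>
      Cmp F [x] (x # xs) (y # ys) M (inj_head (length xs)) $$ (j, 0))) = M $$ (0, 0)"
    using m o by (subst finsum_cong'[where g = "\<lambda>j. u [^] c x ((y # ys) ! j) y \<otimes> (proj_head (length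
        ys) $$ (0, j) \<otimes> M $$ (j, 0))"])
      (auto simp: Cmp_F 1 proj_head_def)
  then show ?thesis by (auto simp: Cmp_F[of "[x]" "y # ys"] scalar_def intro!: eq_matI)
qed

text \<open>The inclusion and the projection of the first summand induce equivariant maps \<open>Sx \<rightarrow> X \<rightarrow> Sx\<close>,
  as \<open>Sx\<close> is free on \<open>x\<close>. The upper left entry of their composite is \<open>p e = 1\<close>, so
  \<open>regular_iso_iff\<close> makes the composite invertible.\<close>

lemma regular_split:
  assumes X: "(x # xs, \<xi>) \<in> Ob D" and r: "c x (\<psi> x) x \<noteq> 0"
  shows "\<exists>V \<eta> f g i p. T.D.biproduct (x # xs, \<xi>) ([x, \<psi> x], S) (V, \<eta>) f g i p \<and>
    length (x # xs) = Suc (Suc (length V))"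
proof -
  let ?X = "x # xs" and ?Y = "[x, \<psi> x]"
  note o = T.Ob_DD[OF X]
  have x [simp]: "x \<in> \<X>" "set xs \<subseteq> \<X>" and \<xi> [simp]: "arr F (map \<psi> ?X) ?X \<xi>" using o by auto
  obtain e p j q where b: "F.biproduct ?X [x] xs e p j q" using biproduct_Cons[of x xs] by auto
  note bD [simp] = F.biproductD(1-5)[OF b]
  have xo: "[x] \<in> Ob F" by simp
  let ?i = "inj_head (Suc 0)" and ?p = "proj_head (Suc 0)" and ?k = "inj_tail (Suc 0)" and ?q =
      "proj_tail (Suc 0)"
  note y = regular_biproduct[OF x(1)]
  note yD = F.biproductD[OF y] F.biproductD_reassoc[OF y]
  let ?e = "Cmp F (map \<psi> [x]) (map \<psi> ?X) ?X \<xi> e" and ?m = "Cmp F ?X (map \<psi> ?X) (map \<psi> [x]) p \<xi>"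
  have ta: "arr F (map \<psi> [x]) (map \<psi> ?X) e" "arr F (map \<psi> ?X) (map \<psi> [x]) p"
    using T.Tm_arr[OF bD(1)] T.Tm_arr[OF bD(2)] by auto
  have \<xi>': "arr F ?X (map \<psi> ?X) \<xi>" using T.Tm_arr'(1)[OF \<xi> o(1)] .
  have e: "arr F (map \<psi> [x]) ?X ?e" and m: "arr F ?X (map \<psi> [x]) ?m"
    using F.Cmp_arr[OF ta(1) \<xi>] F.Cmp_arr[OF \<xi>' ta(2)] .
  obtain f g where f: "f = Cmp F ?Y [x] ?X e ?p \<oplus>\<^bsub>Hom F ?Y ?X\<^esub> Cmp F ?Y (map \<psi> [x]) ?X ?e ?q"
    and g: "g = Cmp F ?X [x] ?Y ?i p \<oplus>\<^bsub>Hom F ?X ?Y\<^esub> Cmp F ?X (map \<psi> [x]) ?Y ?k ?m" by blast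
  have fD: "arr D (?Y, S) (?X, \<xi>) f" and gD: "arr D (?X, \<xi>) (?Y, S) g"
    using T.free_object(2)[OF y xo X bD(1)] T.free_object(3)[OF y xo X bD(2)]
    unfolding f g regular_swap[OF x(1)] by auto
  have fF: "arr F ?Y ?X f" and gF: "arr F ?X ?Y g" using fD gD T.arr_D_C by blast+
  have fi: "Cmp F [x] ?Y ?X f ?i = e"
  proof -
    have "Cmp F [x] ?Y ?X f ?i = Cmp F [x] [x] ?X e (Cmp F [x] ?Y [x] ?p ?i) \<oplus>\<^bsub>Hom F [x] ?X\<^esub>
        Cmp F [x] (map \<psi> [x]) ?X ?e (Cmp F [x] ?Y (map \<psi> [x]) ?q ?i)"
      unfolding f
      using F.Cmp_add_left[OF yD(1) F.Cmp_arr[OF yD(2) bD(1)] F.Cmp_arr[OF yD(4) e]]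
        F.Cmp_assoc[OF yD(1,2) bD(1)] F.Cmp_assoc[OF yD(1,4) e] by (simp only:)
    then show ?thesis
      unfolding yD(5) yD(8) using F.Cmp_zero_right[OF xo e] F.Cmp_Idn_right[OF bD(1)]
        F.hom_r_zero[OF bD(1)] by (simp only:)
  qed
  have pg: "Cmp F ?X ?Y [x] ?p g = p"
  proof -
    have "Cmp F ?X ?Y [x] ?p g = Cmp F ?X [x] [x] (Cmp F [x] ?Y [x] ?p ?i) p \<oplus>\<^bsub>Hom F ?X [x]\<^esub>
        Cmp F ?X (map \<psi> [x]) [x] (Cmp F (map \<psi> [x]) ?Y [x] ?p ?k) ?m"
      unfolding g
      using F.Cmp_add_right[OF F.Cmp_arr[OF bD(2) yD(1)] F.Cmp_arr[OF m yD(3)] yD(2)]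
        F.Cmp_assoc[OF bD(2) yD(1,2)] F.Cmp_assoc[OF m yD(3,2)] by (simp only:)
    then show ?thesis
      unfolding yD(5) yD(7) using F.Cmp_zero_left[OF xo m] F.Cmp_Idn_left[OF bD(2)]
        F.hom_r_zero[OF bD(2)] by (simp only:)
  qed
  let ?M = "Cmp F ?Y ?X ?Y g f"
  have MD: "arr D (?Y, S) (?Y, S) ?M" using T.arr_D_Cmp[OF fD gD] .
  have "Cmp F [x] ?Y [x] ?p (Cmp F [x] ?Y ?Y ?M ?i) = Cmp F [x] ?X [x] (Cmp F ?X ?Y [x] ?p g) (Cmp F
      [x] ?Y ?X f ?i)"
    using F.Cmp_assoc'[OF yD(1) fF gF] F.Cmp_assoc[OF F.Cmp_arr[OF yD(1) fF] gF yD(2)] by (simp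
        only:)
  moreover have "Cmp F [x] ?Y [x] ?p (Cmp F [x] ?Y ?Y ?M ?i) = scalar (?M $$ (0, 0))"
    using head_entry[OF T.arr_D_C[OF MD]] by (simp only: list.size add_0)
  ultimately have "scalar (?M $$ (0, 0)) = Idn F [x]" unfolding fi pg bD(5) by (simp only:)
  then have "?M $$ (0, 0) = \<one>" by (simp add: Idn_scalar)
  then have "iso_arr F ?Y ?Y ?M" using regular_iso_iff[OF x(1) r MD] by simp
  then show ?thesis using split_off[OF fD gD] by fastforce
qed

subsection \<open>The Krull-Schmidt property\<close>

text \<open>The three families of the theorem, with regularity and singularity of \<open>x\<close> expressed by the
  exponent of \<open>u\<close> in the composite \<open>x \<rightarrow> \<psi>x \<rightarrow> x\<close>.\<close>

definition indecs :: "('x list \<times> 'r mat) set" where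
  "indecs = {([x, \<psi> x], S) |x. x \<in> \<X> \<and> c x (\<psi> x) x \<noteq> 0} \<union>
     {([y], scalar \<epsilon>) |y \<epsilon>. y \<in> \<X> \<and> c y (\<psi> y) y = 0 \<and> (\<epsilon> = \<one> \<or> \<epsilon> = \<ominus> \<one>)}"

lemma indecs_local:
  assumes "W \<in> indecs"
  shows "W \<in> Ob D" "local_ring (End_ring D W)"
  using assms regular_Ob regular_local_End singular_Ob singular_local_End unfolding indecs_def by
      blast+

lemma indecs_split:
  assumes X: "(X, \<xi>) \<in> Ob D" "X \<noteq> []"
  obtains W V \<eta> f g i p where "W \<in> indecs" "T.D.biproduct (X, \<xi>) W (V, \<eta>) f g i p" "length V <
      length X"
proof -
  obtain x xs where e: "X = x # xs" using X(2) by (cases X) auto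
  have x: "x \<in> \<X>" using T.Ob_DD(1)[OF X(1)] e by simp
  show ?thesis
  proof (cases "c x (\<psi> x) x = 0")
    case True
    obtain \<epsilon> V \<eta> f g i p where "\<epsilon> = \<one> \<or> \<epsilon> = \<ominus> \<one>" and
      *: "T.D.biproduct (X, \<xi>) ([x], scalar \<epsilon>) (V, \<eta>) f g i p" "length X = Suc (length V)"
      using singular_split[OF X(1)[unfolded e] True] unfolding e by blast
    then have "([x], scalar \<epsilon>) \<in> indecs" using x True unfolding indecs_def by blast
    then show ?thesis by (rule that[OF _ *(1)]) (use * in simp)
  next
    case False
    obtain V \<eta> f g i p where
      *: "T.D.biproduct (X, \<xi>) ([x, \<psi> x], S) (V, \<eta>) f g i p" "length X = Suc (Suc (length V))"
      using regular_split[OF X(1)[unfolded e] False] unfolding e by blast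
    have "([x, \<psi> x], S) \<in> indecs" using x False unfolding indecs_def by blast
    then show ?thesis by (rule that[OF _ *(1)]) (use * in simp)
  qed
qed

lemma zero_object_D_Nil: "([], \<xi>) \<in> Ob D \<Longrightarrow> zero_object D ([], \<xi>)"
  unfolding T.D.zero_object_iff T.D_simps using Idn_Nil by blast

lemma indecs_direct_sum: "(X, \<xi>) \<in> Ob D \<Longrightarrow> \<exists>As. direct_sum D (X, \<xi>) As \<and> set As \<subseteq> indecs"
proof (induction "length X" arbitrary: X \<xi> rule: less_induct)
  case less
  show ?case
  proof (cases "X = []")
    case True
    then show ?thesis using T.D.direct_sum_Nil[OF zero_object_D_Nil] less.prems
      by (intro exI[of _ "[]"]) simp
  next
    case False
    obtain W V \<eta> f g i p where W: "W \<in> indecs" and b: "T.D.biproduct (X, \<xi>) W (V, \<eta>) f g i p"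
      and l: "length V < length X" using indecs_split[OF less.prems False] .
    obtain As where "direct_sum D (V, \<eta>) As" "set As \<subseteq> indecs"
      using less.hyps[OF l] T.D.biproduct_Ob[OF b] by blast
    then show ?thesis using T.D.direct_sum_Cons[OF b] W by (intro exI[of _ "W # As"]) simp
  qed
qed

theorem krull_schmidt_D: "krull_schmidt_category R D"
proof (intro krull_schmidt_category.intro krull_schmidt_category_axioms.intro)
  show "additive_category R D" by (rule T.D.additive_category_axioms)
  fix X assume "X \<in> Ob D"
  then obtain As where "direct_sum D X As" "set As \<subseteq> indecs" using indecs_direct_sum by (cases X)
      blast
  then show "\<exists>As. direct_sum D X As \<and> (\<forall>A\<in>set As. local_ring (End_ring D A))"
    using indecs_local(2) by blast
qed

lemma indecs_indecomposable: "W \<in> indecs \<Longrightarrow> indecomposable D W"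
  using indecs_local T.D.indecomposable_of_local by blast

lemma indecomposable_isomorphic_indecs:
  assumes "indecomposable D A"
  shows "\<exists>B \<in> indecs. isomorphic D A B"
proof -
  obtain X \<xi> where A: "A = (X, \<xi>)" by fastforce
  have X: "(X, \<xi>) \<in> Ob D" "\<not> zero_object D (X, \<xi>)" using assms by (auto simp: A indecomposable_def)
  then have ne: "X \<noteq> []" using zero_object_D_Nil by blast
  obtain W V \<eta> f g i p where W: "W \<in> indecs" and b: "T.D.biproduct (X, \<xi>) W (V, \<eta>) f g i p"
      and "length V < length X"
    using indecs_split[OF X(1) ne] .
  have "direct_sum D A [W, (V, \<eta>)]" unfolding A T.D.direct_sum_two_iff using b by blast
  then have "zero_object D W \<or> zero_object D (V, \<eta>)" using assms unfolding indecomposable_def by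
      blast
  moreover have "\<not> zero_object D W" using indecs_indecomposable[OF W] by (simp add:
      indecomposable_def)
  ultimately show ?thesis using T.D.isomorphic_of_biproduct_zero[OF b] W A by blast
qed

lemma regular_iff: "x \<in> \<X> \<Longrightarrow> regular F \<psi> x \<longleftrightarrow> c x (\<psi> x) x \<noteq> 0"
  by (simp add: regular_def indecomposable_singleton isomorphic_singletons_iff)

lemma singular_iff: "x \<in> \<X> \<Longrightarrow> singular F \<psi> x \<longleftrightarrow> c x (\<psi> x) x = 0"
  by (simp add: singular_def indecomposable_singleton isomorphic_singletons_iff)

lemma Z_plus_eq: "Z_plus R y = ([y], scalar \<one>)"
  by (simp add: Z_plus_def zeta_def scalar_def)

lemma Z_minus_eq:
  assumes "y \<in> \<X>"
  shows "Z_minus R F \<psi> y = ([y], scalar (\<ominus> \<one>))"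
proof -
  have "scalar \<one> \<oplus>\<^bsub>Hom F [\<psi> y] [y]\<^esub> scalar (\<ominus> \<one>) = \<zero>\<^bsub>Hom F [\<psi> y] [y]\<^esub>"
    by (simp add: add_scalar zero_scalar r_neg)
  then have "scalar (\<ominus> \<one>) = \<ominus>\<^bsub>Hom F [\<psi> y] [y]\<^esub> scalar \<one>"
    by (rule F.hom_minus_unique[rotated 2]) (use assms in simp_all)
  then show ?thesis by (simp add: Z_minus_def zeta_def scalar_def)
qed

lemma S_ob_eq: "S_ob R \<psi> x = ([x, \<psi> x], S)"
  by (simp add: S_ob_def)

text \<open>The predicate \<open>Q\<close> on underlying objects makes this applicable to the list of all
  indecomposable objects and to the list of the projective ones.\<close>

lemma indecs_eq: "{W \<in> indecs. Q (fst W)} = {S_ob R \<psi> x |x. x \<in> \<X> \<and> regular F \<psi> x \<and> Q [x, \<psi> x]} \<union>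
    {Z_plus R y |y. y \<in> \<X> \<and> singular F \<psi> y \<and> Q [y]} \<union>
    {Z_minus R F \<psi> y |y. y \<in> \<X> \<and> singular F \<psi> y \<and> Q [y]}" (is "?L = ?A \<union> ?B \<union> ?C")
proof -
  have "?A = {([x, \<psi> x], S) |x. x \<in> \<X> \<and> c x (\<psi> x) x \<noteq> 0 \<and> Q [x, \<psi> x]}"
    unfolding S_ob_eq using regular_iff by blast
  moreover have "?B = {([y], scalar \<one>) |y. y \<in> \<X> \<and> c y (\<psi> y) y = 0 \<and> Q [y]}"
    unfolding Z_plus_eq using singular_iff by blast
  moreover have "?C = {([y], scalar (\<ominus> \<one>)) |y. y \<in> \<X> \<and> c y (\<psi> y) y = 0 \<and> Q [y]}"
  proof (intro Collect_cong iff_exI)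
    fix W y
    show "(W = Z_minus R F \<psi> y \<and> y \<in> \<X> \<and> singular F \<psi> y \<and> Q [y]) \<longleftrightarrow>
        (W = ([y], scalar (\<ominus> \<one>)) \<and> y \<in> \<X> \<and> c y (\<psi> y) y = 0 \<and> Q [y])"
      using Z_minus_eq[of y] singular_iff[of y] by argo
  qed
  moreover have "?L = {([x, \<psi> x], S) |x. x \<in> \<X> \<and> c x (\<psi> x) x \<noteq> 0 \<and> Q [x, \<psi> x]} \<union>
      {([y], scalar \<one>) |y. y \<in> \<X> \<and> c y (\<psi> y) y = 0 \<and> Q [y]} \<union>
      {([y], scalar (\<ominus> \<one>)) |y. y \<in> \<X> \<and> c y (\<psi> y) y = 0 \<and> Q [y]}" (is "_ = ?R")
  proof (intro equalityI subsetI)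
    fix W assume "W \<in> ?L"
    then have Q: "Q (fst W)" and "W \<in> indecs" by blast+
    from this(2) consider
        (S) x where "W = ([x, \<psi> x], S)" "x \<in> \<X>" "c x (\<psi> x) x \<noteq> 0"
      | (plus) y where "W = ([y], scalar \<one>)" "y \<in> \<X>" "c y (\<psi> y) y = 0"
      | (minus) y where "W = ([y], scalar (\<ominus> \<one>))" "y \<in> \<X>" "c y (\<psi> y) y = 0"
      unfolding indecs_def by blast
    then show "W \<in> ?R"
    proof cases
      case S
      then have "Q [x, \<psi> x]" using Q by (simp only: fst_conv)
      with S show ?thesis by blast
    next
      case plus
      then have "Q [y]" using Q by (simp only: fst_conv)
      with plus show ?thesis by blast
    next
      case minus
      then have "Q [y]" using Q by (simp only: fst_conv)
      with minus show ?thesis by blast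
    qed
  next
    fix W assume "W \<in> ?R"
    then consider
        (S) x where "W = ([x, \<psi> x], S)" "x \<in> \<X>" "c x (\<psi> x) x \<noteq> 0" "Q [x, \<psi> x]"
      | (plus) y where "W = ([y], scalar \<one>)" "y \<in> \<X>" "c y (\<psi> y) y = 0" "Q [y]"
      | (minus) y where "W = ([y], scalar (\<ominus> \<one>))" "y \<in> \<X>" "c y (\<psi> y) y = 0" "Q [y]"
      by blast
    then have "W \<in> indecs \<and> Q (fst W)"
      unfolding indecs_def by cases (simp_all only: fst_conv, blast+)
    then show "W \<in> ?L" by blast
  qed
  ultimately show ?thesis by simp
qed

end

section \<open>Discrete valuation rings\<close>

text \<open>The uniformizer generates a maximal ideal. It is not zero, since otherwise \<open>R\<close> would be a
  field and have no nonzero prime ideal. Hence it is the unique nonzero prime ideal, and it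
  contains every non-unit \<open>a \<noteq> 0\<close> because any irreducible divisor of \<open>a\<close> generates a nonzero prime
  ideal too.\<close>

lemma discrete_valuation_ring_Unit_iff:
  fixes R (structure)
  assumes R: "discrete_valuation_ring R" and u: "uniformizer R u" and a: "a \<in> carrier R"
  shows "a \<in> Units R \<longleftrightarrow> a \<notin> PIdl u"
proof -
  interpret discrete_valuation_ring R by fact
  have uR: "u \<in> carrier R" and M: "maximalideal (PIdl u) R" using u by (auto simp: uniformizer_def)
  interpret M: maximalideal "PIdl u" R by fact
  have "PIdl u \<noteq> {\<zero>}"
  proof
    assume "PIdl u = {\<zero>}"
    then interpret field R using M zeromaximalideal_fieldI by simp
    obtain I where I: "primeideal I R" "I \<noteq> {\<zero>}" using unique_nonzero_prime by blast
    then have "I = carrier R" using all_ideals primeideal.axioms(1) by blast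
    then show False using primeideal.I_notcarr[OF I(1)] by blast
  qed
  then have unique: "I = PIdl u" if "primeideal I R" "I \<noteq> {\<zero>}" for I
    using unique_nonzero_prime maximalideal_prime[OF M] that by blast
  have "a \<in> PIdl u" if nu: "a \<notin> Units R"
  proof (cases "a = \<zero>")
    case True
    then show ?thesis using M.zero_closed by simp
  next
    case False
    then obtain b where b: "b \<in> carrier R" "ring_irreducible b" "b divides a"
      using exists_irreducible_divisor[of a] a nu by blast
    have "primeideal (PIdl b) R" using irreducible_imp_maximalideal[OF b(1,2)] maximalideal_prime by
        blast
    moreover have "PIdl b \<noteq> {\<zero>}" using ring_irreducibleE(1)[OF b(1,2)] cgenideal_self[OF b(1)] by
        blast
    ultimately have "PIdl b = PIdl u" using unique by blast
    then show ?thesis using to_contain_is_to_divide[OF b(1) a] b(3) cgenideal_self[OF a] by blast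
  qed
  moreover have "a \<notin> PIdl u" if "a \<in> Units R"
  proof
    assume "a \<in> PIdl u"
    then have "a \<otimes> inv a \<in> PIdl u" using M.I_r_closed[OF _ Units_inv_closed[OF that]] by blast
    then have "\<one> \<in> PIdl u" unfolding Units_r_inv[OF that] .
    then show False using M.one_imp_carrier M.I_notcarr by blast
  qed
  ultimately show ?thesis by blast
qed

lemma discrete_valuation_ring_local:
  fixes R (structure)
  assumes R: "discrete_valuation_ring R" and u: "uniformizer R u"
  shows "local_ring R" "u \<notin> Units R"
proof -
  interpret discrete_valuation_ring R by fact
  have uR: "u \<in> carrier R" and M: "maximalideal (PIdl u) R" using u by (auto simp: uniformizer_def)
  interpret M: maximalideal "PIdl u" R by fact
  note U = discrete_valuation_ring_Unit_iff[OF R u]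
  show "local_ring R"
    unfolding local_ring_def using ring_axioms one_not_zero U M.a_closed by auto
  show "u \<notin> Units R" using U[OF uR] cgenideal_self[OF uR] by blast
qed

text \<open>If \<open>2\<close> lies in the maximal ideal then, in the residue field, a multiple \<open>n \<cdot> 1\<close> is \<open>0\<close> for
  even \<open>n\<close> and \<open>1\<close> for odd \<open>n\<close>, so the characteristic is exactly \<open>2\<close>.\<close>

lemma two_Unit_of_residue_char:
  fixes R (structure)
  assumes R: "discrete_valuation_ring R" and u: "uniformizer R u" and ch: "ring_char (R Quot (PIdl
      u)) \<noteq> 2"
  shows "\<one> \<oplus> \<one> \<in> Units R"
proof (rule ccontr)
  interpret discrete_valuation_ring R by fact
  have uR: "u \<in> carrier R" and M: "maximalideal (PIdl u) R" using u by (auto simp: uniformizer_def)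
  interpret M: maximalideal "PIdl u" R by fact
  let ?Q = "R Quot (PIdl u)"
  interpret Q: ring ?Q by (rule M.quotient_is_ring)
  interpret h: ring_hom_ring R ?Q "(+>) (PIdl u)" by (rule M.rcos_ring_hom_ring)
  assume "\<one> \<oplus> \<one> \<notin> Units R"
  then have "\<one> \<oplus> \<one> \<in> PIdl u" using discrete_valuation_ring_Unit_iff[OF R u] by simp
  then have "PIdl u +> (\<one> \<oplus> \<one>) = PIdl u" by (rule M.a_rcos_const)
  moreover have Q0: "PIdl u = \<zero>\<^bsub>?Q\<^esub>" unfolding FactRing_def by simp
  moreover have "PIdl u +> (\<one> \<oplus> \<one>) = \<one>\<^bsub>?Q\<^esub> \<oplus>\<^bsub>?Q\<^esub> \<one>\<^bsub>?Q\<^esub>"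
    using h.hom_add[OF one_closed one_closed] unfolding h.hom_one .
  ultimately have "\<one>\<^bsub>?Q\<^esub> \<oplus>\<^bsub>?Q\<^esub> \<one>\<^bsub>?Q\<^esub> = \<zero>\<^bsub>?Q\<^esub>" by (simp only:)
  then have two: "[(2::nat)] \<cdot>\<^bsub>?Q\<^esub> \<one>\<^bsub>?Q\<^esub> = \<zero>\<^bsub>?Q\<^esub>" by (simp add: numeral_2_eq_2)
  have "\<one>\<^bsub>?Q\<^esub> \<noteq> \<zero>\<^bsub>?Q\<^esub>"
  proof
    assume "\<one>\<^bsub>?Q\<^esub> = \<zero>\<^bsub>?Q\<^esub>"
    then have "PIdl u +> \<one> = PIdl u" using Q0 h.hom_one by metis
    then have "\<one> \<in> PIdl u" using M.a_rcos_self[OF one_closed] by blast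
    then show False using M.one_imp_carrier M.I_notcarr by blast
  qed
  moreover have "[(2 * k + 1)] \<cdot>\<^bsub>?Q\<^esub> \<one>\<^bsub>?Q\<^esub> = \<one>\<^bsub>?Q\<^esub>" for k :: nat
  proof -
    have "[(2 * k)] \<cdot>\<^bsub>?Q\<^esub> \<one>\<^bsub>?Q\<^esub> = [k] \<cdot>\<^bsub>?Q\<^esub> ([(2::nat)] \<cdot>\<^bsub>?Q\<^esub> \<one>\<^bsub>?Q\<^esub>)"
      by (simp add: Q.add.nat_pow_pow)
    then show ?thesis unfolding two by simp
  qed
  ultimately have "even n" if "[(n::nat)] \<cdot>\<^bsub>?Q\<^esub> \<one>\<^bsub>?Q\<^esub> = \<zero>\<^bsub>?Q\<^esub>" for n
    using that by (metis oddE)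
  then have "ring_char ?Q = 2"
    unfolding ring_char_def using two by (intro Gcd_eqI) auto
  then show False using ch by blast
qed

section \<open>Uniqueness of the exact structure and the theorem\<close>

context local_cyclic_poset
begin

text \<open>The projective objects are exactly the sums of elements of \<open>\<X>\<^sub>0\<close>: a summand \<open>x\<close> of a
  projective object is projective and indecomposable, hence isomorphic to an element of \<open>\<X>\<^sub>0\<close>, and
  \<open>\<X>\<^sub>0\<close> is closed under isomorphism. So \<open>exact_iff_short_exact\<close> applies with these objects as the
  test objects.\<close>

lemma F_exact_unique:
  assumes frob: "frobenius_category R F E" and X0: "\<X>\<^sub>0 \<subseteq> \<X>"
    and closed: "\<forall>x \<in> \<X>\<^sub>0. \<forall>y \<in> \<X>. c x y x = 0 \<longrightarrow> y \<in> \<X>\<^sub>0"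
    and objs: "objects_up_to_iso F (\<lambda>A. indecomposable F A \<and> proj_inj F E A) {[x] |x. x \<in> \<X>\<^sub>0}"
  shows "E = F_exact F \<X>\<^sub>0"
proof -
  interpret E: frobenius_category R F E by fact
  have single: "projective F E [x] \<longleftrightarrow> x \<in> \<X>\<^sub>0" if x: "x \<in> \<X>" for x
  proof
    assume "projective F E [x]"
    then have "indecomposable F [x] \<and> proj_inj F E [x]"
      using x indecomposable_singleton E.projective_iff_injective by (simp add: proj_inj_def)
    then have "\<exists>B \<in> {[x] |x. x \<in> \<X>\<^sub>0}. isomorphic F [x] B"
      using objs x unfolding objects_up_to_iso_def by (simp only: Ob_F) auto
    then obtain x' where x': "x' \<in> \<X>\<^sub>0" "isomorphic F [x] [x']" by blast
    then have "c x' x x' = 0" using isomorphic_singletons_iff[of x x'] c_sym[of x x'] x X0 by auto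
    then show "x \<in> \<X>\<^sub>0" using closed x x' by blast
  next
    assume "x \<in> \<X>\<^sub>0"
    then show "projective F E [x]" using objs unfolding objects_up_to_iso_def proj_inj_def by blast
  qed
  have proj: "projective F E P \<longleftrightarrow> set P \<subseteq> \<X>\<^sub>0" if "set P \<subseteq> \<X>" for P
    using that
  proof (induction P)
    case Nil
    have "projective F E []"
      unfolding projective_def
    proof (intro conjI allI impI)
      fix Y Z g h assume gh: "deflation E Y Z g \<and> arr F [] Z h"
      have g: "arr F Y Z g" using gh E.deflation_arr by blast
      then have "set Y \<subseteq> \<X>" using F.arr_Ob[OF g] by simp
      then have "arr F [] Y \<zero>\<^bsub>Hom F [] Y\<^esub>" "Cmp F [] Y Z g \<zero>\<^bsub>Hom F [] Y\<^esub> = \<zero>\<^bsub>Hom F [] Z\<^esub>"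
        using F.arr_zero[of "[]" Y] F.Cmp_zero_right[OF _ g, of "[]"] by (simp_all only: Ob_F
            list.set empty_subsetI)
      moreover have "h = \<zero>\<^bsub>Hom F [] Z\<^esub>" using F.zero_object_from[OF zero_object_Nil] gh by blast
      ultimately show "\<exists>k. arr F [] Y k \<and> Cmp F [] Y Z g k = h" by blast
    qed simp
    then show ?case by simp
  next
    case (Cons x P)
    then have x: "x \<in> \<X>" and P: "set P \<subseteq> \<X>" by auto
    note b = biproduct_Cons[OF Cons.prems]
    note bD = F.biproductD[OF b]
    have "projective F E (x # P) \<longleftrightarrow> projective F E [x] \<and> projective F E P"
      using E.projective_biproduct[OF _ _ b] E.projective_retract[OF _ bD(1,2,5)]
        E.projective_retract[OF _ bD(3,4,6)] by blast
    then show ?case using Cons.IH[OF P] single[OF x] by simp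
  qed
  have "E A B D f g = F_exact F \<X>\<^sub>0 A B D f g" for A B D f g
    unfolding F_exact_def
  proof (rule E.exact_iff_short_exact[of "{P. set P \<subseteq> \<X>\<^sub>0}", simplified mem_Collect_eq Ball_def])
    fix P assume "set P \<subseteq> \<X>\<^sub>0"
    then show "projective F E P" using proj X0 by blast
    then show "injective F E P" using E.projective_iff_injective by blast
  next
    fix X assume X: "X \<in> Ob F"
    obtain P p where P: "projective F E P" "deflation E P X p" using E.enough_projectives[OF X] by
        blast
    then have "set P \<subseteq> \<X>\<^sub>0" using proj unfolding projective_def Ob_F by blast
    then show "\<exists>P \<in> {P. set P \<subseteq> \<X>\<^sub>0}. \<exists>p. deflation E P X p" using P by blast
  next
    fix X assume X: "X \<in> Ob F"
    obtain P p where P: "injective F E P" "inflation E X P p" using E.enough_injectives[OF X] by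
        blast
    then have "set P \<subseteq> \<X>\<^sub>0" using proj E.projective_iff_injective unfolding injective_def Ob_F by
        blast
    then show "\<exists>P \<in> {P. set P \<subseteq> \<X>\<^sub>0}. \<exists>p. inflation E X P p" using P by blast
  qed
  then show ?thesis by blast
qed

end

lemma short_exact_cong:
  assumes "\<And>x. x \<in> carrier L \<Longrightarrow> \<phi> x = \<phi>' x" "\<And>x. x \<in> carrier M \<Longrightarrow> \<gamma> x = \<gamma>' x"
  shows "short_exact L M N \<phi> \<gamma> \<longleftrightarrow> short_exact L M N \<phi>' \<gamma>'"
proof -
  have "inj_on \<phi> (carrier L) \<longleftrightarrow> inj_on \<phi>' (carrier L)" using assms(1) by (rule inj_on_cong)
  moreover have "\<phi> ` carrier L = \<phi>' ` carrier L" "\<gamma> ` carrier M = \<gamma>' ` carrier M"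
    using assms by (auto intro: image_cong)
  moreover have "{m \<in> carrier M. \<gamma> m = \<zero>\<^bsub>N\<^esub>} = {m \<in> carrier M. \<gamma>' m = \<zero>\<^bsub>N\<^esub>}" using assms(2) by auto
  ultimately show ?thesis unfolding short_exact_def by simp
qed

text \<open>Testing \<open>\<psi>A \<rightarrow> \<psi>B \<rightarrow> \<psi>K\<close> against \<open>P\<close> is the same as testing \<open>A \<rightarrow> B \<rightarrow> K\<close> against \<open>\<psi>P\<close>.\<close>

lemma (in involutive_cyclic_poset) F_exact_map:
  assumes E: "F_exact F \<X>\<^sub>0 A B K f g" and X0: "\<X>\<^sub>0 \<subseteq> \<X>" "\<psi> ` \<X>\<^sub>0 = \<X>\<^sub>0"
  shows "F_exact F \<X>\<^sub>0 (map \<psi> A) (map \<psi> B) (map \<psi> K) f g"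
proof -
  have f: "arr F A B f" and g: "arr F B K g" using E unfolding F_exact_def by blast+
  have o: "A \<in> Ob F" "B \<in> Ob F" "K \<in> Ob F" using F.arr_Ob[OF f] F.arr_Ob[OF g] by blast+
  have "short_exact (Hom F P (map \<psi> A)) (Hom F P (map \<psi> B)) (Hom F P (map \<psi> K))
      (Cmp F P (map \<psi> A) (map \<psi> B) f) (Cmp F P (map \<psi> B) (map \<psi> K) g) \<and>
    short_exact (Hom F (map \<psi> K) P) (Hom F (map \<psi> B) P) (Hom F (map \<psi> A) P)
      (\<lambda>h. Cmp F (map \<psi> B) (map \<psi> K) P h g) (\<lambda>h. Cmp F (map \<psi> A) (map \<psi> B) P h f)"
    if P: "set P \<subseteq> \<X>\<^sub>0" for P
  proof -
    let ?P = "map \<psi> P"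
    have P': "set ?P \<subseteq> \<X>\<^sub>0" using P X0 by auto
    then have oP: "?P \<in> Ob F" using X0 by auto
    have "set P \<subseteq> \<X>" using P X0(1) by blast
    then have e: "map \<psi> ?P = P" by (simp only: map_map map_\<psi>_\<psi>)
    have c: "\<And>X Y t. X \<in> Ob F \<Longrightarrow> Y \<in> Ob F \<Longrightarrow> t \<in> carrier (Hom F X Y) \<longleftrightarrow> arr F X Y t" by (simp add:
        arr_def)
    have H: "Hom F P (map \<psi> X) = Hom F ?P X" "Hom F (map \<psi> X) P = Hom F X ?P" for X
      using Hom_map[of ?P X] Hom_map[of X ?P] unfolding e by auto
    have s: "short_exact (Hom F ?P A) (Hom F ?P B) (Hom F ?P K) (Cmp F ?P A B f) (Cmp F ?P B K g)"
      "short_exact (Hom F K ?P) (Hom F B ?P) (Hom F A ?P) (\<lambda>h. Cmp F B K ?P h g) (\<lambda>h. Cmp F A B ?P h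
          f)"
      using E P' unfolding F_exact_def by blast+
    have "short_exact (Hom F ?P A) (Hom F ?P B) (Hom F ?P K)
        (Cmp F P (map \<psi> A) (map \<psi> B) f) (Cmp F P (map \<psi> B) (map \<psi> K) g)"
      using s(1)
    proof (rule short_exact_cong[THEN iffD1, rotated 2])
      show "Cmp F ?P A B f t = Cmp F P (map \<psi> A) (map \<psi> B) f t" if "t \<in> carrier (Hom F ?P A)" for t
        using Cmp_map[OF c[OF oP o(1), THEN iffD1, OF that] f] unfolding e by (rule sym)
      show "Cmp F ?P B K g t = Cmp F P (map \<psi> B) (map \<psi> K) g t" if "t \<in> carrier (Hom F ?P B)" for t
        using Cmp_map[OF c[OF oP o(2), THEN iffD1, OF that] g] unfolding e by (rule sym)
    qed
    moreover have "short_exact (Hom F K ?P) (Hom F B ?P) (Hom F A ?P)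
        (\<lambda>h. Cmp F (map \<psi> B) (map \<psi> K) P h g) (\<lambda>h. Cmp F (map \<psi> A) (map \<psi> B) P h f)"
      using s(2)
    proof (rule short_exact_cong[THEN iffD1, rotated 2])
      show "Cmp F B K ?P t g = Cmp F (map \<psi> B) (map \<psi> K) P t g" if "t \<in> carrier (Hom F K ?P)" for t
        using Cmp_map[OF g c[OF o(3) oP, THEN iffD1, OF that]] unfolding e by (rule sym)
      show "Cmp F A B ?P t f = Cmp F (map \<psi> A) (map \<psi> B) P t f" if "t \<in> carrier (Hom F B ?P)" for t
        using Cmp_map[OF f c[OF o(2) oP, THEN iffD1, OF that]] unfolding e by (rule sym)
    qed
    ultimately show ?thesis unfolding H by blast
  qed
  then show ?thesis
    unfolding F_exact_def using T.Tm_arr[OF f] T.Tm_arr[OF g] by blast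
qed

theorem theorem1p7p1:
  fixes R :: "'r ring" and u :: 'r
    and \<X> \<X>\<^sub>0 :: "'x set" and c :: "'x \<Rightarrow> 'x \<Rightarrow> 'x \<Rightarrow> nat" and \<psi> :: "'x \<Rightarrow> 'x"
  assumes "discrete_valuation_ring R" and "uniformizer R u"
    and "ring_char (R Quot (PIdl\<^bsub>R\<^esub> u)) \<noteq> 2"
    and "frobenius_cyclic_poset TYPE('r) \<X> c \<X>\<^sub>0"
    and "involution_action \<X> c \<X>\<^sub>0 \<psi>"
  defines "F \<equiv> addP R u \<X> c"
    and "E \<equiv> F_exact (addP R u \<X> c) \<X>\<^sub>0"
    and "F\<psi> \<equiv> F_psi R u \<X> c \<psi>"
    and "E\<psi> \<equiv> F_psi_exact R u \<X> c \<X>\<^sub>0 \<psi>"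
  shows "krull_schmidt_category R F\<psi> \<and>
    objects_up_to_iso F\<psi> (indecomposable F\<psi>)
      ({S_ob R \<psi> x |x. x \<in> \<X> \<and> regular F \<psi> x} \<union>
       {Z_plus R y |y. y \<in> \<X> \<and> singular F \<psi> y} \<union>
       {Z_minus R F \<psi> y |y. y \<in> \<X> \<and> singular F \<psi> y}) \<and>
    frobenius_category R F\<psi> E\<psi> \<and>
    objects_up_to_iso F\<psi> (\<lambda>A. indecomposable F\<psi> A \<and> proj_inj F\<psi> E\<psi> A)
      ({S_ob R \<psi> x |x. x \<in> \<X> \<and> regular F \<psi> x \<and> proj_inj F E [x]} \<union>
       {Z_plus R y |y. y \<in> \<X> \<and> singular F \<psi> y \<and> proj_inj F E [y]} \<union>
       {Z_minus R F \<psi> y |y. y \<in> \<X> \<and> singular F \<psi> y \<and> proj_inj F E [y]})"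
proof -
  note R = assms(1,2)
  interpret R: discrete_valuation_ring R by (rule assms(1))
  from assms(4) obtain E' where frob: "frobenius_category R F E'"
    and objs: "objects_up_to_iso F (\<lambda>A. indecomposable F A \<and> proj_inj F E' A) {[x] |x. x \<in> \<X>\<^sub>0}"
    and coc: "reduced_cocycle \<X> c" and X0: "\<X>\<^sub>0 \<subseteq> \<X>"
    and closed: "\<forall>x \<in> \<X>\<^sub>0. \<forall>y \<in> \<X>. c x y x = 0 \<longrightarrow> y \<in> \<X>\<^sub>0"
    using R unfolding frobenius_cyclic_poset_def F_def by blast
  have act: "\<And>x. x \<in> \<X> \<Longrightarrow> \<psi> x \<in> \<X>" "\<And>x. x \<in> \<X> \<Longrightarrow> \<psi> (\<psi> x) = x"
    "\<And>x y z. \<lbrakk>x \<in> \<X>; y \<in> \<X>; z \<in> \<X>\<rbrakk> \<Longrightarrow> c (\<psi> x) (\<psi> y) (\<psi> z) = c x y z" "\<psi> ` \<X>\<^sub>0 = \<X>\<^sub>0"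
    using assms(5) by (auto simp: involution_action_def)
  interpret frob: frobenius_category R F E' by (rule frob)
  interpret P: involutive_cyclic_poset R u \<X> c \<psi>
  proof (intro involutive_cyclic_poset.intro local_cyclic_poset.intro
      local_cyclic_poset_axioms.intro
      involutive_cyclic_poset_axioms.intro R.is_cring)
    show "u \<in> carrier R" using assms(2) by (simp add: uniformizer_def)
    show "additive_category R (addP R u \<X> c)" using frob.additive_category_axioms unfolding F_def .
  qed (use discrete_valuation_ring_local[OF R] coc act two_Unit_of_residue_char[OF assms(1-3)] in
      auto)
  have "E' = E" using P.F_exact_unique[OF frob[unfolded F_def] X0 closed objs[unfolded F_def]]
      unfolding E_def .
  then have frobE: "frobenius_category R F E" using frob by simp
  interpret E: frobenius_category R F E by (rule frobE)
  interpret G: involutive_frobenius_category R F "map \<psi>" "\<lambda>A B M. M" E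
  proof (intro involutive_frobenius_category.intro involutive_exact_category.intro
      involutive_exact_category_axioms.intro involutive_frobenius_category_axioms.intro)
    show "involutive_additive_category R F (map \<psi>) (\<lambda>A B M. M)"
      unfolding F_def by (rule P.T.involutive_additive_category_axioms)
    show "E (map \<psi> X) (map \<psi> Y) (map \<psi> Z) f g" if "E X Y Z f g" for X Y Z f g
      using P.F_exact_map[OF _ X0 act(4)] that unfolding E_def by blast
  qed (use E.exact_category_axioms frobE P.two in auto)
  have D: "F\<psi> = equivariant_cat F (map \<psi>) (\<lambda>A B M. M)" and ED: "E\<psi> = equivariant_exact F\<psi> E"
    unfolding F\<psi>_def E\<psi>_def F_def E_def by auto
  have L: "{W \<in> P.indecs. Q (fst W)} = {S_ob R \<psi> x |x. x \<in> \<X> \<and> regular F \<psi> x \<and> Q [x, \<psi> x]} \<union>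
    {Z_plus R y |y. y \<in> \<X> \<and> singular F \<psi> y \<and> Q [y]} \<union>
    {Z_minus R F \<psi> y |y. y \<in> \<X> \<and> singular F \<psi> y \<and> Q [y]}" for Q
    unfolding F_def by (rule P.indecs_eq)
  have indecs: "W \<in> Ob F\<psi> \<and> indecomposable F\<psi> W" if "W \<in> P.indecs" for W
    using P.indecs_local(1)[OF that] P.indecs_indecomposable[OF that] unfolding F\<psi>_def by blast
  have up_to_iso: "\<exists>B \<in> P.indecs. isomorphic F\<psi> A B" if "indecomposable F\<psi> A" for A
    using P.indecomposable_isomorphic_indecs[of A] that unfolding F\<psi>_def by blast
  have pi: "proj_inj F\<psi> E\<psi> A \<longleftrightarrow> A \<in> Ob F\<psi> \<and> projective F E (fst A)" for A
  proof -
    have "proj_inj F\<psi> E\<psi> A \<longleftrightarrow> projective F\<psi> E\<psi> A"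
      using G.D.projective_iff_injective[of A] unfolding proj_inj_def ED D by blast
    also have "\<dots> \<longleftrightarrow> A \<in> Ob F\<psi> \<and> projective F E (fst A)"
      using G.projective_D_iff[of "fst A" "snd A"] unfolding ED D prod.collapse .
    finally show ?thesis .
  qed
  have "krull_schmidt_category R F\<psi>" unfolding F\<psi>_def by (rule P.krull_schmidt_D)
  moreover have "objects_up_to_iso F\<psi> (indecomposable F\<psi>) P.indecs"
    unfolding objects_up_to_iso_def using indecs up_to_iso by blast
  moreover have "frobenius_category R F\<psi> E\<psi>"
    unfolding ED D by (rule G.D.frobenius_category_axioms)
  moreover have "objects_up_to_iso F\<psi> (\<lambda>A. indecomposable F\<psi> A \<and> proj_inj F\<psi> E\<psi> A)
      {W \<in> P.indecs. projective F E (fst W)}"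
    unfolding objects_up_to_iso_def
  proof (intro conjI ballI impI)
    fix A assume "A \<in> {W \<in> P.indecs. projective F E (fst W)}"
    then show "A \<in> Ob F\<psi>" "indecomposable F\<psi> A" "proj_inj F\<psi> E\<psi> A" using indecs pi by auto
  next
    fix A assume A: "A \<in> Ob F\<psi>" "indecomposable F\<psi> A \<and> proj_inj F\<psi> E\<psi> A"
    obtain B where B: "B \<in> P.indecs" "isomorphic F\<psi> A B" using up_to_iso A by blast
    obtain f g where fg: "arr F\<psi> A B f" "arr F\<psi> B A g" "Cmp F\<psi> B A B f g = Idn F\<psi> B"
      using B(2) unfolding isomorphic_def iso_arr_def by blast
    have "projective F\<psi> E\<psi> A" using A by (simp add: proj_inj_def)
    then have "projective F\<psi> E\<psi> B"
      using G.D.projective_retract[folded D, folded ED, OF _ fg(2,1,3)] by blast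
    then have "projective F E (fst B)" unfolding ED D by (cases B) (simp add: G.projective_D_iff)
    then show "\<exists>B \<in> {W \<in> P.indecs. projective F E (fst W)}. isomorphic F\<psi> A B" using B by blast
  qed
  moreover have "projective F E [x] \<longleftrightarrow> proj_inj F E [x]" for x
    using E.projective_iff_injective by (auto simp: proj_inj_def)
  \<comment> \<open>The theorem asks for \<open>x\<close> to be projective, whereas the underlying object of \<open>Sx\<close> is \<open>x \<oplus> \<psi>x\<close>.\<close>
  moreover have "projective F E [x, \<psi> x] \<longleftrightarrow> projective F E [x]" if x: "x \<in> \<X>" for x
  proof -
    note b = P.regular_biproduct[OF x, folded F_def]
    note bD = frob.biproductD[OF b]
    show ?thesis
      using E.projective_biproduct[OF _ _ b] E.projective_retract[OF _ bD(1,2,5)]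
        G.projective_To[of "[x]"] by blast
  qed
  ultimately show ?thesis
    using L[of "\<lambda>_. True"] L[of "projective F E"] by (simp cong: conj_cong)
qed

end
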